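(* Let $f(\tau)=\eta^4(2\tau)\eta^4(4\tau)=\sum_{n\ge1}a_nq^n$ and $L(f,s)=\sum_{n\ge1}a_nn^{-s}$. Then $$\frac{192}{\pi}L(f,4)=-8\int_0^1\frac{1+k^2}{1-k^2}K(k)K'(k)\log k\,dk,\qquad 7\pi\zeta(3)=-8\int_0^1\frac{2k}{1-k^2}K(k)K'(k)\log k\,dk.$$
   Context: $K(k)=\frac{\pi}{2}\,{}_2F_1\!\left(\tfrac12,\tfrac12;1;k^2\right)$ and $K'(k)=\frac{\pi}{2}\,{}_2F_1\!\left(\tfrac12,\tfrac12;1;1-k^2\right)$ are the complete elliptic integrals of the first kind; $\eta$ is the Dedekind eta function and $q=e^{2\pi i\tau}$. *)

theory Defs
  imports "HOL-Analysis.Analysis"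
begin

definition dedekind_eta :: "complex \<Rightarrow> complex" where
  "dedekind_eta \<tau> =
     exp (2 * of_real pi * \<i> * \<tau> / 24) *
     (\<Prod>n. 1 - exp (2 * of_real pi * \<i> * \<tau>) ^ Suc n)"

(* The coefficients a of f(tau) = sum_{n >= 0} a_n q^n, q = exp(2 pi i tau), on the upper
   half-plane.  They are unique if they exist; if f has no such expansion the value is
   unspecified. *)
definition q_coeff :: "(complex \<Rightarrow> complex) \<Rightarrow> nat \<Rightarrow> complex" where
  "q_coeff f = (THE a. \<forall>\<tau>. Im \<tau> > 0 \<longrightarrow>
     (\<lambda>n. a n * exp (2 * of_real pi * \<i> * \<tau>) ^ n) sums f \<tau>)"

(* The Dirichlet series itself, meaningful only where it converges; no continuation in s. *)
definition L_series :: "(complex \<Rightarrow> complex) \<Rightarrow> complex \<Rightarrow> complex" where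
  "L_series f s = (\<Sum>n. q_coeff f (Suc n) / of_nat (Suc n) powr s)"

(* The Riemann zeta function on its half-plane of convergence Re s > 1 only. *)
definition zeta_series :: "complex \<Rightarrow> complex" where
  "zeta_series s = (\<Sum>n. 1 / of_nat (Suc n) powr s)"

definition hyp2F1 :: "real \<Rightarrow> real \<Rightarrow> real \<Rightarrow> real \<Rightarrow> real" where
  "hyp2F1 a b c x = eval_fps (fps_hypergeo [a, b] [c] 1) x"

(* For real 0 < k < 1.  The series for ellK diverges at k = 1 and that for ellK' at k = 0. *)
definition ellK :: "real \<Rightarrow> real" where
  "ellK k = pi / 2 * hyp2F1 (1/2) (1/2) 1 (k\<^sup>2)"

definition ellK' :: "real \<Rightarrow> real" where
  "ellK' k = pi / 2 * hyp2F1 (1/2) (1/2) 1 (1 - k\<^sup>2)"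

definition eta_form :: "complex \<Rightarrow> complex" where
  "eta_form \<tau> = dedekind_eta (2 * \<tau>) ^ 4 * dedekind_eta (4 * \<tau>) ^ 4"

end

theory Submission
  imports Defs "HOL-Complex_Analysis.Complex_Analysis"
begin

text \<open>Put \<open>F t = \<^sub>2F\<^sub>1(1/2, 1/2; 1; t)\<close> and \<open>h t = F (1 - t) / F t\<close>, so that \<open>k\<^sup>2 = s\<close> corresponds to the
  nome \<open>q = exp (- \<pi> h s)\<close>.  Landen's transformation halves \<open>h\<close> and the theta functions satisfy the
  matching doubling identities; iterating both towards the cusp gives Jacobi's \<open>F s = \<theta>(q)\<^sup>2\<close>.  Under
  \<open>x = h s\<close> the weight four Lambert series become polynomials in \<open>\<surd>s\<close> times \<open>F(s)\<^sup>4\<close>, while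
  \<open>dx = - ds / (\<pi> s (1 - s) F(s)\<^sup>2)\<close>, so that integrals of such series against \<open>x\<^sup>p\<close> or against \<open>x ln \<kappa>\<close>
  are integrals of products of \<open>F s\<close> and \<open>F (1 - s)\<close>.

  For \<open>L(f, 4)\<close>, the eta quotient is a product of two weight two Eisenstein series; unfolding its Mellin
  transform into a four-fold sum, the Rogers--Zudilin substitution in each term turns it into the product
  of a weight four Eisenstein series and \<open>ln k\<close>.

  For \<open>\<zeta>(3)\<close>, term by term Mellin transforms give \<open>\<integral> F(t) F(1 - t) dt = \<pi> / 2\<close> and
  \<open>\<integral> F(t)\<^sup>2 dt = 14 \<zeta>(3) / \<pi>\<^sup>2\<close>.  The moments of \<open>F(t) F(1 - t)\<close> and the Taylor coefficients of \<open>F\<^sup>2\<close>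
  satisfy the same three-term recurrence, as both functions solve the symmetric square of the
  hypergeometric equation.  Hence the moments are \<open>\<pi> / 2\<close> times the coefficients, and pairing
  \<open>F(t) F(1 - t)\<close> with \<open>- ln (1 - t) / t = \<Sum> t\<^sup>n / (n + 1)\<close> gives \<open>\<pi> / 2\<close> times \<open>\<integral> F\<^sup>2\<close>.\<close>

section \<open>The hypergeometric function and Landen's transformation\<close>

text \<open>No modular transformation of theta functions is proved:
  \<open>h (1 - s) = 1 / h s\<close> follows from the definition of \<open>h\<close> and takes the
  place of \<tau> -> -1/\<tau>. Constants left open by differential equations are fixed by the
  logarithmic singularity of \<open>F\<close> at 1, hence by Wallis' product. The interchanges shape
  the rest. In the Rogers--Zudilin step all terms are nonnegative, so it runs in
  \<open>ennreal\<close> and asks for no convergence beforehand. The q-expansion of the eta quotient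
  has signs, and absolute convergence at 4 calls for coefficients of order below n^3. Jacobi's
  series for the cube of the Euler product gives |(q;q)|^3 = O(1 / (1 - |q|)), hence coefficients
  O(n^(8/3)). For zeta(3), single weight four series behave like x^(-4) at 0 and have no Mellin
  transform at the points in question; the combination \<open>Bc\<close> has one, once one of its
  two sums is put in closed form (\<open>psi\<close>). The factor 192 / pi is assembled from 6 / c^4
  with c = n pi / 2, the 1/16 in \<open>A_product\<close>, the 4 pi^3 of the change of variables and
  the 8 of the statement.\<close>

definition hcoef :: "nat \<Rightarrow> real" where
  "hcoef n = (pochhammer (1/2) n / fact n)\<^sup>2"

definition Ffps :: "real fps" where "Ffps = Abs_fps hcoef"

definition F :: "real \<Rightarrow> real" where "F z = eval_fps Ffps z"

definition dF :: "real \<Rightarrow> real" where "dF z = eval_fps (fps_deriv Ffps) z"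

lemma hcoef_0 [simp]: "hcoef 0 = 1"
  by (simp add: hcoef_def)

lemma hcoef_Suc: "hcoef (Suc n) = hcoef n * ((real n + 1/2) / (real n + 1))\<^sup>2"
  by (simp add: hcoef_def pochhammer_Suc power_divide power_mult_distrib add_ac)

lemma hcoef_pos: "hcoef n > 0"
  by (simp add: hcoef_def pochhammer_pos less_imp_neq[OF pochhammer_pos, symmetric] zero_less_power2)

lemma hyp2F1_eq_F: "hyp2F1 (1/2) (1/2) 1 x = F x"
proof -
  have "fps_hypergeo [1/2, 1/2] [1] (1::real) = Ffps"
    by (rule fps_ext)
       (simp add: Ffps_def hcoef_def pochhammer_fact[symmetric] power2_eq_square)
  then show ?thesis by (simp add: hyp2F1_def F_def)
qed

text \<open>\<open>hcoef n\<close> is the square of binomial(2n, n) / 4^n, so up to the factor 2n +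
  1 it is the reciprocal of a partial Wallis product. The pi in the asymptotics of \<open>F\<close>
  comes from here.\<close>

lemma wallis_hcoef: "hcoef n * (2 * real n + 1) * (\<Prod>k=1..n. (4*real k^2) / (4*real k^2 - 1)) = 1"
proof (induction n)
  case (Suc n)
  define w where "w = (\<Prod>k=1..n. (4*real k^2) / (4*real k^2 - 1))"
  have ne: "4 * real (Suc n)^2 - 1 = (2 * real n + 1) * (2 * real n + 3)"
    by (simp add: power2_eq_square algebra_simps)
  have pos: "real n + 1 \<noteq> 0" "2 * real n + 1 \<noteq> 0" "2 * real n + 3 \<noteq> 0"
    using of_nat_0_le_iff[of n, where 'a = real] by linarith+
  have "(\<Prod>k=1..Suc n. (4*real k^2) / (4*real k^2 - 1))
      = w * ((4 * (real n + 1)\<^sup>2) / ((2 * real n + 1) * (2 * real n + 3)))"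
    unfolding w_def ne[symmetric] by (simp add: add.commute)
  moreover have "2 * real (Suc n) + 1 = 2 * real n + 3" by simp
  ultimately have "hcoef (Suc n) * (2 * real (Suc n) + 1) * (\<Prod>k=1..Suc n. (4*real k^2) / (4*real k^2 - 1))
     = hcoef n * ((real n + 1/2) / (real n + 1))\<^sup>2 * (2 * real n + 3) *
       (w * ((4 * (real n + 1)\<^sup>2) / ((2 * real n + 1) * (2 * real n + 3))))"
    by (simp only: hcoef_Suc)
  also have "\<dots> = hcoef n * (2 * real n + 1) * w"
    using pos by (simp add: divide_simps power2_eq_square) (simp add: algebra_simps)
  finally show ?case using Suc.IH unfolding w_def by (rule trans)
qed simp

lemma hcoef_lim: "(\<lambda>n. hcoef n * (2 * real n + 1)) \<longlonglongrightarrow> 2 / pi"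
proof -
  have "(\<lambda>n. inverse (\<Prod>k=1..n. (4*real k^2) / (4*real k^2 - 1))) \<longlonglongrightarrow> inverse (pi/2)"
    by (intro tendsto_inverse wallis) auto
  moreover have "inverse (\<Prod>k=1..n. (4*real k^2) / (4*real k^2 - 1)) = hcoef n * (2 * real n + 1)" for n
    by (rule inverse_unique, subst mult.commute, rule wallis_hcoef)
  ultimately show ?thesis by (simp only: inverse_divide)
qed

lemma hcoef_lim': "(\<lambda>n. real n * hcoef n) \<longlonglongrightarrow> 1 / pi"
proof -
  have a: "(\<lambda>n. real n / (2 * real n + 1)) \<longlonglongrightarrow> 1/2" by real_asymp
  have "(\<lambda>n. hcoef n * (2 * real n + 1) * (real n / (2 * real n + 1))) \<longlonglongrightarrow> 2 / pi * (1/2)"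
    by (intro tendsto_mult hcoef_lim a)
  moreover have "hcoef n * (2 * real n + 1) * (real n / (2 * real n + 1)) = real n * hcoef n" for n
    using of_nat_0_le_iff[of n, where 'a = real] by simp
  ultimately show ?thesis by (simp only: times_divide_eq_right mult_1_right) simp
qed

text \<open>The sequence with weight 2n + 1 decreases to its limit, while the one with weight n in
  \<open>hcoef_upper\<close> increases to its limit. Together they bracket \<open>hcoef n\<close> by
  1 / (pi (n + 1)) and 1 / (pi n), the coefficients of a logarithm.\<close>

lemma hcoef_lower: "hcoef n \<ge> 1 / pi / (real n + 1)"
proof -
  have "decseq (\<lambda>n. hcoef n * (2 * real n + 1))"
  proof (rule decseq_SucI)
    fix n
    have pos: "real n + 1 > 0" by simp
    have "((real n + 1/2) / (real n + 1))\<^sup>2 * (2 * real n + 3) \<le> 2 * real n + 1"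
      using pos by (simp add: power_divide divide_simps power2_eq_square) (simp add: algebra_simps)
    from mult_left_mono[OF this, of "hcoef n"]
    show "hcoef (Suc n) * (2 * real (Suc n) + 1) \<le> hcoef n * (2 * real n + 1)"
      using hcoef_pos[of n] by (simp add: hcoef_Suc algebra_simps)
  qed
  from decseq_ge[OF this hcoef_lim, of n] have "2 / pi \<le> hcoef n * (2 * real n + 1)" .
  also have "\<dots> \<le> hcoef n * (2 * (real n + 1))"
    using hcoef_pos[of n] by (intro mult_left_mono) auto
  also have "\<dots> = 2 * (hcoef n * (real n + 1))" by simp
  finally have "1 / pi \<le> hcoef n * (real n + 1)" by simp
  then show ?thesis by (subst pos_divide_le_eq) auto
qed

lemma hcoef_upper: "real n * hcoef n \<le> 1 / pi"
proof -
  have "incseq (\<lambda>n. real n * hcoef n)"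
  proof (rule incseq_SucI)
    fix n
    have pos: "real n + 1 > 0" by simp
    have "real n \<le> ((real n + 1/2) / (real n + 1))\<^sup>2 * (real n + 1)"
      using pos by (simp add: power_divide divide_simps power2_eq_square) (simp add: algebra_simps)
    from mult_left_mono[OF this, of "hcoef n"]
    show "real n * hcoef n \<le> real (Suc n) * hcoef (Suc n)"
      using hcoef_pos[of n] by (simp add: hcoef_Suc algebra_simps)
  qed
  from incseq_le[OF this hcoef_lim'] show ?thesis .
qed

lemma hcoef_le1: "hcoef n \<le> 1"
proof (cases "n = 0")
  case False
  then have "hcoef n \<le> real n * hcoef n" using hcoef_pos[of n] by simp
  also have "\<dots> \<le> 1 / pi" by (rule hcoef_upper)
  also have "\<dots> \<le> 1" using pi_gt3 by simp
  finally show ?thesis .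
qed simp

lemma summable_hcoef: "norm z < 1 \<Longrightarrow> summable (\<lambda>n. hcoef n * z ^ n)" for z :: real
  by (rule summable_comparison_test'[of "\<lambda>n. norm z ^ n" 0])
     (simp_all add: abs_mult power_abs abs_of_pos[OF hcoef_pos] mult_left_le_one_le hcoef_le1 less_imp_le[OF hcoef_pos])

lemma Ffps_radius: "fps_conv_radius Ffps \<ge> 1"
  unfolding fps_conv_radius_def Ffps_def fps_nth_Abs_fps
  by (rule conv_radius_geI_ex') (auto intro!: summable_hcoef)

lemma Ffps_radius': "norm z < 1 \<Longrightarrow> ereal (norm z) < fps_conv_radius Ffps"
  using Ffps_radius by (metis ereal_less(3) less_le_trans)

lemma F_sums: "norm z < 1 \<Longrightarrow> (\<lambda>n. hcoef n * z ^ n) sums F z"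
  using summable_hcoef[of z] by (simp add: F_def eval_fps_def Ffps_def summable_sums)

lemma F_0 [simp]: "F 0 = 1"
  by (simp add: F_def eval_fps_at_0 Ffps_def)

lemma dF_radius': "norm z < 1 \<Longrightarrow> ereal (norm z) < fps_conv_radius (fps_deriv Ffps)"
  using Ffps_radius' fps_conv_radius_deriv by (metis order.strict_trans2)

lemma ddF_radius': "norm z < 1 \<Longrightarrow> ereal (norm z) < fps_conv_radius (fps_deriv (fps_deriv Ffps))"
  using dF_radius' fps_conv_radius_deriv by (metis order.strict_trans2)

lemma F_deriv:
  assumes "norm z < 1" shows "(F has_field_derivative dF z) (at z)"
  unfolding F_def[abs_def] dF_def
  by (rule has_field_derivative_eval_fps) (use Ffps_radius'[OF assms] in \<open>simp add: in_eball_iff\<close>)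

text \<open>The hypergeometric equation, kept formal so that it serves both the analytic
  \<open>pdF_deriv\<close> and the coefficient recurrence \<open>gc_rec\<close>.\<close>

lemma Ffps_ode: "fps_X * (1 - fps_X) * fps_deriv (fps_deriv Ffps) + (1 - 2 * fps_X) * fps_deriv Ffps
    = fps_const (1/4) * Ffps"
proof (rule fps_ext)
  fix n
  have rec: "hcoef (Suc n) * (real n + 1)^2 = hcoef n * (real n + 1/2)^2" for n
    by (simp add: hcoef_Suc power_divide add_nonneg_eq_0_iff)
  have 2: "fps_nth ((1 - 2 * fps_X) * fps_deriv Ffps) n = (real n + 1) * hcoef (Suc n) - 2 * real n * hcoef n"
    by (cases n) (simp_all add: Ffps_def ring_distribs mult.assoc numeral_fps_const)
  have 1: "fps_nth (fps_X * (1 - fps_X) * fps_deriv (fps_deriv Ffps)) n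
     = real n * (real n + 1) * hcoef (Suc n) - real n * (real n - 1) * hcoef n"
  proof (cases n)
    case (Suc m)
    then show ?thesis
      by (cases m) (simp_all add: Ffps_def ring_distribs mult.assoc)
  qed (simp add: mult.assoc)
  show "fps_nth (fps_X * (1 - fps_X) * fps_deriv (fps_deriv Ffps) + (1 - 2 * fps_X) * fps_deriv Ffps) n
     = fps_nth (fps_const (1/4) * Ffps) n"
    unfolding fps_add_nth 1 2 using rec[of n] by (simp add: Ffps_def power2_eq_square algebra_simps)
qed

text \<open>The equation in self-adjoint form. Treating z (1 - z) F' as a quantity of its own keeps
  second derivatives out of every Wronskian that follows.\<close>

lemma pdF_deriv:
  assumes "norm z < 1"
  shows "((\<lambda>z. z * (1 - z) * dF z) has_field_derivative F z / 4) (at z)"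
proof -
  let ?D = "eval_fps (fps_deriv (fps_deriv Ffps))"
  have d: "(dF has_field_derivative ?D z) (at z)"
    unfolding dF_def[abs_def]
    by (rule has_field_derivative_eval_fps) (use dF_radius'[OF assms] in \<open>simp add: in_eball_iff\<close>)
  have rX: "fps_conv_radius (1 - fps_X :: real fps) = \<infinity>" "fps_conv_radius (1 - 2 * fps_X :: real fps) = \<infinity>"
    "fps_conv_radius (fps_X * (1 - fps_X) :: real fps) = \<infinity>" "fps_conv_radius (2 * fps_X :: real fps) = \<infinity>"
  proof -
    have a: "fps_conv_radius (1 - fps_X :: real fps) \<ge> min (fps_conv_radius (1::real fps)) (fps_conv_radius (fps_X::real fps))"
      by (rule fps_conv_radius_diff)
    then show a': "fps_conv_radius (1 - fps_X :: real fps) = \<infinity>" by simp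
    have "fps_conv_radius (2 * fps_X :: real fps) \<ge> min (fps_conv_radius (2::real fps)) (fps_conv_radius (fps_X::real fps))"
      by (rule fps_conv_radius_mult)
    then show b: "fps_conv_radius (2 * fps_X :: real fps) = \<infinity>" by simp
    have "fps_conv_radius (1 - 2 * fps_X :: real fps) \<ge> min (fps_conv_radius (1::real fps)) (fps_conv_radius (2 * fps_X::real fps))"
      by (rule fps_conv_radius_diff)
    then show "fps_conv_radius (1 - 2 * fps_X :: real fps) = \<infinity>" using b by simp
    have "fps_conv_radius (fps_X * (1 - fps_X) :: real fps) \<ge> min (fps_conv_radius (fps_X::real fps)) (fps_conv_radius (1 - fps_X::real fps))"
      by (rule fps_conv_radius_mult)
    then show "fps_conv_radius (fps_X * (1 - fps_X) :: real fps) = \<infinity>" using a' by simp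
  qed
  have r1: "ereal (norm z) < fps_conv_radius (fps_X * (1 - fps_X) * fps_deriv (fps_deriv Ffps))"
    using fps_conv_radius_mult[of "fps_X * (1 - fps_X)" "fps_deriv (fps_deriv Ffps)"] ddF_radius'[OF assms]
    by (simp add: rX del: real_norm_def)
  have r2: "ereal (norm z) < fps_conv_radius ((1 - 2 * fps_X) * fps_deriv Ffps)"
    using fps_conv_radius_mult[of "1 - 2 * fps_X" "fps_deriv Ffps"] dF_radius'[OF assms]
    by (simp add: rX del: real_norm_def)
  have "z * (1 - z) * ?D z + (1 - 2 * z) * dF z = F z / 4"
  proof -
    have "eval_fps (fps_X * (1 - fps_X) * fps_deriv (fps_deriv Ffps) + (1 - 2 * fps_X) * fps_deriv Ffps) z
      = eval_fps (fps_const (1/4) * Ffps) z" by (simp add: Ffps_ode)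
    then show ?thesis using r1 r2 assms ddF_radius'[OF assms] dF_radius'[OF assms] Ffps_radius'[OF assms]
      by (simp add: eval_fps_add eval_fps_mult eval_fps_diff rX F_def dF_def del: real_norm_def)
  qed
  moreover have "((\<lambda>z. z * (1 - z) * dF z) has_field_derivative (z * (1 - z) * ?D z + (1 - 2 * z) * dF z)) (at z)"
    by (rule derivative_eq_intros d refl | simp add: algebra_simps)+
  ultimately show ?thesis by metis
qed

lemma F_ge1: "0 \<le> z \<Longrightarrow> z < 1 \<Longrightarrow> F z \<ge> 1"
proof -
  assume z: "0 \<le> z" "z < 1"
  have "sum (\<lambda>n. hcoef n * z ^ n) {..<1} \<le> F z"
    using sum_le_suminf[OF summable_hcoef, of z "{..<1}"] z hcoef_pos F_sums[of z]
    by (auto simp: sums_iff less_imp_le)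
  then show ?thesis by simp
qed

lemma F_pos: "0 \<le> z \<Longrightarrow> z < 1 \<Longrightarrow> F z > 0"
  using F_ge1[of z] by linarith

lemma sums_le': "f sums a \<Longrightarrow> (\<And>n. f n \<le> g n) \<Longrightarrow> g sums b \<Longrightarrow> a \<le> b" for f g :: "nat \<Rightarrow> real"
  by (rule sums_le)

text \<open>Termwise comparison with the logarithm series; the extra power of 1 - t absorbs the
  shift between n and n + 1.\<close>

lemma F_lower:
  assumes "0 < t" "t < 1" shows "F (1 - t) \<ge> - ln t / pi"
proof -
  have s: "(\<lambda>n. (1 - t) ^ Suc n / real (Suc n)) sums (- ln t)"
  proof -
    have "(\<lambda>n. - ((- (-(1-t))) ^ n) / real n) sums ln (1 + -(1-t))"
      using assms by (intro ln_series') auto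
    from sums_minus[OF this] have "(\<lambda>n. (1-t) ^ n / real n) sums (- ln t)" by simp
    then show ?thesis using sums_Suc_iff[of "\<lambda>n. (1-t) ^ n / real n" "- ln t"] by simp
  qed
  have "(\<lambda>n. 1 / pi * ((1 - t) ^ Suc n / real (Suc n))) sums (1 / pi * (- ln t))"
    by (intro sums_mult s)
  moreover have "1 / pi * ((1 - t) ^ Suc n / real (Suc n)) \<le> hcoef n * (1 - t) ^ n" for n
  proof -
    have "1 / pi * ((1 - t) ^ Suc n / real (Suc n)) = (1 / pi / (real n + 1)) * (1 - t) ^ Suc n"
      by (simp add: field_simps)
    also have "\<dots> \<le> hcoef n * (1 - t) ^ n"
      using hcoef_lower[of n] hcoef_pos[of n] assms
      by (intro mult_mono power_decreasing) auto
    finally show ?thesis .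
  qed
  moreover have "(\<lambda>n. hcoef n * (1 - t) ^ n) sums F (1 - t)"
    using assms by (intro F_sums) auto
  ultimately have "1 / pi * (- ln t) \<le> F (1 - t)" by (rule sums_le')
  then show ?thesis by simp
qed

lemma F_upper:
  assumes "0 < t" "t < 1" shows "F (1 - t) \<le> 1 - ln t / pi"
proof -
  have "(\<lambda>n. - ((- (-(1-t))) ^ n) / real n) sums ln (1 + -(1-t))"
    using assms by (intro ln_series') auto
  from sums_minus[OF this] have "(\<lambda>n. (1-t) ^ n / real n) sums (- ln t)" by simp
  then have "(\<lambda>n. 1 / pi * ((1-t) ^ n / real n)) sums (1 / pi * (- ln t))" by (intro sums_mult)
  moreover have "(\<lambda>n. if n = 0 then 1 else 0 :: real) sums 1"
    using sums_If_finite[of "\<lambda>n. n = 0" "\<lambda>_. 1::real"] by simp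
  ultimately have B: "(\<lambda>n. (if n = 0 then 1 else 0) + 1 / pi * ((1-t) ^ n / real n)) sums (1 + 1 / pi * (- ln t))"
    by (intro sums_add)
  have C: "hcoef n * (1 - t) ^ n \<le> (if n = 0 then 1 else 0) + 1 / pi * ((1 - t) ^ n / real n)" for n
  proof (cases "n = 0")
    case False
    have "hcoef n \<le> 1 / pi / real n"
      using hcoef_upper[of n] False by (simp add: field_simps)
    from mult_right_mono[OF this, of "(1 - t) ^ n"] show ?thesis using assms False by simp
  qed simp
  have A: "(\<lambda>n. hcoef n * (1 - t) ^ n) sums F (1 - t)"
    using assms by (intro F_sums) auto
  have "F (1 - t) \<le> 1 + 1 / pi * (- ln t)" by (rule sums_le'[OF A C B])
  then show ?thesis by simp
qed

lemma dF_sums: "norm z < 1 \<Longrightarrow> (\<lambda>n. (real n + 1) * hcoef (Suc n) * z ^ n) sums dF z"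
proof -
  assume "norm z < 1"
  then have "summable (\<lambda>n. fps_nth (fps_deriv Ffps) n * z ^ n)"
    by (intro summable_fps dF_radius')
  then show ?thesis by (simp add: dF_def eval_fps_def Ffps_def summable_sums add.commute)
qed

lemma dF_nonneg:
  assumes "0 \<le> z" "z < 1" shows "dF z \<ge> 0"
proof -
  have "(\<lambda>n. (real n + 1) * hcoef (Suc n) * z ^ n) sums dF z"
    using assms by (intro dF_sums) auto
  moreover have "0 \<le> (real n + 1) * hcoef (Suc n) * z ^ n" for n
    using assms hcoef_pos[of "Suc n"] by simp
  ultimately show ?thesis by (rule sums_le[OF _ sums_zero, rotated 1])
qed

lemma dF_upper:
  assumes "0 \<le> z" "z < 1" shows "(1 - z) * dF z \<le> 1"
proof -
  have "(\<lambda>n. (real n + 1) * hcoef (Suc n) * z ^ n) sums dF z"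
    using assms by (intro dF_sums) auto
  moreover have "(real n + 1) * hcoef (Suc n) * z ^ n \<le> z ^ n" for n
  proof -
    have "(real n + 1) * hcoef (Suc n) \<le> 1 / pi" using hcoef_upper[of "Suc n"] by (simp add: add.commute)
    also have "\<dots> \<le> 1" using pi_gt3 by simp
    finally show ?thesis using assms hcoef_pos[of "Suc n"] by (intro mult_left_le_one_le) auto
  qed
  moreover have "(\<lambda>n. z ^ n) sums (1 / (1 - z))"
    using assms by (intro geometric_sums) auto
  ultimately have "dF z \<le> 1 / (1 - z)" by (rule sums_le')
  then show ?thesis using assms by (simp add: field_simps)
qed

lemma F_cont: "norm z < 1 \<Longrightarrow> isCont F z"
  using F_deriv DERIV_isCont by blast

lemma F_deriv_at_1_minus:
  assumes "0 < t" "t < 1"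
  shows "((\<lambda>t. F (1 - t)) has_field_derivative - dF (1 - t)) (at t)"
proof -
  have "((\<lambda>t. F (1 - t)) has_field_derivative dF (1 - t) * (-1)) (at t)"
    by (rule DERIV_chain2[OF F_deriv]) (use assms in \<open>auto intro!: derivative_eq_intros\<close>)
  then show ?thesis by simp
qed

lemma pdF_deriv_at_1_minus:
  assumes "0 < t" "t < 1"
  shows "((\<lambda>t. t * (1 - t) * dF (1 - t)) has_field_derivative - F (1 - t) / 4) (at t)"
proof -
  have "((\<lambda>t. (1 - t) * (1 - (1 - t)) * dF (1 - t)) has_field_derivative F (1 - t) / 4 * (-1)) (at t)"
    by (rule DERIV_chain2[OF pdF_deriv]) (use assms in \<open>auto intro!: derivative_eq_intros\<close>)
  then show ?thesis by (simp add: mult_ac)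
qed

section \<open>The quotient of the two solutions and its derivative\<close>

definition h :: "real \<Rightarrow> real" where "h t = F (1 - t) / F t"

text \<open>\<open>F_lower\<close> and \<open>F_upper\<close> enclose the quotient. The limit
  supplies the constant both in \<open>h_deriv\<close> and in \<open>h_lam\<close>, where invariance
  arguments leave one factor open.\<close>

lemma h_ratio_lim: "((\<lambda>t. h t / - ln t) \<longlongrightarrow> 1 / pi) (at_right 0)"
proof -
  have F: "(F \<longlongrightarrow> 1) (at_right 0)"
    using F_cont[of 0] by (simp add: continuous_at filterlim_at_split)
  have ev: "eventually (\<lambda>t::real. 0 < t \<and> t < 1) (at_right 0)"
    by (rule eventually_at_rightI[of 0 1]) auto
  have "((\<lambda>t. F (1 - t) / - ln t) \<longlongrightarrow> 1 / pi) (at_right 0)"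
  proof (rule tendsto_sandwich)
    show "\<forall>\<^sub>F t in at_right 0. 1 / pi \<le> F (1 - t) / - ln t"
      using ev by eventually_elim (use F_lower in \<open>force simp: field_simps\<close>)
    show "\<forall>\<^sub>F t in at_right 0. F (1 - t) / - ln t \<le> (1 - ln t / pi) / - ln t"
      using ev by eventually_elim (use F_upper in \<open>auto intro!: divide_right_mono_neg simp del: divide_minus_right simp: ln_less_zero less_imp_le divide_le_cancel\<close>)
    show "((\<lambda>t. (1 - ln t / pi) / - ln t) \<longlongrightarrow> 1 / pi) (at_right 0)"
      by (real_asymp simp: field_simps)
  qed auto
  from tendsto_divide[OF this F] show ?thesis
    by (simp add: h_def mult.commute)
qed

lemma h_deriv:
  assumes t: "0 < t" "t < 1"
  shows "(h has_field_derivative - 1 / (pi * t * (1 - t) * (F t)\<^sup>2)) (at t)"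
proof -
  \<comment> \<open>Up to sign, t (1 - t) times the Wronskian of the solutions \<open>F t\<close>
    and \<open>F (1 - t)\<close>; by Abel's identity it is constant.\<close>
  define W where "W = (\<lambda>t. F t * (t * (1 - t) * dF (1 - t)) + F (1 - t) * (t * (1 - t) * dF t))"
  have Wd: "(W has_field_derivative 0) (at t)" if "0 < t" "t < 1" for t
    unfolding W_def
  proof -
    have "((\<lambda>t. F t * (t * (1 - t) * dF (1 - t)) + F (1 - t) * (t * (1 - t) * dF t)) has_field_derivative
        (dF t * (t * (1 - t) * dF (1 - t)) + - F (1 - t) / 4 * F t) +
        (- dF (1 - t) * (t * (1 - t) * dF t) + F t / 4 * F (1 - t))) (at t)"
      using that by (intro DERIV_add DERIV_mult F_deriv pdF_deriv F_deriv_at_1_minus pdF_deriv_at_1_minus) auto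
    then show "((\<lambda>t. F t * (t * (1 - t) * dF (1 - t)) + F (1 - t) * (t * (1 - t) * dF t)) has_field_derivative 0) (at t)"
      by (simp add: algebra_simps)
  qed
  have "\<exists>c. \<forall>t\<in>{0<..<1}. W t = c"
    by (rule has_field_derivative_zero_constant) (auto intro!: DERIV_subset[OF Wd])
  then obtain c where c: "\<And>t. 0 < t \<Longrightarrow> t < 1 \<Longrightarrow> W t = c" by auto
  have hd: "(h has_field_derivative - c / (t * (1 - t) * (F t)\<^sup>2)) (at t)" if "0 < t" "t < 1" for t
  proof -
    have Fp: "F t > 0" using F_pos[of t] that by simp
    have "(h has_field_derivative (- dF (1 - t) * F t - F (1 - t) * dF t) / (F t * F t)) (at t)"
      unfolding h_def[abs_def]
      by (rule DERIV_divide F_deriv F_deriv_at_1_minus | use that Fp in force)+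
    moreover have "(- dF (1 - t) * F t - F (1 - t) * dF t) / (F t * F t) = - c / (t * (1 - t) * (F t)\<^sup>2)"
      using that Fp c[OF that] by (simp add: W_def divide_simps power2_eq_square) (simp add: algebra_simps)
    ultimately show ?thesis by simp
  qed
  have ev: "eventually (\<lambda>t::real. 0 < t \<and> t < 1) (at_right 0)"
    by (rule eventually_at_rightI[of 0 1]) auto
  have F: "(F \<longlongrightarrow> 1) (at_right 0)"
    using F_cont[of 0] by (simp add: continuous_at filterlim_at_split)
  \<comment> \<open>The quotient of derivatives tends to \<open>c\<close>, the quotient of the
    functions to a known limit, so l'Hopital's rule determines \<open>c\<close>.\<close>
  have "((\<lambda>t. h t / - ln t) \<longlongrightarrow> c) (at_right 0)"
  proof (rule lhopital_right_0_at_top)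
    show "LIM t at_right 0. - ln (t::real) :> at_top" by real_asymp
    show "\<forall>\<^sub>F t in at_right 0. - (1 / t) \<noteq> (0::real)"
      using ev by eventually_elim auto
    show "\<forall>\<^sub>F t in at_right 0. (h has_field_derivative - c / (t * (1 - t) * (F t)\<^sup>2)) (at t)"
      using ev by eventually_elim (use hd in auto)
    show "\<forall>\<^sub>F t::real in at_right 0. ((\<lambda>t. - ln t) has_field_derivative - (1 / t)) (at t)"
      using ev by eventually_elim (auto intro!: derivative_eq_intros)
    have "((\<lambda>t. c / ((1 - t) * (F t)\<^sup>2)) \<longlongrightarrow> c / ((1 - 0) * 1\<^sup>2)) (at_right 0)"
      by (intro tendsto_intros F) auto
    then have l: "((\<lambda>t. c / ((1 - t) * (F t)\<^sup>2)) \<longlongrightarrow> c) (at_right 0)" by simp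
    have "\<forall>\<^sub>F t in at_right 0. c / ((1 - t) * (F t)\<^sup>2) = - c / (t * (1 - t) * (F t)\<^sup>2) / - (1 / t)"
      using ev by eventually_elim simp
    from Lim_transform_eventually[OF l this]
    show "((\<lambda>t. - c / (t * (1 - t) * (F t)\<^sup>2) / - (1 / t)) \<longlongrightarrow> c) (at_right 0)" .
  qed
  from tendsto_unique[OF _ this h_ratio_lim] have "c = 1 / pi" by simp
  with hd[OF t] show ?thesis by (simp add: mult_ac)
qed

lemma h_pos: "0 < t \<Longrightarrow> t < 1 \<Longrightarrow> h t > 0"
  by (simp add: h_def F_pos)

lemma h_strict_antimono:
  assumes "0 < s" "s < t" "t < 1" shows "h t < h s"
proof (rule DERIV_neg_imp_decreasing[OF \<open>s < t\<close>])
  fix x assume x: "s \<le> x" "x \<le> t"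
  then have "0 < x" "x < 1" using assms by auto
  moreover from this have "F x > 0" by (simp add: F_pos)
  ultimately show "\<exists>y. (h has_real_derivative y) (at x) \<and> y < 0"
    by (intro exI[of _ "- 1 / (pi * x * (1 - x) * (F x)\<^sup>2)"] conjI h_deriv) (auto simp: field_simps)
qed

lemma h_inj: "inj_on h {0<..<1}"
proof (rule inj_onI)
  fix x y :: real assume "x \<in> {0<..<1}" "y \<in> {0<..<1}" "h x = h y"
  then show "x = y" using h_strict_antimono[of x y] h_strict_antimono[of y x]
    by (cases x y rule: linorder_cases) auto
qed

lemma h_reflect: "0 < t \<Longrightarrow> t < 1 \<Longrightarrow> h (1 - t) = 1 / h t"
  by (simp add: h_def)

text \<open>The range starts below 0 so that 0 becomes an interior point, at which the Wronskian in
  \<open>F_landen\<close> is evaluated. Any left end between 2 sqrt 2 - 3 and 0 would serve.\<close>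

lemma landen_lt:
  fixes m :: real assumes "-1/10 < m" "m < 1" shows "norm (4 * m / (1 + m)\<^sup>2) < 1"
proof -
  have "(1 + m)\<^sup>2 - 4 * m = (1 - m)\<^sup>2" by (simp add: power2_eq_square algebra_simps)
  moreover have "(1 - m)\<^sup>2 > 0" using assms by simp
  ultimately have 1: "4 * m < (1 + m)\<^sup>2" by linarith
  have "(1 + m)\<^sup>2 \<ge> (9/10)\<^sup>2" using assms by (intro power_mono) auto
  then have 2: "- (4 * m) < (1 + m)\<^sup>2" using assms by (simp add: power2_eq_square)
  have "(1 + m)\<^sup>2 > 0" using assms by simp
  then show ?thesis using 1 2 by (simp add: abs_less_iff field_simps)
qed

text \<open>Both sides solve \<open>(P u')' = R u\<close> with \<open>P = m (1 - m) / (1 + m)\<close>, \<open>R = (1 - m) / (1 + m)\<^sup>3\<close>;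
  \<open>P\<close> vanishes at 0, so their Wronskian does, too.\<close>

lemma F_landen:
  assumes m: "0 \<le> m" "m < 1" shows "F (4 * m / (1 + m)\<^sup>2) = (1 + m) * F (m\<^sup>2)"
proof -
  define Y where "Y = (\<lambda>z. z * (1 - z) * dF z)"
  define z where "z = (\<lambda>m::real. 4 * m / (1 + m)\<^sup>2)"
  define U where "U = (\<lambda>m. F (z m))"
  define V where "V = (\<lambda>m. (1 + m) * F (m\<^sup>2))"
  \<comment> \<open>\<open>PV\<close> is \<open>P\<close> times the derivative of \<open>V\<close>,
    written through \<open>Y\<close> so that \<open>pdF_deriv\<close> differentiates it.
    \<open>Y (z m)\<close> is \<open>P\<close> times the derivative of \<open>U\<close> in the same
    way.\<close>
  define PV where "PV = (\<lambda>m. m * (1 - m) / (1 + m) * F (m\<^sup>2) + 2 * Y (m\<^sup>2) / (1 + m))"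
  let ?z' = "\<lambda>m::real. 4 * (1 - m) / (1 + m) ^ 3"
  have sq: "norm (m\<^sup>2) < 1" if "-1/10 < m" "m < 1" for m :: real
    using that by (simp add: abs_square_less_1 abs_less_iff)
  have zd: "(z has_field_derivative ?z' m) (at m)" if "-1/10 < m" "m < 1" for m
  proof -
    have "((\<lambda>m. 4 * m / (1 + m)\<^sup>2) has_field_derivative (4 * (1 + m)\<^sup>2 - 4 * m * (2 * (1 + m))) / ((1 + m)\<^sup>2 * (1 + m)\<^sup>2)) (at m)"
      using that by (auto intro!: derivative_eq_intros)
    moreover have "(4 * (1 + m)\<^sup>2 - 4 * m * (2 * (1 + m))) / ((1 + m)\<^sup>2 * (1 + m)\<^sup>2) = ?z' m"
      using that by (simp add: divide_simps eval_nat_numeral) (simp add: algebra_simps)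
    ultimately show ?thesis by (simp add: z_def)
  qed
  have zl: "norm (z m) < 1" if "-1/10 < m" "m < 1" for m
    using landen_lt[OF that] by (simp add: z_def)
  have Ud: "(U has_field_derivative dF (z m) * ?z' m) (at m)" if "-1/10 < m" "m < 1" for m
    unfolding U_def by (rule DERIV_chain2[OF F_deriv[OF zl[OF that]] zd[OF that]])
  have YUd: "((\<lambda>m. Y (z m)) has_field_derivative F (z m) / 4 * ?z' m) (at m)" if "-1/10 < m" "m < 1" for m
    unfolding Y_def by (rule DERIV_chain2[OF pdF_deriv[OF zl[OF that]] zd[OF that]])
  have sqd: "((\<lambda>m. m\<^sup>2) has_field_derivative 2 * m) (at m)" for m :: real
    by (auto intro!: derivative_eq_intros)
  have Fsd: "((\<lambda>m. F (m\<^sup>2)) has_field_derivative dF (m\<^sup>2) * (2 * m)) (at m)" if "-1/10 < m" "m < 1" for m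
    by (rule DERIV_chain2[OF F_deriv[OF sq[OF that]] sqd])
  have Ysd: "((\<lambda>m. Y (m\<^sup>2)) has_field_derivative F (m\<^sup>2) / 4 * (2 * m)) (at m)" if "-1/10 < m" "m < 1" for m
    unfolding Y_def by (rule DERIV_chain2[OF pdF_deriv[OF sq[OF that]] sqd])
  have Vd: "(V has_field_derivative F (m\<^sup>2) + (1 + m) * (dF (m\<^sup>2) * (2 * m))) (at m)" if "-1/10 < m" "m < 1" for m
    unfolding V_def by (rule derivative_eq_intros Fsd that refl | simp)+
  have PVd: "(PV has_field_derivative (1 - m) / (1 + m)\<^sup>2 * F (m\<^sup>2)) (at m)" if "-1/10 < m" "m < 1" for m
  proof -
    have "1 + m > 0" using that by simp
    have f: "((\<lambda>m. m * (1 - m) / (1 + m)) has_field_derivative (1 - 2 * m - m * m) / (1 + m)\<^sup>2) (at m)"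
    proof -
      have "((\<lambda>m. m * (1 - m) / (1 + m)) has_field_derivative
          ((1 - 2 * m) * (1 + m) - m * (1 - m) * 1) / ((1 + m) * (1 + m))) (at m)"
        using \<open>1 + m > 0\<close> by (intro DERIV_divide) (auto intro!: derivative_eq_intros)
      moreover have "(1 - 2 * m) * (1 + m) - m * (1 - m) * 1 = 1 - 2 * m - m * m" by (simp add: algebra_simps)
      ultimately show ?thesis by (simp only: power2_eq_square)
    qed
    have "(PV has_field_derivative
        ((1 - 2 * m - m * m) / (1 + m)\<^sup>2 * F (m\<^sup>2) + dF (m\<^sup>2) * (2 * m) * (m * (1 - m) / (1 + m))) +
        (2 * (F (m\<^sup>2) / 4 * (2 * m)) * (1 + m) - 2 * Y (m\<^sup>2) * 1) / ((1 + m) * (1 + m))) (at m)"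
      unfolding PV_def using \<open>1 + m > 0\<close>
      by (intro DERIV_add DERIV_mult DERIV_divide f Fsd Ysd DERIV_cmult that) (auto intro!: derivative_eq_intros)
    moreover have "((1 - 2 * m - m * m) / (1 + m)\<^sup>2 * F (m\<^sup>2) + dF (m\<^sup>2) * (2 * m) * (m * (1 - m) / (1 + m))) +
        (2 * (F (m\<^sup>2) / 4 * (2 * m)) * (1 + m) - 2 * Y (m\<^sup>2) * 1) / ((1 + m) * (1 + m)) = (1 - m) / (1 + m)\<^sup>2 * F (m\<^sup>2)"
    proof -
      define f g where "f = F (m\<^sup>2)" and "g = dF (m\<^sup>2)"
      show ?thesis unfolding Y_def f_def[symmetric] g_def[symmetric] using \<open>1 + m > 0\<close>
        by (simp add: divide_simps eval_nat_numeral) (simp add: algebra_simps)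
    qed
    ultimately show ?thesis by metis
  qed
  define w where "w = (\<lambda>m. U m * PV m - V m * Y (z m))"
  have wd: "(w has_field_derivative 0) (at m)" if "-1/10 < m" "m < 1" for m
  proof -
    have "1 + m > 0" using that by simp
    have "(w has_field_derivative (dF (z m) * ?z' m * PV m + (1 - m) / (1 + m)\<^sup>2 * F (m\<^sup>2) * U m) -
       ((F (m\<^sup>2) + (1 + m) * (dF (m\<^sup>2) * (2 * m))) * Y (z m) + F (z m) / 4 * ?z' m * V m)) (at m)"
      unfolding w_def by (intro DERIV_diff DERIV_mult Ud PVd Vd YUd that)
    moreover have 1: "Y (z m) = m * (1 - m) / (1 + m) * (dF (z m) * ?z' m)"
      unfolding Y_def z_def using \<open>1 + m > 0\<close> by (simp add: divide_simps eval_nat_numeral) (simp add: algebra_simps)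
    moreover have 2: "PV m = m * (1 - m) / (1 + m) * (F (m\<^sup>2) + (1 + m) * (dF (m\<^sup>2) * (2 * m)))"
      unfolding PV_def Y_def using \<open>1 + m > 0\<close> by (simp add: divide_simps) (simp add: algebra_simps power2_eq_square)
    moreover have 3: "(1 - m) / (1 + m)\<^sup>2 * F (m\<^sup>2) * U m = F (z m) / 4 * ?z' m * V m"
      unfolding U_def V_def using \<open>1 + m > 0\<close> by (simp add: divide_simps eval_nat_numeral) (simp add: algebra_simps)
    moreover have aux: "a * P + r - (b * y + s) = 0" if "y = q * a" "P = q * b" "r = s" for a b P r y s q :: real
      using that by (simp add: algebra_simps)
    ultimately show ?thesis using aux[OF 1 2 3] by simp
  qed
  have "\<exists>c. \<forall>t\<in>{-1/10<..<1}. w t = c"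
    by (rule has_field_derivative_zero_constant) (auto intro!: DERIV_subset[OF wd])
  moreover have "w 0 = 0" by (simp add: w_def PV_def Y_def z_def)
  ultimately have w0: "w t = 0" if "-1/10 < t" "t < 1" for t
    using that by force
  have Vpos: "V m > 0" if "-1/10 < m" "m < 1" for m
    using that F_pos[of "m\<^sup>2"] sq[OF that] by (simp add: V_def)
  show ?thesis
  proof (cases "m = 0")
    case False
    then have "0 < m" using m by simp
    \<comment> \<open>The Wronskian carries the factor \<open>P\<close>, which can be cancelled only
      away from 0; the value at 0 enters by continuity.\<close>
    have "U m / V m = U 0 / V 0"
    proof (rule DERIV_isconst_end[OF \<open>0 < m\<close>])
      show "continuous_on {0..m} (\<lambda>m. U m / V m)"
      proof (intro continuous_at_imp_continuous_on ballI isCont_divide)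
        fix x assume "x \<in> {0..m}"
        then have "-1/10 < x" "x < 1" using m by auto
        then show "isCont U x" "isCont V x" "V x \<noteq> 0"
          using DERIV_isCont[OF Ud] DERIV_isCont[OF Vd] Vpos[of x] by auto
      qed
      fix x assume x: "0 < x" "x < m"
      then have x': "-1/10 < x" "x < 1" using m by auto
      have "1 + x > 0" using x by simp
      have 1: "Y (z x) = x * (1 - x) / (1 + x) * (dF (z x) * ?z' x)"
        unfolding Y_def z_def using \<open>1 + x > 0\<close> by (simp add: divide_simps eval_nat_numeral) (simp add: algebra_simps)
      have 2: "PV x = x * (1 - x) / (1 + x) * (F (x\<^sup>2) + (1 + x) * (dF (x\<^sup>2) * (2 * x)))"
        unfolding PV_def Y_def using \<open>1 + x > 0\<close> by (simp add: divide_simps) (simp add: algebra_simps power2_eq_square)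
      have "x * (1 - x) / (1 + x) * (U x * (F (x\<^sup>2) + (1 + x) * (dF (x\<^sup>2) * (2 * x))) - V x * (dF (z x) * ?z' x)) = 0"
      proof -
        have "x * (1 - x) / (1 + x) * (U x * B - V x * A) = U x * (x * (1 - x) / (1 + x) * B) - V x * (x * (1 - x) / (1 + x) * A)" for A B
          by (simp only: right_diff_distrib mult.left_commute)
        then show ?thesis using w0[OF x'] unfolding w_def 1 2 by (simp only:)
      qed
      moreover have "x * (1 - x) / (1 + x) \<noteq> 0" using x x' by auto
      ultimately have 3: "dF (z x) * ?z' x * V x - U x * (F (x\<^sup>2) + (1 + x) * (dF (x\<^sup>2) * (2 * x))) = 0"
        by (auto simp only: mult_eq_0_iff mult.commute)
      have "((\<lambda>m. U m / V m) has_field_derivative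
         (dF (z x) * ?z' x * V x - U x * (F (x\<^sup>2) + (1 + x) * (dF (x\<^sup>2) * (2 * x)))) / (V x * V x)) (at x)"
        using Vpos[OF x'] by (intro DERIV_divide Ud Vd x') auto
      then show "((\<lambda>m. U m / V m) has_field_derivative 0) (at x)" unfolding 3 by simp
    qed
    moreover have "U 0 = 1" unfolding U_def z_def by simp
    moreover have "V 0 = 1" unfolding V_def by simp
    ultimately have "U m / V m = 1" by (simp only: div_by_1)
    then have "U m = V m" using right_inverse_eq[of "V m" "U m"] Vpos[of m] m by auto
    then show ?thesis unfolding U_def V_def z_def .
  qed simp
qed

text \<open>The Landen step acts on the modulus as \<open>k \<mapsto> 2 \<surd>k / (1 + k)\<close> and halves \<open>h\<close>.\<close>

lemma landen_complement:
  fixes k :: real assumes "0 < k" shows "1 - 4 * k / (1 + k)\<^sup>2 = ((1 - k) / (1 + k))\<^sup>2"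
  using assms by (simp add: divide_simps) (simp add: power2_eq_square algebra_simps)

text \<open>Landen's transformation is used twice: for k, and for m = (1 - k) / (1 + k), whose image
  is the complementary parameter 1 - k^2. The factors 1 + k and 2 / (1 + k) leave the 1/2.\<close>

lemma h_landen:
  assumes k: "0 < k" "k < 1" shows "h (4 * k / (1 + k)\<^sup>2) = h (k\<^sup>2) / 2"
proof -
  define m where "m = (1 - k) / (1 + k)"
  have m: "0 \<le> m" "m < 1" using k by (auto simp: m_def)
  have "1 + m = 2 / (1 + k)" using k by (simp add: m_def field_simps)
  moreover have "4 * m / (1 + m)\<^sup>2 = 1 - k\<^sup>2"
    unfolding calculation using k by (simp add: m_def divide_simps) (simp add: power2_eq_square algebra_simps)
  ultimately have "F (1 - k\<^sup>2) = 2 / (1 + k) * F (m\<^sup>2)"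
    using F_landen[OF m] by simp
  moreover have "F (4 * k / (1 + k)\<^sup>2) = (1 + k) * F (k\<^sup>2)"
    using k by (intro F_landen) auto
  moreover have "1 - 4 * k / (1 + k)\<^sup>2 = m\<^sup>2"
    using landen_complement[OF k(1)] by (simp add: m_def)
  ultimately show ?thesis
    using k by (simp add: h_def)
qed

section \<open>Theta functions and infinite products\<close>

text \<open>Euler's function (q;q)_\<infinity>, with (q;q^2)_\<infinity> as \<open>qo\<close> and
  the partial products of the former as \<open>qpf\<close>. The field is left open: theta functions
  are taken at real nomes, but the power series of the eta quotient calls for complex
  arguments.\<close>

definition qp :: "'a::{real_normed_field,banach} \<Rightarrow> 'a" where
  "qp q = (\<Prod>n. 1 - q ^ Suc n)"

definition qo :: "'a::{real_normed_field,banach} \<Rightarrow> 'a" where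
  "qo q = (\<Prod>n. 1 - q ^ (2 * n + 1))"

definition qpf :: "'a::field \<Rightarrow> nat \<Rightarrow> 'a" where
  "qpf q n = (\<Prod>k<n. 1 - q ^ Suc k)"

lemma one_minus_power_nz: "norm q < 1 \<Longrightarrow> 1 - q ^ Suc n \<noteq> 0" for q :: "'a::real_normed_field"
proof
  assume "norm q < 1" "1 - q ^ Suc n = 0"
  then have "norm q ^ Suc n = 1" by (metis eq_iff_diff_eq_0 norm_one norm_power)
  then show False using \<open>norm q < 1\<close> power_Suc_less_one[of "norm q" n]
    by (metis less_irrefl norm_ge_zero order_le_less power_Suc0_right power_0_Suc zero_neq_one)
qed

lemma norm_norm_power_le: "norm q < 1 \<Longrightarrow> n \<le> m \<Longrightarrow> norm (norm (q ^ m)) \<le> norm q ^ n" for q :: "'a::real_normed_field"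
  by (simp add: norm_power power_decreasing)

lemma qp_conv: "norm q < 1 \<Longrightarrow> convergent_prod (\<lambda>n. 1 - q ^ Suc n)"
  for q :: "'a::{real_normed_field,banach}"
proof -
  assume "norm q < 1"
  then have "summable (\<lambda>n. norm q ^ Suc n)" by (subst summable_Suc_iff) (simp add: summable_geometric)
  then have "abs_convergent_prod (\<lambda>n. 1 - q ^ Suc n)"
    by (subst abs_convergent_prod_conv_summable) (simp add: norm_power norm_mult)
  then show ?thesis by (rule abs_convergent_prod_imp_convergent_prod)
qed

lemma qo_conv: "norm q < 1 \<Longrightarrow> convergent_prod (\<lambda>n. 1 - q ^ (2 * n + 1))"
  for q :: "'a::{real_normed_field,banach}"
proof -
  assume q: "norm q < 1"
  have "summable (\<lambda>n. norm (q ^ (2 * n + 1)))"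
  proof (rule summable_comparison_test'[of "\<lambda>n. norm q ^ n" 0])
    show "summable (\<lambda>n. norm q ^ n)" using q by (simp add: summable_geometric)
    show "norm (norm (q ^ (2 * n + 1))) \<le> norm q ^ n" for n
      using q by (intro norm_norm_power_le) auto
  qed
  then have "abs_convergent_prod (\<lambda>n. 1 - q ^ (2 * n + 1))"
    by (subst abs_convergent_prod_conv_summable) simp
  then show ?thesis by (rule abs_convergent_prod_imp_convergent_prod)
qed

lemma qpf_lim: "norm q < 1 \<Longrightarrow> qpf q \<longlonglongrightarrow> qp q" for q :: "'a::{real_normed_field,banach}"
proof -
  assume "norm q < 1"
  then have "(\<lambda>n. \<Prod>k\<le>n. 1 - q ^ Suc k) \<longlonglongrightarrow> qp q"
    unfolding qp_def by (intro convergent_prod_LIMSEQ qp_conv)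
  then show ?thesis unfolding qpf_def[abs_def] by (subst LIMSEQ_lessThan_iff_atMost)
qed

lemma qo_lim: "norm q < 1 \<Longrightarrow> (\<lambda>n. \<Prod>k<n. 1 - q ^ (2 * k + 1)) \<longlonglongrightarrow> qo q" for q :: "'a::{real_normed_field,banach}"
proof -
  assume "norm q < 1"
  then have "(\<lambda>n. \<Prod>k\<le>n. 1 - q ^ (2 * k + 1)) \<longlonglongrightarrow> qo q"
    unfolding qo_def by (intro convergent_prod_LIMSEQ qo_conv)
  then show ?thesis by (subst LIMSEQ_lessThan_iff_atMost)
qed

lemma qp_nz: "norm q < 1 \<Longrightarrow> qp q \<noteq> 0" for q :: "'a::{real_normed_field,banach}"
  unfolding qp_def by (intro prodinf_nonzero qp_conv one_minus_power_nz)

lemma qo_nz: "norm q < 1 \<Longrightarrow> qo q \<noteq> 0" for q :: "'a::{real_normed_field,banach}"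
  unfolding qo_def using qo_conv[of q] one_minus_power_nz[of q] by (intro prodinf_nonzero) auto

lemma norm_sq_less: "norm q < 1 \<Longrightarrow> norm (q\<^sup>2) < 1" for q :: "'a::real_normed_field"
  by (simp add: norm_power abs_square_less_1)

lemma qp_split: fixes q :: "'a::{real_normed_field,banach}"
  assumes q: "norm q < 1" shows "qp q = qo q * qp (q\<^sup>2)"
proof -
  have fin: "qpf q (2 * n) = (\<Prod>k<n. 1 - q ^ (2 * k + 1)) * qpf (q\<^sup>2) n" for n
    by (induction n) (simp_all add: qpf_def power_mult[symmetric] algebra_simps del: power_Suc)
  have "(\<lambda>n. qpf q (2 * n)) \<longlonglongrightarrow> qp q"
    using LIMSEQ_subseq_LIMSEQ[OF qpf_lim[OF q], of "\<lambda>n. 2 * n"] by (simp add: o_def strict_mono_def)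
  moreover have "(\<lambda>n. qpf q (2 * n)) \<longlonglongrightarrow> qo q * qp (q\<^sup>2)"
    unfolding fin by (intro tendsto_mult qo_lim qpf_lim norm_sq_less q)
  ultimately show ?thesis by (rule LIMSEQ_unique)
qed

lemma qo_mult_minus: fixes q :: "'a::{real_normed_field,banach}"
  assumes q: "norm q < 1" shows "qo q * qo (- q) = qo (q\<^sup>2)"
proof -
  have "(\<lambda>n. (\<Prod>k<n. 1 - q ^ (2 * k + 1)) * (\<Prod>k<n. 1 - (- q) ^ (2 * k + 1))) \<longlonglongrightarrow> qo q * qo (- q)"
    using q by (intro tendsto_mult qo_lim) auto
  moreover have "(\<Prod>k<n. 1 - q ^ (2 * k + 1)) * (\<Prod>k<n. 1 - (- q) ^ (2 * k + 1)) = (\<Prod>k<n. 1 - (q\<^sup>2) ^ (2 * k + 1))" for n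
    unfolding prod.distrib[symmetric]
    by (intro prod.cong refl) (simp add: power_mult[symmetric] algebra_simps power_add[symmetric])
  ultimately show ?thesis using qo_lim[OF norm_sq_less[OF q]] LIMSEQ_unique by simp
qed

section \<open>Gaussian binomial coefficients and the triple product\<close>

fun qbinom :: "'a::field \<Rightarrow> nat \<Rightarrow> nat \<Rightarrow> 'a" where
  "qbinom q n 0 = 1"
| "qbinom q 0 (Suc k) = 0"
| "qbinom q (Suc n) (Suc k) = qbinom q n (Suc k) + q ^ (n - k) * qbinom q n k"

lemma qbinom_eq_0: "k > n \<Longrightarrow> qbinom q n k = 0"
  by (induction q n k rule: qbinom.induct) auto

lemma qpf_0 [simp]: "qpf q 0 = 1"
  by (simp add: qpf_def)

lemma qpf_Suc: "qpf q (Suc n) = qpf q n * (1 - q ^ Suc n)"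
  by (simp add: qpf_def)

lemma qbinom_qpf: "k \<le> n \<Longrightarrow> qbinom q n k * (qpf q k * qpf q (n - k)) = qpf q n"
proof (induction q n k rule: qbinom.induct)
  case (3 q n k)
  show ?case
  proof (cases "k = n")
    case True
    then have "qbinom q n n * qpf q n = qpf q n" using 3 by simp
    then show ?thesis using True by (simp add: qbinom_eq_0 qpf_Suc mult.assoc[symmetric] del: power_Suc)
  next
    case False
    then have k: "Suc k \<le> n" using 3 by simp
    define d where "d = n - Suc k"
    have d: "n - k = Suc d" using k by (simp add: d_def)
    have e: "q ^ Suc d * q ^ Suc k = q ^ Suc n" using k d unfolding power_add[symmetric]
      by (metis Suc_diff_le add.commute add_Suc_right diff_Suc_Suc le_add_diff_inverse2 nat_le_linear Suc_leD)
    have "qbinom q (Suc n) (Suc k) * (qpf q (Suc k) * qpf q (Suc n - Suc k)) =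
      (qbinom q n (Suc k) * (qpf q (Suc k) * qpf q (n - Suc k))) * (1 - q ^ Suc d) +
      q ^ Suc d * (qbinom q n k * (qpf q k * qpf q (n - k))) * (1 - q ^ Suc k)"
      by (simp add: d d_def[symmetric] qpf_Suc ring_distribs mult_ac del: power_Suc)
    also have "\<dots> = qpf q n * (1 - q ^ Suc d * q ^ Suc k)"
      using 3 k by (simp add: algebra_simps del: power_Suc)
    finally show ?thesis unfolding e by (simp only: qpf_Suc)
  qed
qed auto

lemma qpf_nz: "norm q < 1 \<Longrightarrow> qpf q n \<noteq> 0" for q :: "'a::real_normed_field"
  using one_minus_power_nz[of q] by (simp add: qpf_def del: power_Suc)

lemma qbinom_eq: "norm q < 1 \<Longrightarrow> qbinom q (a + b) a = qpf q (a + b) / (qpf q a * qpf q b)" for q :: "'a::real_normed_field"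
  using qbinom_qpf[of a "a + b" q] qpf_nz[of q] by (simp add: field_simps)

text \<open>Rothe's finite q-binomial theorem. Because \<open>qbinom\<close> is defined by a Pascal
  rule and not as a quotient, the identity is polynomial and carries no condition on q; the quotient
  form \<open>qbinom_eq\<close> is used for symmetry and limits.\<close>

lemma q_binomial: "(\<Prod>j<n. 1 + x * q ^ j) = (\<Sum>m\<le>n. q ^ (m * (m - 1) div 2) * qbinom q n m * x ^ m)"
proof (induction n)
  case (Suc n)
  have T: "Suc m * (Suc m - 1) div 2 = m * (m - 1) div 2 + m" for m
    by (cases m) (simp_all add: algebra_simps)
  have "(\<Sum>m\<le>Suc n. q ^ (m * (m - 1) div 2) * qbinom q (Suc n) m * x ^ m) =
     1 + (\<Sum>m\<le>n. q ^ (Suc m * (Suc m - 1) div 2) * qbinom q (Suc n) (Suc m) * x ^ Suc m)"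
    by (subst sum.atMost_Suc_shift) simp
  also have "(\<Sum>m\<le>n. q ^ (Suc m * (Suc m - 1) div 2) * qbinom q (Suc n) (Suc m) * x ^ Suc m) =
      (\<Sum>m\<le>n. q ^ (Suc m * (Suc m - 1) div 2) * qbinom q n (Suc m) * x ^ Suc m) +
      (\<Sum>m\<le>n. q ^ (Suc m * (Suc m - 1) div 2) * q ^ (n - m) * qbinom q n m * x ^ Suc m)"
    unfolding sum.distrib[symmetric] by (intro sum.cong refl) (simp add: algebra_simps)
  also have "(\<Sum>m\<le>n. q ^ (Suc m * (Suc m - 1) div 2) * q ^ (n - m) * qbinom q n m * x ^ Suc m) =
     x * q ^ n * (\<Sum>m\<le>n. q ^ (m * (m - 1) div 2) * qbinom q n m * x ^ m)"
    unfolding sum_distrib_left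
  proof (intro sum.cong refl)
    fix m assume "m \<in> {..n}"
    then have "q ^ (Suc m * (Suc m - 1) div 2) * q ^ (n - m) = q ^ n * q ^ (m * (m - 1) div 2)"
      unfolding T power_add[symmetric] by (intro arg_cong[of _ _ "\<lambda>i. q ^ i"]) auto
    then show "q ^ (Suc m * (Suc m - 1) div 2) * q ^ (n - m) * qbinom q n m * x ^ Suc m =
       x * q ^ n * (q ^ (m * (m - 1) div 2) * qbinom q n m * x ^ m)" by (simp only: power_Suc mult_ac)
  qed
  also have "1 + ((\<Sum>m\<le>n. q ^ (Suc m * (Suc m - 1) div 2) * qbinom q n (Suc m) * x ^ Suc m) +
       x * q ^ n * (\<Sum>m\<le>n. q ^ (m * (m - 1) div 2) * qbinom q n m * x ^ m)) =
     (1 + (\<Sum>m\<le>n. q ^ (Suc m * (Suc m - 1) div 2) * qbinom q n (Suc m) * x ^ Suc m)) +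
       x * q ^ n * (\<Sum>m\<le>n. q ^ (m * (m - 1) div 2) * qbinom q n m * x ^ m)"
    by (rule add.assoc[symmetric])
  also have "1 + (\<Sum>m\<le>n. q ^ (Suc m * (Suc m - 1) div 2) * qbinom q n (Suc m) * x ^ Suc m) =
     (\<Sum>m\<le>Suc n. q ^ (m * (m - 1) div 2) * qbinom q n m * x ^ m)"
    by (subst sum.atMost_Suc_shift) simp
  also have "\<dots> = (\<Sum>m\<le>n. q ^ (m * (m - 1) div 2) * qbinom q n m * x ^ m)"
    by (simp add: qbinom_eq_0)
  finally show ?case using Suc by (simp add: algebra_simps)
qed simp

lemma qpf_bound: fixes q :: "'a::{real_normed_field,banach}"
  assumes q: "norm q < 1" shows "\<exists>K. \<forall>n. norm (qpf q n) \<le> K \<and> norm (inverse (qpf q n)) \<le> K"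
proof -
  have "Bseq (qpf q)" "Bseq (\<lambda>n. inverse (qpf q n))"
    using qpf_lim[OF q] tendsto_inverse[OF qpf_lim[OF q] qp_nz[OF q]]
    by (auto intro: convergent_imp_Bseq convergentI)
  then obtain K1 K2 where "\<And>n. norm (qpf q n) \<le> K1" "\<And>n. norm (inverse (qpf q n)) \<le> K2"
    by (auto simp: Bseq_def)
  then show ?thesis by (intro exI[of _ "max K1 K2"]) (auto simp: le_max_iff_disj)
qed

text \<open>By Tannery's theorem: the central Gaussian binomial coefficients are bounded and tend to \<open>1 / qp q\<close>.\<close>

lemma gauss_tannery:
  fixes q :: "'a::{real_normed_field,banach}"
  assumes q: "norm q < 1" and u: "summable (\<lambda>k. norm (u k))" and c: "c \<le> 1"
  shows "(\<lambda>n. \<Sum>k\<le>n. u k * qbinom q (2 * n + c) (n - k)) \<longlonglongrightarrow> suminf u / qp q"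
proof -
  obtain K where K: "\<And>n. norm (qpf q n) \<le> K" "\<And>n. norm (inverse (qpf q n)) \<le> K"
    using qpf_bound[OF q] by auto
  have K0: "K \<ge> 0" using K(1)[of 0] norm_ge_zero order_trans by blast
  define a where "a = (\<lambda>k n. if k \<le> n then u k * qbinom q (2 * n + c) (n - k) else 0)"
  have g: "qbinom q (2 * n + c) (n - k) = qpf q (2 * n + c) / (qpf q (n - k) * qpf q (n + c + k))" if "k \<le> n" for k n
    using qbinom_eq[OF q, of "n - k" "n + c + k"] that by (simp add: mult_2 add.assoc)
  have gK: "norm (qbinom q (2 * n + c) (n - k)) \<le> K * (K * K)" if "k \<le> n" for k n
    unfolding g[OF that] divide_inverse inverse_mult_distrib norm_mult using K K0
    by (intro mult_mono) (auto simp: norm_inverse)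
  have "(\<lambda>n. \<Sum>k. a k n) \<longlonglongrightarrow> (\<Sum>k. u k * (qp q / (qp q * qp q)))"
  proof (rule tannerys_theorem[THEN conjunct2, THEN conjunct2])
    show "(a k) \<longlonglongrightarrow> u k * (qp q / (qp q * qp q))" for k
    proof -
      have sub: "(\<lambda>n. qpf q (f n)) \<longlonglongrightarrow> qp q" if "filterlim f at_top at_top" for f
        by (rule filterlim_compose[OF qpf_lim[OF q] that])
      have fl: "filterlim (\<lambda>n. 2 * n + c) at_top at_top" "filterlim (\<lambda>n. n - k) at_top at_top" "filterlim (\<lambda>n. n + c + k) at_top at_top"
        by (rule filterlim_at_top_mono[OF filterlim_ident], rule always_eventually, simp)
           (rule filterlim_minus_const_nat_at_top,
            rule filterlim_at_top_mono[OF filterlim_ident], rule always_eventually, simp)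
      have "(\<lambda>n. u k * (qpf q (2 * n + c) / (qpf q (n - k) * qpf q (n + c + k)))) \<longlonglongrightarrow> u k * (qp q / (qp q * qp q))"
        by (intro tendsto_intros sub fl) (use qp_nz[OF q] in auto)
      moreover have "eventually (\<lambda>n. u k * (qpf q (2 * n + c) / (qpf q (n - k) * qpf q (n + c + k))) = a k n) at_top"
        using eventually_ge_at_top[of k] by eventually_elim (simp add: a_def g)
      ultimately show ?thesis by (rule Lim_transform_eventually)
    qed
    show "summable (\<lambda>k. norm (u k) * (K * (K * K)))" by (intro summable_mult2 u)
    show "\<forall>\<^sub>F (k, n) in sequentially \<times>\<^sub>F sequentially. norm (a k n) \<le> norm (u k) * (K * (K * K))"
      by (intro always_eventually) (auto simp: a_def norm_mult gK K0 intro!: mult_left_mono)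
  qed auto
  moreover have "(\<Sum>k. a k n) = (\<Sum>k\<le>n. u k * qbinom q (2 * n + c) (n - k))" for n
    by (subst suminf_finite[of "{..n}"]) (auto simp: a_def)
  moreover have "(\<Sum>k. u k * (qp q / (qp q * qp q))) = suminf u / qp q"
    using suminf_mult2[OF summable_norm_cancel[OF u], of "qp q / (qp q * qp q)"] qp_nz[OF q] by simp
  ultimately show ?thesis by simp
qed

text \<open>Jacobi's theta_3, folded onto the naturals so that \<open>gauss_tannery\<close> applies
  to it as it stands; \<open>theta (- q)\<close> is theta_4.\<close>

definition theta :: "'a::{real_normed_field,banach} \<Rightarrow> 'a" where
  "theta q = (\<Sum>k. (if k = 0 then 1 else 2) * q ^ (k\<^sup>2))"

lemma summable_power_sq: "norm q < 1 \<Longrightarrow> summable (\<lambda>k. norm (q ^ (k\<^sup>2)))" for q :: "'a::real_normed_field"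
proof (rule summable_comparison_test'[of "\<lambda>n. norm q ^ n" 0])
  assume q: "norm q < 1"
  show "summable (\<lambda>n. norm q ^ n)" using q by (simp add: summable_geometric)
  show "norm (norm (q ^ (n\<^sup>2))) \<le> norm q ^ n" for n
    using q by (intro norm_norm_power_le) (auto simp: power2_eq_square)
qed

lemma theta_summable: "norm q < 1 \<Longrightarrow> summable (\<lambda>k. norm ((if k = 0 then 1 else 2) * q ^ (k\<^sup>2)))" for q :: "'a::{real_normed_field,banach}"
proof (rule summable_comparison_test'[of "\<lambda>k. 2 * norm (q ^ (k\<^sup>2))" 0])
  assume q: "norm q < 1"
  show "summable (\<lambda>k. 2 * norm (q ^ (k\<^sup>2)))" using summable_power_sq[OF q] by (intro summable_mult)
qed (auto simp: norm_mult)

lemma theta_sums: "norm q < 1 \<Longrightarrow> (\<lambda>k. (if k = 0 then 1 else 2) * q ^ (k\<^sup>2)) sums theta q" for q :: "'a::{real_normed_field,banach}"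
  unfolding theta_def by (rule summable_sums, rule summable_norm_cancel, rule theta_summable)

lemma sum_centered: "(\<Sum>m\<le>2 * n. f m) = f n + (\<Sum>k<n. f (n + Suc k) + f (n - Suc k))" for f :: "nat \<Rightarrow> 'a::comm_monoid_add"
proof -
  have 1: "{..2*n} = {..<n} \<union> ({n} \<union> {n<..2*n})" by auto
  have 2: "sum f ({..<n} \<union> ({n} \<union> {n<..2*n})) = sum f {..<n} + sum f ({n} \<union> {n<..2*n})"
    by (rule sum.union_disjoint) auto
  have 3: "sum f ({n} \<union> {n<..2*n}) = sum f {n} + sum f {n<..2*n}"
    by (rule sum.union_disjoint) auto
  have "(\<Sum>m\<le>2 * n. f m) = sum f {..<n} + (f n + sum f {n<..2*n})"
    unfolding 1 2 3 by (simp only: sum.insert sum.empty finite.emptyI empty_iff not_False_eq_True add_0_right)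
  also have "sum f {..<n} = (\<Sum>k<n. f (n - Suc k))"
    by (rule sum.nat_diff_reindex[symmetric])
  also have "sum f {n<..2*n} = (\<Sum>k<n. f (n + Suc k))"
    by (rule sum.reindex_bij_witness[of _ "\<lambda>k. n + Suc k" "\<lambda>m. m - Suc n"]) auto
  finally show ?thesis by (simp only: sum.distrib add_ac)
qed

lemma qbinom_sym: "norm q < 1 \<Longrightarrow> qbinom q (a + b) a = qbinom q (a + b) b" for q :: "'a::real_normed_field"
  using qbinom_eq[of q a b] qbinom_eq[of q b a] by (simp add: add.commute mult.commute)

text \<open>The q-binomial theorem in base q^2 with 2n factors and argument q^(1 - 2n), which
  centres the product: the factors from n on give the odd powers of q, those below n their inverses,
  so both halves agree up to q^(n^2).\<close>

lemma theta_finite: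
  fixes q :: "'a::{real_normed_field,banach}"
  assumes q: "norm q < 1" "q \<noteq> 0"
  shows "(\<Prod>i<n. 1 + q ^ (2 * i + 1))\<^sup>2 = (\<Sum>k\<le>n. (if k = 0 then 1 else 2) * q ^ (k\<^sup>2) * qbinom (q\<^sup>2) (2 * n) (n - k))"
proof -
  define x where "x = q / q ^ (2 * n)"
  have "(\<Prod>j<2 * n. 1 + x * (q\<^sup>2) ^ j) = (\<Prod>j<n. 1 + x * (q\<^sup>2) ^ j) * (\<Prod>i<n. 1 + x * (q\<^sup>2) ^ (n + i))"
  proof -
    have "(\<Prod>j<2*n. 1 + x * (q\<^sup>2) ^ j) = (\<Prod>j<n. 1 + x * (q\<^sup>2) ^ j) * (\<Prod>j\<in>{n..<n+n}. 1 + x * (q\<^sup>2) ^ j)"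
      unfolding mult_2 lessThan_atLeast0 by (rule prod.atLeastLessThan_concat[symmetric]) auto
    also have "(\<Prod>j\<in>{n..<n+n}. 1 + x * (q\<^sup>2) ^ j) = (\<Prod>i<n. 1 + x * (q\<^sup>2) ^ (n + i))"
      by (rule prod.reindex_bij_witness[of _ "\<lambda>i. n + i" "\<lambda>i. i - n"]) auto
    finally show ?thesis .
  qed
  also have "(\<Prod>i<n. 1 + x * (q\<^sup>2) ^ (n + i)) = (\<Prod>i<n. 1 + q ^ (2 * i + 1))"
    using q by (intro prod.cong refl) (simp add: x_def power_mult[symmetric] power_add)
  also have "(\<Prod>j<n. 1 + x * (q\<^sup>2) ^ j) = (\<Prod>j<n. 1 + x * (q\<^sup>2) ^ (n - Suc j))"
    by (rule prod.nat_diff_reindex[symmetric])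
  also have "\<dots> = (\<Prod>i<n. (1 + q ^ (2 * i + 1)) / q ^ (2 * i + 1))"
  proof (intro prod.cong refl)
    fix i assume "i \<in> {..<n}"
    then obtain d where d: "n = i + Suc d" using less_iff_Suc_add by auto
    show "1 + x * (q\<^sup>2) ^ (n - Suc i) = (1 + q ^ (2 * i + 1)) / q ^ (2 * i + 1)"
      using q unfolding x_def d by (simp add: power_mult[symmetric] field_simps power_add power2_eq_square mult_2_right)
  qed
  also have "\<dots> = (\<Prod>i<n. 1 + q ^ (2 * i + 1)) / q ^ (n\<^sup>2)"
  proof -
    have "(\<Prod>i<n. q ^ (2 * i + 1)) = q ^ (n\<^sup>2)"
    proof (induction n)
      case (Suc n)
      have "n\<^sup>2 + (2 * n + 1) = (Suc n)\<^sup>2" by (simp add: power2_eq_square)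
      then show ?case using Suc by (simp only: prod.lessThan_Suc power_add[symmetric])
    qed simp
    then show ?thesis by (simp add: prod_dividef)
  qed
  finally have "(\<Prod>i<n. 1 + q ^ (2 * i + 1))\<^sup>2 = q ^ (n\<^sup>2) * (\<Prod>j<2 * n. 1 + x * (q\<^sup>2) ^ j)"
    using q by (simp add: power2_eq_square[of "prod _ _"])
  also have "\<dots> = (\<Sum>m\<le>2 * n. q ^ (n\<^sup>2) * ((q\<^sup>2) ^ (m * (m - 1) div 2) * x ^ m) * qbinom (q\<^sup>2) (2 * n) m)"
    unfolding q_binomial sum_distrib_left by (simp add: mult_ac)
  \<comment> \<open>Completing the square: n^2 + m (m - 1) + m (1 - 2n) = (m - n)^2.\<close>
  also have "\<dots> = (\<Sum>m\<le>2 * n. q ^ ((nat \<bar>int m - int n\<bar>)\<^sup>2) * qbinom (q\<^sup>2) (2 * n) m)"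
  proof (intro sum.cong refl arg_cong2[of _ _ _ _ "(*)"])
    fix m :: nat
    have "even (m * (m - 1))" by auto
    then have ev: "2 * (m * (m - 1) div 2) = m * (m - 1)" by (rule dvd_mult_div_cancel)
    have mm: "m * (m - 1) + m = m * m" by (cases m) auto
    have s: "(nat \<bar>int m - int n\<bar>)\<^sup>2 + 2 * n * m = n\<^sup>2 + m * m"
    proof -
      have "int ((nat \<bar>int m - int n\<bar>)\<^sup>2 + 2 * n * m) = int (n\<^sup>2 + m * m)"
        by (simp add: power2_eq_square algebra_simps)
      then show ?thesis by linarith
    qed
    have "q ^ (n\<^sup>2) * ((q\<^sup>2) ^ (m * (m - 1) div 2) * x ^ m) = q ^ (n\<^sup>2) * (q ^ (m * (m - 1)) * q ^ m / q ^ (2 * n * m))"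
      unfolding x_def power_mult[symmetric] ev by (simp add: power_divide power_mult[symmetric])
    also have "\<dots> = q ^ (n\<^sup>2 + m * m) / q ^ (2 * n * m)"
      by (simp only: mm[symmetric] power_add times_divide_eq_right)
    also have "\<dots> = q ^ ((nat \<bar>int m - int n\<bar>)\<^sup>2)"
      unfolding s[symmetric] using q by (simp add: power_add)
    finally show "q ^ (n\<^sup>2) * ((q\<^sup>2) ^ (m * (m - 1) div 2) * x ^ m) = q ^ ((nat \<bar>int m - int n\<bar>)\<^sup>2)" .
  qed
  also have "\<dots> = qbinom (q\<^sup>2) (2 * n) n + (\<Sum>k<n. q ^ ((Suc k)\<^sup>2) * (qbinom (q\<^sup>2) (2 * n) (n + Suc k) + qbinom (q\<^sup>2) (2 * n) (n - Suc k)))"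
  proof -
    have "nat \<bar>int (n + Suc k) - int n\<bar> = Suc k" "k < n \<Longrightarrow> nat \<bar>int (n - Suc k) - int n\<bar> = Suc k" for k
      by auto
    then show ?thesis unfolding sum_centered by (auto simp: ring_distribs simp del: add_Suc_right intro!: sum.cong)
  qed
  also have "\<dots> = qbinom (q\<^sup>2) (2 * n) n + (\<Sum>k<n. 2 * q ^ ((Suc k)\<^sup>2) * qbinom (q\<^sup>2) (2 * n) (n - Suc k))"
  proof -
    have "qbinom (q\<^sup>2) (2 * n) (n + Suc k) = qbinom (q\<^sup>2) (2 * n) (n - Suc k)" if "k < n" for k
      using qbinom_sym[OF norm_sq_less[OF q(1)], of "n + Suc k" "n - Suc k"] that by (simp add: mult_2)
    then show ?thesis by (simp add: mult_ac)
  qed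
  also have "\<dots> = (\<Sum>k\<le>n. (if k = 0 then 1 else 2) * q ^ (k\<^sup>2) * qbinom (q\<^sup>2) (2 * n) (n - k))"
    by (subst sum.atMost_shift) simp
  finally show ?thesis .
qed

text \<open>The limit of \<open>theta_finite\<close>. The point q = 0 is treated apart because the
  finite form involves negative powers of q.\<close>

theorem theta_product:
  fixes q :: "'a::{real_normed_field,banach}"
  assumes q: "norm q < 1"
  shows "theta q = qp (q\<^sup>2) * (qo (- q))\<^sup>2"
proof (cases "q = 0")
  case True
  have "theta (0::'a) = 1" unfolding theta_def by (subst suminf_finite[of "{0}"]) auto
  then show ?thesis using True by (simp add: qp_def qo_def)
next
  case False
  have "(\<lambda>n. (\<Prod>i<n. 1 - (-q) ^ (2 * i + 1))\<^sup>2) \<longlonglongrightarrow> (qo (- q))\<^sup>2"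
    using q by (intro tendsto_power qo_lim) simp
  then have "(\<lambda>n. (\<Prod>i<n. 1 + q ^ (2 * i + 1))\<^sup>2) \<longlonglongrightarrow> (qo (- q))\<^sup>2" by simp
  moreover have "(\<lambda>n. (\<Prod>i<n. 1 + q ^ (2 * i + 1))\<^sup>2) \<longlonglongrightarrow> theta q / qp (q\<^sup>2)"
    unfolding theta_finite[OF q False] theta_def
    using gauss_tannery[OF norm_sq_less[OF q] theta_summable[OF q], of 0] by simp
  ultimately have "(qo (- q))\<^sup>2 = theta q / qp (q\<^sup>2)" by (rule LIMSEQ_unique)
  then show ?thesis using qp_nz[OF norm_sq_less[OF q]] by simp
qed

section \<open>Jacobi's identity and the growth of the Euler product\<close>

lemma prod_one_minus_power: "q \<noteq> 0 \<Longrightarrow> (\<Prod>i<n. 1 - inverse q ^ Suc i) = (-1) ^ n * qpf q n / q ^ (n * (n + 1) div 2)"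
  for q :: "'a::field"
proof (induction n)
  case (Suc n)
  have T: "Suc n * (Suc n + 1) div 2 = n * (n + 1) div 2 + Suc n"
    by (simp add: algebra_simps)
  have e: "1 - inverse q ^ Suc n = (-1) * (1 - q ^ Suc n) / q ^ Suc n"
    using Suc.prems by (simp add: field_simps power_inverse)
  have "(\<Prod>i<Suc n. 1 - inverse q ^ Suc i) = ((-1) ^ n * qpf q n / q ^ (n * (n + 1) div 2)) * ((-1) * (1 - q ^ Suc n) / q ^ Suc n)"
    by (simp only: prod.lessThan_Suc Suc.IH[OF Suc.prems] e)
  also have "\<dots> = (-1) ^ Suc n * qpf q (Suc n) / q ^ (Suc n * (Suc n + 1) div 2)"
    unfolding T qpf_Suc power_add power_Suc[of "-1"] by (simp only: times_divide_times_eq mult_ac)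
  finally show ?case .
qed simp

text \<open>The derivative at \<open>z = 1\<close> of the finite triple product with argument \<open>- z\<close>,
  one of whose factors is \<open>1 - z\<close>.\<close>

lemma jacobi_finite:
  fixes q :: "'a::{real_normed_field,banach}"
  assumes q: "norm q < 1" "q \<noteq> 0"
  shows "(qpf q n)\<^sup>2 = (\<Sum>k\<le>n. (-1) ^ k * (2 * of_nat k + 1) * q ^ (k * (k + 1) div 2) * qbinom q (2 * n + 1) (n - k))"
proof -
  define N where "N = 2 * n + 1"
  let ?g = "qbinom q N"
  \<comment> \<open>With the argument - z / q^n the middle factor j = n becomes 1 - z, and n factors
    remain on either side of it.\<close>
  define L where "L = (\<lambda>z. \<Prod>j<N. 1 + z * (- 1 / q ^ n) * q ^ j)"
  define c where "c = (\<lambda>m. q ^ (m * (m - 1) div 2) * ?g m * (- 1 / q ^ n) ^ m)"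
  have L1: "L z = (\<Sum>m\<le>N. c m * z ^ m)" for z
    unfolding L_def q_binomial c_def power_mult_distrib
    by (intro sum.cong refl) (simp only: mult_ac)
  have "(L has_field_derivative (\<Sum>m\<le>N. c m * (of_nat m * 1 ^ (m - 1)))) (at 1)"
    unfolding L1[abs_def] by (auto intro!: derivative_eq_intros sum.cong)
  then have d1: "(L has_field_derivative (\<Sum>m\<le>N. c m * of_nat m)) (at 1)" by simp
  define R where "R = (\<lambda>z. (\<Prod>j<n. 1 + z * (- 1 / q ^ n) * q ^ j) * (\<Prod>i<n. 1 + z * (- 1 / q ^ n) * q ^ (n + Suc i)))"
  have L2: "L z = (1 - z) * R z" for z
  proof -
    have "L z = (1 + z * (- 1 / q ^ n) * q ^ n) * (\<Prod>j\<in>{..<N} - {n}. 1 + z * (- 1 / q ^ n) * q ^ j)"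
      unfolding L_def by (subst prod.remove[of _ n]) (auto simp: N_def)
    also have "{..<N} - {n} = {..<n} \<union> {n<..<N}" by (auto simp: N_def)
    also have "(\<Prod>j\<in>{..<n} \<union> {n<..<N}. 1 + z * (- 1 / q ^ n) * q ^ j) =
       (\<Prod>j<n. 1 + z * (- 1 / q ^ n) * q ^ j) * (\<Prod>j\<in>{n<..<N}. 1 + z * (- 1 / q ^ n) * q ^ j)"
      by (rule prod.union_disjoint) auto
    also have "(\<Prod>j\<in>{n<..<N}. 1 + z * (- 1 / q ^ n) * q ^ j) = (\<Prod>i<n. 1 + z * (- 1 / q ^ n) * q ^ (n + Suc i))"
      by (rule prod.reindex_bij_witness[of _ "\<lambda>i. n + Suc i" "\<lambda>j. j - Suc n"]) (auto simp: N_def)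
    finally show ?thesis using q by (simp add: R_def)
  qed
  have "isCont R 1" unfolding R_def by (intro continuous_intros)
  \<comment> \<open>Caratheodory's form of the derivative: L z = (1 - z) R z, and continuity of
    \<open>R\<close> at 1 suffices.\<close>
  then have "(L has_field_derivative - R 1) (at 1)"
    unfolding CARAT_DERIV by (intro exI[of _ "\<lambda>z. - R z"]) (auto simp: L2 algebra_simps intro!: continuous_intros)
  from DERIV_unique[OF this d1] have "- R 1 = (\<Sum>m\<le>N. c m * of_nat m)" .
  then have R1: "R 1 = - (\<Sum>m\<le>N. c m * of_nat m)" by (metis minus_minus)
  have "(\<Prod>j<n. 1 + 1 * (- 1 / q ^ n) * q ^ j) = (\<Prod>j<n. 1 + 1 * (- 1 / q ^ n) * q ^ (n - Suc j))"
    by (rule prod.nat_diff_reindex[symmetric])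
  also have "\<dots> = (\<Prod>i<n. 1 - inverse q ^ Suc i)"
  proof (intro prod.cong refl)
    fix i assume "i \<in> {..<n}"
    then obtain d where d: "n = i + Suc d" using less_iff_Suc_add by auto
    show "1 + 1 * (- 1 / q ^ n) * q ^ (n - Suc i) = 1 - inverse q ^ Suc i"
      using q unfolding d by (simp add: field_simps power_add power_inverse)
  qed
  also have "\<dots> = (-1) ^ n * qpf q n / q ^ (n * (n + 1) div 2)" by (rule prod_one_minus_power[OF q(2)])
  finally have "R 1 = (-1) ^ n * qpf q n / q ^ (n * (n + 1) div 2) * qpf q n"
    using q unfolding R_def by (simp add: qpf_def power_add)
  moreover have "(-1) ^ n * q ^ A * ((-1) ^ n * P / q ^ A * P) = P\<^sup>2" for P A
  proof -
    have "(-1) ^ n * q ^ A * ((-1) ^ n * P / q ^ A * P) = ((-1) ^ n * (-1) ^ n) * P * P" using q(2) by simp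
    also have "(-1::'a) ^ n * (-1) ^ n = 1" by (simp add: power_mult_distrib[symmetric])
    finally show ?thesis by (simp add: power2_eq_square)
  qed
  ultimately have "(qpf q n)\<^sup>2 = (-1) ^ n * q ^ (n * (n + 1) div 2) * R 1" by (simp only:)
  also have "\<dots> = (\<Sum>m\<le>N. (-1) ^ (n + 1) * q ^ (n * (n + 1) div 2) * (c m * of_nat m))"
    unfolding R1 sum_distrib_left by (simp add: sum_negf sum_distrib_left)
  also have "\<dots> = (\<Sum>m\<le>N. (-1) ^ (n + 1 + m) * of_nat m * q ^ (nat ((int m - int n) * (int m - int n - 1)) div 2) * ?g m)"
  proof (intro sum.cong refl)
    fix m :: nat
    define A B C where "A = n * (n + 1) div 2" and "B = m * (m - 1) div 2" and "C = nat ((int m - int n) * (int m - int n - 1)) div 2"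
    have "A + B = C + n * m"
    proof -
      have "even (n * (n + 1))" by auto
      then have A: "2 * A = n * (n + 1)" unfolding A_def by (rule dvd_mult_div_cancel)
      have "even (m * (m - 1))" by auto
      then have B: "2 * B = m * (m - 1)" unfolding B_def by (rule dvd_mult_div_cancel)
      have mm: "int (m * (m - 1)) = int m * (int m - 1)" by (cases m) (auto simp: algebra_simps)
      have nn: "(int m - int n) * (int m - int n - 1) \<ge> 0"
        by (cases "int m - int n \<ge> 1") (auto intro: mult_nonneg_nonneg mult_nonpos_nonpos)
      have "even ((int m - int n) * (int m - int n - 1))" by auto
      then have "even (nat ((int m - int n) * (int m - int n - 1)))" using nn by (simp add: even_nat_iff)
      then have "2 * C = nat ((int m - int n) * (int m - int n - 1))" unfolding C_def by (rule dvd_mult_div_cancel)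
      then have C: "int (2 * C) = (int m - int n) * (int m - int n - 1)" using nn by simp
      have "int (2 * A + 2 * B) = int (2 * C + 2 * (n * m))"
        unfolding of_nat_add C unfolding A B mm by (simp add: algebra_simps)
      then show ?thesis by linarith
    qed
    then have e: "q ^ A * q ^ B = q ^ C * q ^ (n * m)" by (simp add: power_add[symmetric])
    have "(-1) ^ (n + 1) * q ^ A * (c m * of_nat m) = (-1) ^ (n + 1 + m) * of_nat m * ?g m * ((q ^ A * q ^ B) / q ^ (n * m))"
    proof -
      have e2: "(- 1 / q ^ n) ^ m = (-1) ^ m / q ^ (n * m)" by (simp only: power_divide power_mult)
      show ?thesis unfolding c_def B_def[symmetric] e2 by (simp add: power_add mult_ac)
    qed
    also have "\<dots> = (-1) ^ (n + 1 + m) * of_nat m * q ^ C * ?g m"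
      unfolding e using q by simp
    finally show "(-1) ^ (n + 1) * q ^ (n * (n + 1) div 2) * (c m * of_nat m) =
       (-1) ^ (n + 1 + m) * of_nat m * q ^ (nat ((int m - int n) * (int m - int n - 1)) div 2) * ?g m"
      unfolding A_def C_def .
  qed
  also have "\<dots> = (\<Sum>k\<le>n. (-1) ^ k * (2 * of_nat k + 1) * q ^ (k * (k + 1) div 2) * ?g (n - k))"
  proof -
    let ?f = "\<lambda>m. (-1) ^ (n + 1 + m) * of_nat m * q ^ (nat ((int m - int n) * (int m - int n - 1)) div 2) * ?g m"
    \<comment> \<open>The indices n + 1 + k and n - k share the exponent k (k + 1) / 2 and the
      Gaussian coefficient but have opposite signs, so their weights combine to (n + 1 + k) - (n -
      k) = 2k + 1.\<close>
    have f1: "?f (n + Suc k) = (-1) ^ k * (of_nat (n + Suc k)) * q ^ (k * (k + 1) div 2) * ?g (n - k)" if "k \<le> n" for k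
    proof -
      have "int (n + Suc k) - int n = int (k + 1)" "int (n + Suc k) - int n - 1 = int k" by auto
      then have "(int (n + Suc k) - int n) * (int (n + Suc k) - int n - 1) = int (k * (k + 1))"
        by (simp only: of_nat_mult mult.commute)
      then have 1: "nat ((int (n + Suc k) - int n) * (int (n + Suc k) - int n - 1)) = k * (k + 1)" by (simp only: nat_int)
      have 2: "?g (n + Suc k) = ?g (n - k)"
        using qbinom_sym[OF q(1), of "n + Suc k" "n - k"] that by (simp add: mult_2 N_def)
      have 3: "(-1::'a) ^ (n + 1 + (n + Suc k)) = (-1) ^ k" by (simp add: power_add)
      show ?thesis unfolding 1 2 3 ..
    qed
    have f2: "?f (n - k) = - ((-1) ^ k * of_nat (n - k) * q ^ (k * (k + 1) div 2) * ?g (n - k))" if "k \<le> n" for k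
    proof -
      have "int (n - k) - int n = - int k" "int (n - k) - int n - 1 = - int (k + 1)" using that by auto
      then have "(int (n - k) - int n) * (int (n - k) - int n - 1) = int (k * (k + 1))"
        by (simp only: of_nat_mult minus_mult_minus)
      then have 1: "nat ((int (n - k) - int n) * (int (n - k) - int n - 1)) = k * (k + 1)" by (simp only: nat_int)
      have "n + 1 + (n - k) = 2 * (n - k) + (k + 1)" using that by simp
      then have 2: "(-1::'a) ^ (n + 1 + (n - k)) = - ((-1) ^ k)" by (simp only: power_add power_mult) simp
      show ?thesis unfolding 1 2 by simp
    qed
    have "(\<Sum>m\<le>N. ?f m) = sum ?f {..n} + sum ?f {n+1..N}"
      proof -
      have "{..N} = {..n} \<union> {n+1..N}" by (auto simp: N_def)
      moreover have "sum ?f ({..n} \<union> {n+1..N}) = sum ?f {..n} + sum ?f {n+1..N}"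
        by (rule sum.union_disjoint) auto
      ultimately show ?thesis by (simp only:)
    qed
    also have "sum ?f {..n} = (\<Sum>k\<le>n. ?f (n - k))"
      by (rule sum.reindex_bij_witness[of _ "\<lambda>k. n - k" "\<lambda>k. n - k"]) auto
    also have "sum ?f {n+1..N} = (\<Sum>k\<le>n. ?f (n + Suc k))"
      by (rule sum.reindex_bij_witness[of _ "\<lambda>k. n + Suc k" "\<lambda>k. k - Suc n"]) (auto simp: N_def)
    also have "(\<Sum>k\<le>n. ?f (n - k)) + (\<Sum>k\<le>n. ?f (n + Suc k)) = (\<Sum>k\<le>n. ?f (n - k) + ?f (n + Suc k))"
      by (rule sum.distrib[symmetric])
    also have "\<dots> = (\<Sum>k\<le>n. (-1) ^ k * (2 * of_nat k + 1) * q ^ (k * (k + 1) div 2) * ?g (n - k))"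
    proof (intro sum.cong refl)
      fix k assume "k \<in> {..n}"
      then have k: "k \<le> n" by simp
      have "?f (n - k) + ?f (n + Suc k) = (-1) ^ k * (of_nat (n + Suc k) - of_nat (n - k)) * q ^ (k * (k + 1) div 2) * ?g (n - k)"
        unfolding f1[OF k] f2[OF k] by (simp only: left_diff_distrib right_diff_distrib) simp
      moreover have "of_nat (n + Suc k) - of_nat (n - k) = (2 * of_nat k + 1 :: 'a)" using k by (simp add: of_nat_diff)
      ultimately show "?f (n - k) + ?f (n + Suc k) = (-1) ^ k * (2 * of_nat k + 1) * q ^ (k * (k + 1) div 2) * ?g (n - k)"
        by (simp only:)
    qed
    finally show ?thesis .
  qed
  finally show ?thesis unfolding N_def .
qed

text \<open>Telescoping: (k + 1) r^(k+1) is at most 1 + r + ... + r^k, so (1 - r) (k + 1) r^T(k+1)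
  is at most r^T(k) - r^T(k+1) for the triangular numbers T. The 4 is 1 for the first term plus 3
  for the others, as 2k + 3 \<le> 3 (k + 1).\<close>

lemma triangular_weight_bound:
  fixes r :: real assumes r: "0 \<le> r" "r < 1"
  shows "(1 - r) * (\<Sum>k<n. (2 * real k + 1) * r ^ (k * (k + 1) div 2)) \<le> 4"
proof -
  let ?T = "\<lambda>k::nat. k * (k + 1) div 2"
  have T: "?T (Suc k) = ?T k + Suc k" for k by (simp add: algebra_simps)
  have step: "(1 - r) * (real (Suc k) * r ^ ?T (Suc k)) \<le> r ^ ?T k - r ^ ?T (Suc k)" for k
  proof -
    have "(\<Sum>i<Suc k. r ^ Suc k) \<le> (\<Sum>i<Suc k. r ^ i)"
      using r by (intro sum_mono power_decreasing) auto
    then have "real (Suc k) * r ^ Suc k \<le> (\<Sum>i<Suc k. r ^ i)" by simp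
    then have "(1 - r) * (real (Suc k) * r ^ Suc k) \<le> (1 - r) * (\<Sum>i<Suc k. r ^ i)"
      using r by (intro mult_left_mono) auto
    also have "\<dots> = 1 - r ^ Suc k" by (rule one_diff_power_eq[symmetric])
    finally have "(1 - r) * (real (Suc k) * r ^ Suc k) * r ^ ?T k \<le> (1 - r ^ Suc k) * r ^ ?T k"
      using r by (intro mult_right_mono) auto
    then show ?thesis unfolding T power_add by (simp add: algebra_simps)
  qed
  have A0: "(1 - r) * (\<Sum>k<n. real (Suc k) * r ^ ?T (Suc k)) \<le> 1 - r ^ ?T n" for n
  proof (induction n)
    case (Suc n)
    then show ?case using step[of n] by (simp only: sum.lessThan_Suc distrib_left)
  qed simp
  have A: "(1 - r) * (\<Sum>k<n. real (Suc k) * r ^ ?T (Suc k)) \<le> 1" for n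
    using A0[of n] zero_le_power[OF r(1), of "?T n"] by linarith
  show ?thesis
  proof (cases n)
    case (Suc m)
    have "(\<Sum>k<n. (2 * real k + 1) * r ^ ?T k) = 1 + (\<Sum>k<m. (2 * real (Suc k) + 1) * r ^ ?T (Suc k))"
      unfolding Suc sum.lessThan_Suc_shift by simp
    also have "\<dots> \<le> 1 + (\<Sum>k<m. 3 * (real (Suc k) * r ^ ?T (Suc k)))"
    proof (intro add_left_mono sum_mono)
      fix k
      have "(2 * real (Suc k) + 1) * r ^ ?T (Suc k) \<le> (3 * real (Suc k)) * r ^ ?T (Suc k)"
        using r by (intro mult_right_mono) auto
      then show "(2 * real (Suc k) + 1) * r ^ ?T (Suc k) \<le> 3 * (real (Suc k) * r ^ ?T (Suc k))" by (simp only: mult.assoc)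
    qed
    finally have "(1 - r) * (\<Sum>k<n. (2 * real k + 1) * r ^ ?T k) \<le> (1 - r) * (1 + 3 * (\<Sum>k<m. real (Suc k) * r ^ ?T (Suc k)))"
      unfolding sum_distrib_left[symmetric] using r by (intro mult_left_mono) auto
    also have "\<dots> = (1 - r) + 3 * ((1 - r) * (\<Sum>k<m. real (Suc k) * r ^ ?T (Suc k)))" by (simp add: algebra_simps)
    also have "\<dots> \<le> 4" using A[of m] r by linarith
    finally show ?thesis .
  qed simp
qed

text \<open>In the limit \<open>jacobi_finite\<close> equates the cube of \<open>qp q\<close> with
  the series of (-1)^k (2k + 1) q^(k(k+1)/2), whose absolute values sum to O(1 / (1 - |q|)).
  Estimating the product factor by factor would only give exponential growth in 1 / (1 -
  |q|).\<close>

lemma qp_cube_bound: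
  fixes q :: "'a::{real_normed_field,banach}"
  assumes q: "norm q < 1"
  shows "norm (qp q) ^ 3 \<le> 4 / (1 - norm q)"
proof (cases "q = 0")
  case True
  then show ?thesis by (simp add: qp_def)
next
  case False
  define u where "u = (\<lambda>k. (-1) ^ k * (2 * of_nat k + 1) * q ^ (k * (k + 1) div 2))"
  have nu: "norm (u k) \<le> (2 * real k + 1) * norm q ^ (k * (k + 1) div 2)" for k
  proof -
    have "norm (2 * of_nat k + 1 :: 'a) = 2 * real k + 1"
      using norm_of_nat[of "2 * k + 1", where 'a = 'a] by (simp add: add.commute)
    then show ?thesis by (simp add: u_def norm_mult norm_power)
  qed
  have part: "(\<Sum>k<n. norm (u k)) \<le> 4 / (1 - norm q)" for n
  proof -
    have "(\<Sum>k<n. norm (u k)) \<le> (\<Sum>k<n. (2 * real k + 1) * norm q ^ (k * (k + 1) div 2))"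
      by (intro sum_mono nu)
    also have "\<dots> \<le> 4 / (1 - norm q)"
      using triangular_weight_bound[of "norm q" n] q by (simp add: field_simps)
    finally show ?thesis .
  qed
  have su: "summable (\<lambda>k. norm (u k))"
  proof (rule bounded_imp_summable)
    show "(\<Sum>k\<le>n. norm (u k)) \<le> 4 / (1 - norm q)" for n
      using part[of "Suc n"] by (simp only: lessThan_Suc_atMost)
  qed simp
  have "(\<lambda>n. (qpf q n)\<^sup>2) \<longlonglongrightarrow> (qp q)\<^sup>2" by (intro tendsto_power qpf_lim q)
  moreover have "(\<lambda>n. (qpf q n)\<^sup>2) \<longlonglongrightarrow> suminf u / qp q"
    using gauss_tannery[OF q su, of 1] unfolding jacobi_finite[OF q False] u_def by simp
  ultimately have "(qp q)\<^sup>2 = suminf u / qp q" by (rule LIMSEQ_unique)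
  then have "(qp q) ^ 3 = suminf u" using qp_nz[OF q] by (simp add: power2_eq_square power3_eq_cube field_simps)
  then have "norm (qp q) ^ 3 = norm (suminf u)" using norm_power[of "qp q" 3] by simp
  moreover have "norm (suminf u) \<le> suminf (\<lambda>k. norm (u k))" by (rule summable_norm[OF su])
  moreover have "suminf (\<lambda>k. norm (u k)) \<le> 4 / (1 - norm q)"
  proof (rule LIMSEQ_le_const2[OF summable_LIMSEQ[OF su]])
    show "\<exists>N. \<forall>n\<ge>N. (\<Sum>k<n. norm (u k)) \<le> 4 / (1 - norm q)" using part by blast
  qed
  ultimately show ?thesis by linarith
qed

section \<open>Theta functions under squaring of the nome\<close>

lemma has_sum_times_real:
  fixes f :: "'a \<Rightarrow> real" and g :: "'b \<Rightarrow> real"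
  assumes f: "(f has_sum a) A" and g: "(g has_sum b) B"
  shows "((\<lambda>(x, y). f x * g y) has_sum (a * b)) (A \<times> B)"
proof (rule has_sum_SigmaI)
  show "((\<lambda>y. case (x, y) of (x, y) \<Rightarrow> f x * g y) has_sum f x * b) B" if "x \<in> A" for x
    using has_sum_cmult_right[OF g, of "f x"] by simp
  show "((\<lambda>x. f x * b) has_sum a * b) A"
    using has_sum_cmult_left[OF f] by simp
  have fa: "(\<lambda>x. norm (f x)) summable_on A"
    using has_sum_imp_summable[OF f] by (rule summable_on_iff_abs_summable_on_real[THEN iffD1])
  have ga: "(\<lambda>x. norm (g x)) summable_on B"
    using has_sum_imp_summable[OF g] by (rule summable_on_iff_abs_summable_on_real[THEN iffD1])
  have "(\<lambda>z. norm (case z of (x, y) \<Rightarrow> f x * g y)) summable_on A \<times> B"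
  proof (subst Infinite_Sum.abs_summable_on_Sigma_iff, intro conjI ballI)
    show "(\<lambda>y. norm (case (x, y) of (x, y) \<Rightarrow> f x * g y)) summable_on B" for x
      using summable_on_cmult_right[OF ga, of "norm (f x)"] by (simp add: abs_mult)
    have "infsum (\<lambda>y. norm (f x * g y)) B = norm (f x) * infsum (\<lambda>y. norm (g y)) B" for x
      unfolding norm_mult by (rule infsum_cmult_right) (use ga in auto)
    then show "(\<lambda>x. norm (infsum (\<lambda>y. norm (case (x, y) of (x, y) \<Rightarrow> f x * g y)) B)) summable_on A"
      using summable_on_cmult_left[OF fa, of "infsum (\<lambda>y. norm (g y)) B"] infsum_nonneg[of B "\<lambda>y. norm (g y)"]
      by (simp add: abs_mult)
  qed
  then show "(\<lambda>(x, y). f x * g y) summable_on A \<times> B" by (rule Infinite_Sum.abs_summable_summable)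
qed

lemma theta_has_sum_int:
  fixes q :: real assumes q: "norm q < 1"
  shows "((\<lambda>n::int. q ^ nat (n\<^sup>2)) has_sum theta q) UNIV"
proof -
  define S where "S = (\<Sum>k. q ^ (k\<^sup>2))"
  have sm: "summable (\<lambda>k. q ^ (k\<^sup>2))" by (rule summable_norm_cancel, rule summable_power_sq[OF q])
  then have s: "(\<lambda>k. q ^ (k\<^sup>2)) sums S" unfolding S_def by (rule summable_sums)
  have s1: "((\<lambda>k. q ^ (k\<^sup>2)) has_sum S) UNIV"
    by (rule norm_summable_imp_has_sum[OF summable_power_sq[OF q] s])
  have "(\<lambda>k. q ^ ((Suc k)\<^sup>2)) sums (S - 1)"
    using s sums_Suc_iff[of "\<lambda>k. q ^ (k\<^sup>2)" "S - 1"] by simp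
  moreover have "summable (\<lambda>k. norm (q ^ ((Suc k)\<^sup>2)))"
    using summable_power_sq[OF q] summable_Suc_iff[of "\<lambda>k. norm (q ^ (k\<^sup>2))"] by blast
  ultimately have s2: "((\<lambda>k. q ^ ((Suc k)\<^sup>2)) has_sum (S - 1)) UNIV"
    by (intro norm_summable_imp_has_sum)
  have "((\<lambda>n::int. q ^ nat (n\<^sup>2)) has_sum S) {0..}"
    by (rule has_sum_reindex_bij_witness[where i = nat and j = int, THEN iffD1, OF _ _ _ _ _ refl s1])
       (auto simp: nat_power_eq)
  moreover have "((\<lambda>n::int. q ^ nat (n\<^sup>2)) has_sum (S - 1)) {..<0}"
  proof (rule has_sum_reindex_bij_witness[where i = "\<lambda>n. nat (- n - 1)" and j = "\<lambda>k. - int (Suc k)", THEN iffD1, OF _ _ _ _ _ refl s2])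
    show "q ^ nat ((- int (Suc k))\<^sup>2) = q ^ (Suc k)\<^sup>2" for k
      by (simp only: power2_minus nat_power_eq of_nat_0_le_iff nat_int)
  qed auto
  ultimately have "((\<lambda>n::int. q ^ nat (n\<^sup>2)) has_sum (S + (S - 1))) ({0..} \<union> {..<0})"
    by (rule has_sum_Un_disjoint) auto
  moreover have "{0..} \<union> {..<0} = (UNIV :: int set)" by auto
  moreover have "theta q = S + (S - 1)"
  proof (rule sums_unique2[OF theta_sums[OF q]])
    have "(\<lambda>k. 2 * q ^ (k\<^sup>2) - (if k = 0 then 1 else 0)) sums (2 * S - 1)"
      using sums_If_finite[of "\<lambda>n. n = 0" "\<lambda>_. 1::real"] by (intro sums_diff sums_mult s) simp
    moreover have "(\<lambda>k. 2 * q ^ (k\<^sup>2) - (if k = 0 then 1 else 0)) = (\<lambda>k::nat. (if k = 0 then 1 else 2) * q ^ k\<^sup>2)"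
      by auto
    ultimately show "(\<lambda>k. (if k = 0 then 1 else 2) * q ^ k\<^sup>2) sums (S + (S - 1))" by simp
  qed
  ultimately show ?thesis by simp
qed

text \<open>Rotating the lattice by \<open>(c, d) \<mapsto> (c + d, c - d)\<close> maps it onto the points with even coordinate sum.\<close>

lemma theta_sq_add:
  fixes q :: real assumes q: "norm q < 1"
  shows "(theta q)\<^sup>2 + (theta (- q))\<^sup>2 = 2 * (theta (q\<^sup>2))\<^sup>2"
proof -
  have P: "((\<lambda>(m, n). r ^ nat (m\<^sup>2) * r ^ nat (n\<^sup>2)) has_sum (theta r * theta r)) (UNIV \<times> UNIV)" if "norm r < 1" for r :: real
    by (intro has_sum_times_real theta_has_sum_int that)
  define x where "x = theta q * theta q + theta (- q) * theta (- q)"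
  define f where "f = (\<lambda>r::real. \<lambda>(m::int, n::int). r ^ nat (m\<^sup>2) * r ^ nat (n\<^sup>2))"
  define E where "E = {(m::int, n::int). even (m + n)}"
  have 1: "((\<lambda>z. f q z + f (- q) z) has_sum x) UNIV"
    unfolding x_def using P[of q] P[of "- q"] q by (intro has_sum_add) (simp_all add: f_def)
  have 2: "((\<lambda>z. 2 * f q z) has_sum x) E"
  proof (rule has_sum_cong_neutral[THEN iffD1, OF _ _ _ 1])
    fix z :: "int \<times> int" assume "z \<in> UNIV - E"
    then obtain m n where z: "z = (m, n)" "odd (m + n)" by (auto simp: E_def)
    then have "even m \<and> odd n \<or> odd m \<and> even n" by auto
    then have "even (nat (m\<^sup>2)) \<and> odd (nat (n\<^sup>2)) \<or> odd (nat (m\<^sup>2)) \<and> even (nat (n\<^sup>2))" by (simp add: even_nat_iff)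
    then show "f q z + f (- q) z = 0" by (auto simp: z f_def)
  next
    fix z :: "int \<times> int" assume "z \<in> UNIV \<inter> E"
    then obtain m n where z: "z = (m, n)" "even (m + n)" by (auto simp: E_def)
    then have "even m \<and> even n \<or> odd m \<and> odd n" by auto
    then have "even (nat (m\<^sup>2)) \<and> even (nat (n\<^sup>2)) \<or> odd (nat (m\<^sup>2)) \<and> odd (nat (n\<^sup>2))" by (simp add: even_nat_iff)
    then show "f q z + f (- q) z = 2 * f q z" by (auto simp: z f_def)
  qed auto
  have 3: "((\<lambda>z. 2 * f (q\<^sup>2) z) has_sum x) UNIV"
  proof (rule has_sum_reindex_bij_witness[where j = "\<lambda>(c, d). (c + d, c - d)" and i = "\<lambda>(m, n). ((m + n) div 2, (m - n) div 2)", THEN iffD2, OF _ _ _ _ _ refl 2])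
    fix z :: "int \<times> int"
    obtain c d where z: "z = (c, d)" by (cases z)
    show "(case (case z of (c, d) \<Rightarrow> (c + d, c - d)) of (m, n) \<Rightarrow> ((m + n) div 2, (m - n) div 2)) = z"
      by (simp add: z)
    show "(case z of (c, d) \<Rightarrow> (c + d, c - d)) \<in> E" by (simp add: z E_def)
    have "int (nat ((c + d)\<^sup>2) + nat ((c - d)\<^sup>2)) = int (2 * nat (c\<^sup>2) + 2 * nat (d\<^sup>2))"
    proof -
      have nn: "int (nat (i\<^sup>2)) = i\<^sup>2" for i :: int by simp
      show ?thesis unfolding of_nat_add of_nat_mult nn by (simp add: power2_eq_square algebra_simps)
    qed
    then have "nat ((c + d)\<^sup>2) + nat ((c - d)\<^sup>2) = 2 * nat (c\<^sup>2) + 2 * nat (d\<^sup>2)" by linarith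
    then show "2 * f q (case z of (c, d) \<Rightarrow> (c + d, c - d)) = 2 * f (q\<^sup>2) z"
      by (simp add: z f_def power_add[symmetric] power_mult[symmetric] ring_distribs)
  next
    fix z assume "z \<in> E"
    then obtain m n where z: "z = (m, n)" "even (m + n)" by (auto simp: E_def)
    define d where "d = (m + n) div 2"
    have "m + n = 2 * d" using z(2) by (simp add: d_def)
    then have "m = 2 * d - n" by simp
    then show "(case (case z of (m, n) \<Rightarrow> ((m + n) div 2, (m - n) div 2)) of (c, d) \<Rightarrow> (c + d, c - d)) = z"
      by (simp add: z)
  qed auto
  have 4: "((\<lambda>z. 2 * f (q\<^sup>2) z) has_sum (2 * (theta (q\<^sup>2) * theta (q\<^sup>2)))) UNIV"
    using has_sum_cmult_right[OF P[OF norm_sq_less[OF q]], of 2] by (simp add: f_def)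
  from has_sum_unique[OF 3 4] show ?thesis by (simp only: x_def power2_eq_square)
qed

text \<open>Immediate from the product formula, since (1 - y)(1 + y) = 1 - y^2 in each factor. With
  \<open>theta_sq_add\<close> it says that theta(q)^2 and theta(-q)^2 perform a step of the
  arithmetic-geometric mean when q is squared.\<close>

lemma theta_mult_minus:
  fixes q :: real assumes q: "norm q < 1"
  shows "theta q * theta (- q) = (theta (- (q\<^sup>2)))\<^sup>2"
proof -
  have q2: "norm (q\<^sup>2) < 1" by (rule norm_sq_less[OF q])
  have "theta q * theta (- q) = (qp (q\<^sup>2))\<^sup>2 * (qo q * qo (- q))\<^sup>2"
    using theta_product[of q] theta_product[of "- q"] q by (simp add: power_mult_distrib) (simp add: power2_eq_square)
  also have "\<dots> = (theta (- (q\<^sup>2)))\<^sup>2"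
    unfolding qo_mult_minus[OF q] qp_split[OF q2] using theta_product[of "- (q\<^sup>2)"] q2
    by (simp add: power_mult_distrib)
  finally show ?thesis .
qed

lemma qo_pos: "norm q < 1 \<Longrightarrow> qo q > 0" for q :: real
proof -
  assume q: "norm q < 1"
  have "0 \<le> qo q"
  proof (rule LIMSEQ_le_const[OF qo_lim[OF q]])
    have "0 \<le> 1 - q ^ (2 * k + 1)" for k
    proof -
      have "\<bar>q\<bar> ^ (2 * k + 1) \<le> 1" using q by (intro power_le_one) auto
      then show ?thesis using abs_ge_self[of "q ^ (2 * k + 1)"] unfolding power_abs by linarith
    qed
    then show "\<exists>N. \<forall>n\<ge>N. 0 \<le> (\<Prod>k<n. 1 - q ^ (2 * k + 1))" by (auto intro!: prod_nonneg)
  qed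
  with qo_nz[OF q] show ?thesis by linarith
qed

lemma qp_pos: "norm q < 1 \<Longrightarrow> qp q > 0" for q :: real
proof -
  assume q: "norm q < 1"
  have "0 \<le> qp q"
  proof (rule LIMSEQ_le_const[OF qpf_lim[OF q]])
    have "0 \<le> 1 - q ^ Suc k" for k
    proof -
      have "\<bar>q\<bar> ^ Suc k \<le> 1" using q by (intro power_le_one) auto
      then show ?thesis using abs_ge_self[of "q ^ Suc k"] unfolding power_abs by linarith
    qed
    then show "\<exists>N. \<forall>n\<ge>N. 0 \<le> qpf q n" unfolding qpf_def by (auto intro!: prod_nonneg)
  qed
  with qp_nz[OF q] show ?thesis by linarith
qed

lemma theta_pos: "norm q < 1 \<Longrightarrow> theta q > 0" for q :: real
  using theta_product[of q] qp_pos[OF norm_sq_less[of q]] qo_pos[of "- q"] by simp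

text \<open>All terms of the difference are nonnegative, and k = 1 alone contributes 4q. The lower
  bound for \<open>lam\<close> near 0 rests on this.\<close>

lemma theta_minus_less:
  fixes q :: real assumes q: "0 < q" "q < 1" shows "theta (- q) + 4 * q \<le> theta q"
proof -
  let ?f = "\<lambda>k::nat. (if k = 0 then 1 else 2) * q ^ (k\<^sup>2) - (if k = 0 then 1 else 2) * (- q) ^ (k\<^sup>2)"
  have s: "?f sums (theta q - theta (- q))"
    by (intro sums_diff theta_sums) (use q in auto)
  have nn: "?f k \<ge> 0" for k
  proof -
    have "(- q) ^ (k\<^sup>2) \<le> q ^ (k\<^sup>2)" using q by (cases "even k") (auto simp: power_minus_odd)
    then show ?thesis by simp
  qed
  have "sum ?f {1} \<le> suminf ?f"
    by (rule sum_le_suminf) (use s nn in \<open>auto simp: sums_iff\<close>)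
  then show ?thesis using s by (simp add: sums_iff)
qed

lemma theta_near_0:
  fixes q :: real assumes q: "norm q \<le> 1/2" shows "\<bar>theta q - 1\<bar> \<le> 4 * \<bar>q\<bar>"
proof -
  have q1: "norm q < 1" using q by simp
  have th: "(\<lambda>k. 2 * q ^ ((Suc k)\<^sup>2)) sums (theta q - 1)"
    using theta_sums[OF q1] sums_Suc_iff[of "\<lambda>k. (if k = 0 then 1 else 2) * q ^ k\<^sup>2" "theta q - 1"] by simp
  have g: "(\<lambda>k. 2 * \<bar>q\<bar> * \<bar>q\<bar> ^ k) sums (2 * \<bar>q\<bar> * (1 / (1 - \<bar>q\<bar>)))"
    using q by (intro sums_mult geometric_sums) auto
  have le: "norm (2 * q ^ ((Suc k)\<^sup>2)) \<le> 2 * \<bar>q\<bar> * \<bar>q\<bar> ^ k" for k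
  proof -
    have "\<bar>q\<bar> ^ ((Suc k)\<^sup>2) \<le> \<bar>q\<bar> ^ Suc k" using q by (intro power_decreasing) (auto simp: power2_eq_square)
    then show ?thesis by (simp add: abs_mult power_abs)
  qed
  have "norm (suminf (\<lambda>k. 2 * q ^ ((Suc k)\<^sup>2))) \<le> suminf (\<lambda>k. 2 * \<bar>q\<bar> * \<bar>q\<bar> ^ k)"
    by (rule norm_suminf_le[OF le]) (use g in \<open>simp add: sums_iff\<close>)
  then have "\<bar>theta q - 1\<bar> \<le> 2 * \<bar>q\<bar> * (1 / (1 - \<bar>q\<bar>))" using th g by (simp add: sums_iff)
  also have "\<dots> \<le> 2 * \<bar>q\<bar> * 2" using q by (intro mult_left_mono) (auto simp: field_simps)
  finally show ?thesis by simp
qed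

section \<open>Jacobi inversion\<close>

text \<open>The complementary modulus theta_4^2 / theta_3^2 as a function of the nome;
  \<open>lam\<close> is the modular lambda function. Defining it as 1 - kap^2 builds in Jacobi's
  quartic identity and avoids theta_2.\<close>

definition kap :: "real \<Rightarrow> real" where "kap q = (theta (- q) / theta q)\<^sup>2"

definition lam :: "real \<Rightarrow> real" where "lam q = 1 - (kap q)\<^sup>2"

lemma kap_range: "0 < q \<Longrightarrow> q < 1 \<Longrightarrow> 0 < kap q \<and> kap q < 1"
  using theta_minus_less[of q] theta_pos[of q] theta_pos[of "- q"] by (simp add: kap_def power_less_one_iff abs_square_less_1)

lemma lam_range: "0 < q \<Longrightarrow> q < 1 \<Longrightarrow> 0 < lam q \<and> lam q < 1"
  using kap_range[of q] by (simp add: lam_def power_less_one_iff)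

text \<open>Squaring the nome is the descending Landen step: with a = theta(q) and b = theta(-q), m
  equals (a^2 - b^2) / (a^2 + b^2), the modulus at q^2, and \<open>lam q\<close> is its ascending
  image.\<close>

lemma kap_square:
  assumes q: "0 < q" "q < 1"
  defines "m \<equiv> (1 - kap q) / (1 + kap q)"
  shows "lam (q\<^sup>2) = m\<^sup>2" "lam q = 4 * m / (1 + m)\<^sup>2" "(theta (q\<^sup>2))\<^sup>2 * (1 + m) = (theta q)\<^sup>2" "0 < m" "m < 1"
proof -
  have n: "norm q < 1" using q by simp
  define a b where "a = theta q" and "b = theta (- q)"
  have ab: "a > 0" "b > 0" using theta_pos n by (auto simp: a_def b_def)
  have k: "kap q = b\<^sup>2 / a\<^sup>2" by (simp add: kap_def a_def b_def power_divide)
  have t3: "(theta (q\<^sup>2))\<^sup>2 = (a\<^sup>2 + b\<^sup>2) / 2" using theta_sq_add[OF n] by (simp add: a_def b_def)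
  have t4: "(theta (- (q\<^sup>2)))\<^sup>2 = a * b" using theta_mult_minus[OF n] by (simp add: a_def b_def)
  have k2: "kap (q\<^sup>2) = 2 * a * b / (a\<^sup>2 + b\<^sup>2)"
    unfolding kap_def power_divide t3 t4 by simp
  have pos: "a\<^sup>2 + b\<^sup>2 > 0" "a\<^sup>2 > 0" using ab by (auto simp: add_pos_pos)
  have m: "m = (a\<^sup>2 - b\<^sup>2) / (a\<^sup>2 + b\<^sup>2)" unfolding m_def k using pos by (simp add: divide_simps)
  have m1: "1 + m = 2 * a\<^sup>2 / (a\<^sup>2 + b\<^sup>2)" unfolding m using pos by (simp add: divide_simps)
  show "0 < m" "m < 1" using kap_range[OF q] by (auto simp: m_def)
  show "(theta (q\<^sup>2))\<^sup>2 * (1 + m) = (theta q)\<^sup>2"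
    unfolding t3 m1 using pos by (simp add: a_def[symmetric])
  have "1 - (2 * a * b / (a\<^sup>2 + b\<^sup>2))\<^sup>2 = ((a\<^sup>2 + b\<^sup>2)\<^sup>2 - (2 * a * b)\<^sup>2) / (a\<^sup>2 + b\<^sup>2)\<^sup>2"
    using pos by (simp add: power_divide diff_divide_distrib)
  also have "(a\<^sup>2 + b\<^sup>2)\<^sup>2 - (2 * a * b)\<^sup>2 = (a\<^sup>2 - b\<^sup>2)\<^sup>2" by (simp add: power2_eq_square algebra_simps)
  finally show "lam (q\<^sup>2) = m\<^sup>2" unfolding lam_def k2 m by (simp add: power_divide)
  have "4 * m / (1 + m)\<^sup>2 = (a\<^sup>2 - b\<^sup>2) * (a\<^sup>2 + b\<^sup>2) / (a\<^sup>2)\<^sup>2"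
    unfolding m1 unfolding m using pos by (simp add: divide_simps power2_eq_square[of "a\<^sup>2 + b\<^sup>2"] power2_eq_square[of "2 * a\<^sup>2"] power2_eq_square[of "2 * _"])
  also have "\<dots> = lam q"
    unfolding lam_def k using pos by (simp add: power_divide field_simps)
  finally show "lam q = 4 * m / (1 + m)\<^sup>2" ..
qed

text \<open>The true behaviour is 16q. Crude constants suffice because \<open>h_lam\<close> and
  \<open>lam_product\<close> take logarithms and divide by quantities that grow like 2^n.\<close>

lemma lam_near_0:
  assumes q: "0 < q" "q \<le> 1/2" shows "lam q \<le> 128 * q" "q \<le> lam q"
proof -
  define a b r where "a = theta q" and "b = theta (- q)" and "r = b / a"
  have n: "norm q < 1" using q by simp
  have ab: "a > 0" "b > 0" using theta_pos n by (auto simp: a_def b_def)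
  have A: "\<bar>a - 1\<bar> \<le> 4 * q" and B: "\<bar>b - 1\<bar> \<le> 4 * q"
    using theta_near_0[of q] theta_near_0[of "- q"] q by (auto simp: a_def b_def)
  have D: "b + 4 * q \<le> a" using theta_minus_less[of q] q by (simp add: a_def b_def)
  have a3: "a \<le> 3" using A q by (auto simp: abs_le_iff)
  have r: "0 < r" "r < 1" using ab D q by (auto simp: r_def)
  have l: "lam q = 1 - r ^ 4" by (simp add: lam_def kap_def a_def b_def r_def)
  have f: "1 - r ^ 4 = (1 - r) * (1 + r + r ^ 2 + r ^ 3)" by (simp add: algebra_simps eval_nat_numeral)
  have p: "r ^ 2 \<le> 1" "r ^ 3 \<le> 1" using r by (auto intro!: power_le_one)
  have r1: "1 - r = (a - b) / a" using ab by (simp add: r_def field_simps)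
  show "q \<le> lam q"
  proof -
    have "q * a \<le> 4 * q" using a3 q mult_left_mono[of a 3 q] by simp
    then have "q \<le> 1 - r" unfolding r1 using D ab by (simp add: pos_le_divide_eq)
    moreover have "1 - r \<le> lam q" unfolding l f using r mult_left_mono[of 1 "1 + r + r ^ 2 + r ^ 3" "1 - r"] by simp
    ultimately show ?thesis by simp
  qed
  show "lam q \<le> 128 * q"
  proof (cases "q \<le> 1/8")
    case True
    then have "a \<ge> 1/2" using A by (auto simp: abs_le_iff)
    have "1 - r \<le> 16 * q"
    proof -
      have "16 * q * a \<ge> 8 * q" using \<open>a \<ge> 1/2\<close> q mult_left_mono[of "1/2" a "16 * q"] by simp
      moreover have "a - b \<le> 8 * q" using A B by (auto simp: abs_le_iff)
      ultimately have "a - b \<le> 16 * q * a" by linarith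
      then show ?thesis unfolding r1 using ab by (simp only: pos_divide_le_eq)
    qed
    moreover have "lam q \<le> (1 - r) * 4"
      unfolding l f using r p by (intro mult_left_mono) auto
    ultimately show ?thesis using q by simp
  next
    case False
    then show ?thesis using lam_range[of q] q by simp
  qed
qed

lemma iter_tendsto: "0 < q \<Longrightarrow> q < 1 \<Longrightarrow> (\<lambda>n. q ^ (2 ^ n)) \<longlonglongrightarrow> (0::real)"
  by (rule LIMSEQ_subseq_LIMSEQ[OF LIMSEQ_power_zero, unfolded o_def, of q "\<lambda>n. 2 ^ n"]) (auto intro!: strict_monoI)

lemma lam_iter_tendsto: assumes q: "0 < q" "q < 1" shows "(\<lambda>n. lam (q ^ (2 ^ n))) \<longlonglongrightarrow> 0"
proof (rule tendsto_sandwich)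
  have "eventually (\<lambda>n. q ^ (2 ^ n) < 1/2) at_top"
    using iter_tendsto[OF q] by (rule order_tendstoD) auto
  then show "eventually (\<lambda>n. lam (q ^ (2 ^ n)) \<le> 128 * q ^ (2 ^ n)) at_top"
    by eventually_elim (use q in \<open>auto intro!: lam_near_0(1)\<close>)
  show "eventually (\<lambda>n. 0 \<le> lam (q ^ (2 ^ n))) at_top"
    using lam_range[of "q ^ (2 ^ n)" for n] q by (intro always_eventually) (auto simp: power_less_one_iff less_imp_le)
  show "(\<lambda>n. 128 * q ^ (2 ^ n)) \<longlonglongrightarrow> 0"
    using tendsto_mult[OF tendsto_const iter_tendsto[OF q], of 128] by simp
qed auto

lemma iter_range: "0 < q \<Longrightarrow> q < 1 \<Longrightarrow> 0 < q ^ (2 ^ n) \<and> q ^ (2 ^ n) < (1::real)"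
  by (simp add: power_less_one_iff)

lemma iter_Suc: "q ^ (2 ^ Suc n) = (q ^ (2 ^ n))\<^sup>2" for q :: real
  by (simp add: power_mult[symmetric] mult.commute)

text \<open>The Landen factor 1 + m is exactly the ratio of theta(q)^2 to theta(q^2)^2, so the
  quotient of the two sides is invariant under q -> q^2; it tends to 1 at q = 0.\<close>

theorem F_lam: assumes q: "0 < q" "q < 1" shows "F (lam q) = (theta q)\<^sup>2"
proof -
  have step: "F (lam q) / (theta q)\<^sup>2 = F (lam (q\<^sup>2)) / (theta (q\<^sup>2))\<^sup>2" if q: "0 < q" "q < 1" for q
  proof -
    define m where "m = (1 - kap q) / (1 + kap q)"
    note ks = kap_square[OF q, folded m_def]
    have "F (lam q) = (1 + m) * F (lam (q\<^sup>2))"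
      unfolding ks(1,2) using ks(4,5) by (intro F_landen) auto
    moreover have "theta (q\<^sup>2) > 0" using theta_pos[of "q\<^sup>2"] q by (simp add: power_less_one_iff abs_square_less_1)
    ultimately show ?thesis unfolding ks(3)[symmetric] using ks(4) by (simp add: divide_simps)
  qed
  have it: "F (lam (q ^ (2 ^ n))) / (theta (q ^ (2 ^ n)))\<^sup>2 = F (lam q) / (theta q)\<^sup>2" for n
  proof (induction n)
    case (Suc n)
    then show ?case using step[of "q ^ (2 ^ n)"] iter_range[OF q, of n] unfolding iter_Suc by simp
  qed simp
  have "(\<lambda>n. F (lam (q ^ (2 ^ n)))) \<longlonglongrightarrow> F 0"
    by (rule isCont_tendsto_compose[OF F_cont lam_iter_tendsto[OF q]]) simp
  moreover have "(\<lambda>n. theta (q ^ (2 ^ n))) \<longlonglongrightarrow> 1"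
  proof -
    have "(\<lambda>n. theta (q ^ (2 ^ n)) - 1) \<longlonglongrightarrow> 0"
    proof (rule Lim_null_comparison)
      have "eventually (\<lambda>n. q ^ (2 ^ n) < 1/2) at_top"
        using iter_tendsto[OF q] by (rule order_tendstoD) auto
      then show "eventually (\<lambda>n. norm (theta (q ^ (2 ^ n)) - 1) \<le> 4 * q ^ (2 ^ n)) at_top"
        by eventually_elim (use theta_near_0[of "q ^ (2 ^ n)" for n] q in auto)
      show "(\<lambda>n. 4 * q ^ (2 ^ n)) \<longlonglongrightarrow> 0"
        using tendsto_mult[OF tendsto_const iter_tendsto[OF q], of 4] by simp
    qed
    then show ?thesis by (simp add: LIM_zero_iff)
  qed
  ultimately have "(\<lambda>n. F (lam (q ^ (2 ^ n))) / (theta (q ^ (2 ^ n)))\<^sup>2) \<longlonglongrightarrow> F 0 / 1\<^sup>2"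
    by (intro tendsto_divide tendsto_power) auto
  then have "F (lam q) / (theta q)\<^sup>2 = 1" unfolding it by (simp only: LIMSEQ_const_iff F_0 one_power2 div_by_1)
  then show ?thesis by (simp only: divide_eq_1_iff)
qed

text \<open>Squaring the nome doubles both sides, so their ratio is invariant and can be computed at
  the cusp, where \<open>h_ratio_lim\<close> gives it.\<close>

theorem h_lam: assumes q: "0 < q" "q < 1" shows "h (lam q) = - ln q / pi"
proof -
  have step: "h (lam (q\<^sup>2)) = 2 * h (lam q)" if q: "0 < q" "q < 1" for q
  proof -
    define m where "m = (1 - kap q) / (1 + kap q)"
    note ks = kap_square[OF q, folded m_def]
    show ?thesis unfolding ks(1,2) using h_landen[OF ks(4,5)] by simp
  qed
  have it: "h (lam (q ^ (2 ^ n))) = 2 ^ n * h (lam q)" for n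
  proof (induction n)
    case (Suc n)
    then show ?case using step[of "q ^ (2 ^ n)"] iter_range[OF q, of n] unfolding iter_Suc by simp
  qed simp
  define Q where "Q = (\<lambda>n::nat. q ^ (2 ^ n))"
  have Qr: "0 < Q n" "Q n < 1" for n using iter_range[OF q, of n] by (auto simp: Q_def)
  have Q0: "Q \<longlonglongrightarrow> 0" using iter_tendsto[OF q] by (simp add: Q_def)
  have lnQ: "ln (Q n) = 2 ^ n * ln q" for n using q by (simp add: Q_def ln_realpow)
  have ev: "eventually (\<lambda>n. Q n < 1/2) at_top" using Q0 by (rule order_tendstoD) auto
  have "filterlim (\<lambda>n. lam (Q n)) (at_right 0) at_top"
  proof -
    have "(\<lambda>n. lam (Q n)) \<longlonglongrightarrow> 0" unfolding Q_def by (rule lam_iter_tendsto[OF q])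
    then show ?thesis unfolding filterlim_at using lam_range[OF Qr] by (auto simp: less_imp_neq[symmetric])
  qed
  then have 1: "(\<lambda>n. h (lam (Q n)) / - ln (lam (Q n))) \<longlonglongrightarrow> 1 / pi"
    by (rule filterlim_compose[OF h_ratio_lim])
  \<comment> \<open>\<open>lam (Q n)\<close> lies between \<open>Q n\<close> and
    \<open>128 * Q n\<close>: replacing the logarithm of the one by that of the other costs a
    bounded amount, while \<open>ln (Q n)\<close> doubles at each step.\<close>
  have "(\<lambda>n. (ln (lam (Q n)) - ln (Q n)) / ln (Q n)) \<longlonglongrightarrow> 0"
  proof (rule Lim_null_comparison)
    show "eventually (\<lambda>n. norm ((ln (lam (Q n)) - ln (Q n)) / ln (Q n)) \<le> ln 128 / - ln (Q n)) at_top"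
      using ev
    proof eventually_elim
      case (elim n)
      have "Q n \<le> lam (Q n)" "lam (Q n) \<le> 128 * Q n" using lam_near_0[of "Q n"] Qr[of n] elim by auto
      then have "ln (Q n) \<le> ln (lam (Q n))" "ln (lam (Q n)) \<le> ln (128 * Q n)"
        using Qr[of n] lam_range[OF Qr[of n]] by auto
      moreover have "ln (128 * Q n) = ln 128 + ln (Q n)" using Qr[of n] by (subst ln_mult) auto
      ultimately have "norm (ln (lam (Q n)) - ln (Q n)) \<le> ln 128" by simp
      then show ?case using Qr[of n] by (simp add: divide_simps ln_less_zero)
    qed
    have "filterlim (\<lambda>n. - ln (Q n)) at_top at_top"
    proof -
      have "filterlim (\<lambda>n::nat. (2::real) ^ n) at_top at_top" by real_asymp
      then have "filterlim (\<lambda>n::nat. - ln q * 2 ^ n) at_top at_top"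
        using q by (intro filterlim_tendsto_pos_mult_at_top[OF tendsto_const]) auto
      then show ?thesis by (simp add: lnQ mult.commute)
    qed
    then show "(\<lambda>n. ln 128 / - ln (Q n)) \<longlonglongrightarrow> 0" by (intro real_tendsto_divide_at_top[OF tendsto_const])
  qed
  then have "(\<lambda>n. 1 + (ln (lam (Q n)) - ln (Q n)) / ln (Q n)) \<longlonglongrightarrow> 1 + 0" by (intro tendsto_add tendsto_const)
  from tendsto_mult[OF 1 this]
  have "(\<lambda>n. h (lam (Q n)) / - ln (lam (Q n)) * (1 + (ln (lam (Q n)) - ln (Q n)) / ln (Q n))) \<longlonglongrightarrow> 1 / pi" by simp
  moreover have "h (lam (Q n)) / - ln (lam (Q n)) * (1 + (ln (lam (Q n)) - ln (Q n)) / ln (Q n)) = h (lam q) / - ln q" for n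
  proof -
    have nz: "ln (Q n) \<noteq> 0" "ln (lam (Q n)) \<noteq> 0" "ln q \<noteq> 0" using Qr[of n] lam_range[OF Qr[of n]] q by auto
    then have "1 + (ln (lam (Q n)) - ln (Q n)) / ln (Q n) = ln (lam (Q n)) / ln (Q n)" by (simp add: field_simps)
    then have "h (lam (Q n)) / - ln (lam (Q n)) * (1 + (ln (lam (Q n)) - ln (Q n)) / ln (Q n)) = h (lam (Q n)) / - ln (Q n)"
      using nz by simp
    also have "\<dots> = h (lam q) / - ln q" unfolding lnQ using it[of n] by (simp add: Q_def)
    finally show ?thesis .
  qed
  ultimately have "h (lam q) / - ln q = 1 / pi" by (simp only: LIMSEQ_const_iff)
  then show ?thesis using q by (simp add: field_simps)
qed

text \<open>Jacobi's inversion: \<open>h_lam\<close> says that \<open>lam q\<close> and s have the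
  same value under \<open>h\<close>, and injectivity of \<open>h\<close> identifies them.\<close>

theorem modular_param:
  assumes s: "0 < s" "s < 1"
  defines "q \<equiv> exp (- pi * h s)"
  shows "0 < q" "q < 1" "lam q = s" "(theta q)\<^sup>2 = F s" "kap q = sqrt (1 - s)"
proof -
  show q: "0 < q" "q < 1" using h_pos[OF s] by (auto simp: q_def)
  have "h (lam q) = h s" using h_lam[OF q] by (simp add: q_def)
  then show l: "lam q = s" using inj_onD[OF h_inj] lam_range[OF q] s by auto
  show "(theta q)\<^sup>2 = F s" using F_lam[OF q] l by simp
  have "(kap q)\<^sup>2 = 1 - s" using l by (simp add: lam_def)
  then show "kap q = sqrt (1 - s)" using kap_range[OF q] by (metis less_eq_real_def real_sqrt_unique)
qed

lemma h_image: "h ` {0<..<1} = {0<..}"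
proof
  show "h ` {0<..<1} \<subseteq> {0<..}" using h_pos by auto
  show "{0<..} \<subseteq> h ` {0<..<1}"
  proof
    fix x :: real assume "x \<in> {0<..}"
    then have q: "0 < exp (- pi * x)" "exp (- pi * x) < 1" by auto
    have "h (lam (exp (- pi * x))) = x" using h_lam[OF q] by simp
    then show "x \<in> h ` {0<..<1}" using lam_range[OF q] by (intro image_eqI[of _ _ "lam (exp (- pi * x))"]) auto
  qed
qed

section \<open>Lambert series of weight two and four\<close>

text \<open>Half the hyperbolic cosecant, in the form in which geometric series in exp (- 2 y)
  produce it.\<close>

definition cs :: "real \<Rightarrow> real" where "cs y = exp (- y) / (1 - exp (- 2 * y))"

lemma cs_sinh: "y \<noteq> 0 \<Longrightarrow> cs y = 1 / (2 * sinh y)"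
proof -
  assume y: "y \<noteq> 0"
  have "exp (- 2 * y) = exp (- y) * exp (- y)" by (simp add: exp_add[symmetric])
  moreover have "exp (-y) * exp y = 1" by (simp add: exp_add[symmetric])
  moreover have "exp (- 2 * y) \<noteq> 1" using y by simp
  moreover have "exp y - exp (- y) \<noteq> 0" using y by simp
  ultimately show ?thesis by (simp add: cs_def sinh_def field_simps)
qed

lemma cs_pos: "y > 0 \<Longrightarrow> cs y > 0"
  by (simp add: cs_def)

lemma cs_upper: "0 < a \<Longrightarrow> a \<le> y \<Longrightarrow> cs y \<le> exp (- y) / (1 - exp (- 2 * a))"
  unfolding cs_def by (intro divide_left_mono) auto

lemma pow_le_exp: "y \<ge> 0 \<Longrightarrow> y ^ p \<le> fact p * exp y" for y :: real
proof -
  assume y: "y \<ge> 0"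
  have "(\<lambda>n. y ^ n / fact n) sums exp y" using exp_converges[of y] by (simp add: divide_inverse mult.commute)
  then have "sum (\<lambda>n. y ^ n / fact n) {p} \<le> exp y"
    using y sum_le_suminf[of "\<lambda>n. y ^ n / fact n" "{p}"] by (auto simp: sums_iff)
  then show ?thesis by (simp add: field_simps)
qed

lemma pow_cs_bound:
  assumes v: "v > 0"
  shows "\<exists>C r. 0 < r \<and> r < 1 \<and> 0 \<le> C \<and> (\<forall>n\<ge>1. real n ^ p * cs (real n * v) \<le> C * r ^ n)"
proof (intro exI conjI allI impI)
  let ?D = "1 - exp (- 2 * v)"
  have D: "?D > 0" using v by simp
  show "0 < exp (- v / 2)" "exp (- v / 2) < 1" using v by auto
  show "0 \<le> fact p * (2 / v) ^ p / ?D" using v D by simp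
  fix n :: nat assume n: "1 \<le> n"
  have nv: "v \<le> real n * v" using n v by simp
  have "(real n * v / 2) ^ p \<le> fact p * exp (real n * v / 2)" using v by (intro pow_le_exp) auto
  from mult_left_mono[OF this, of "(2 / v) ^ p"]
  have 1: "real n ^ p \<le> fact p * (2 / v) ^ p * exp (real n * v / 2)"
    using v by (simp add: power_mult_distrib[symmetric] mult_ac)
  have "real n ^ p * cs (real n * v) \<le> (fact p * (2 / v) ^ p * exp (real n * v / 2)) * (exp (- (real n * v)) / ?D)"
    using cs_upper[OF v nv] 1 cs_pos[of "real n * v"] v n by (intro mult_mono) auto
  also have "\<dots> = fact p * (2 / v) ^ p / ?D * (exp (real n * v / 2) * exp (- (real n * v)))" by simp
  also have "exp (real n * v / 2) * exp (- (real n * v)) = exp (- v / 2) ^ n"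
    by (simp add: exp_add[symmetric] exp_of_nat_mult[symmetric])
  finally show "real n ^ p * cs (real n * v) \<le> fact p * (2 / v) ^ p / ?D * exp (- v / 2) ^ n" .
qed

lemma pow_cs_summable:
  assumes v: "v > 0"
  shows "summable (\<lambda>n. real (Suc n) ^ p * cs (real (Suc n) * v))" (is ?A)
    and "summable (\<lambda>j. real (2 * j + 1) ^ p * cs (real (2 * j + 1) * v))" (is ?B)
proof -
  obtain C r where C: "0 < r" "r < 1" "0 \<le> C" "\<And>n. n \<ge> 1 \<Longrightarrow> real n ^ p * cs (real n * v) \<le> C * r ^ n"
    using pow_cs_bound[OF v, of p] by auto
  have g: "summable (\<lambda>n. C * r ^ n)" using C by (intro summable_mult summable_geometric) auto
  have nn: "0 \<le> real n ^ p * cs (real n * v)" if "n \<ge> 1" for n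
    using cs_pos[of "real n * v"] v that by simp
  have le: "real n ^ p * cs (real n * v) \<le> C * r ^ k" if "k \<le> n" "n \<ge> 1" for n k
    using C(4)[OF that(2)] mult_left_mono[OF power_decreasing[OF that(1), of r], of C] C by linarith
  show ?A by (rule summable_comparison_test'[OF g, of 0]) (use nn le in \<open>auto simp del: of_nat_Suc\<close>)
  show ?B by (rule summable_comparison_test'[OF g, of 0]) (use nn le in \<open>auto simp del: of_nat_Suc of_nat_add of_nat_mult\<close>)
qed

text \<open>With q = exp (- pi x), the weight two Eisenstein series of n q^n / (1 - q^(2n)) over odd
  n, classically theta_2^4 / 16.\<close>

definition A :: "real \<Rightarrow> real" where
  "A x = (\<Sum>j. real (2 * j + 1) * cs (real (2 * j + 1) * (pi * x)))"

lemma A_sums: "x > 0 \<Longrightarrow> (\<lambda>j. real (2 * j + 1) * cs (real (2 * j + 1) * (pi * x))) sums A x"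
  using pow_cs_summable(2)[of "pi * x" 1] unfolding A_def power_one_right by (intro summable_sums) auto

lemma kap_qo: "norm q < 1 \<Longrightarrow> kap q = (qo q / qo (- q)) ^ 4"
  using theta_product[of q] theta_product[of "- q"] qp_nz[OF norm_sq_less[of q]]
  by (simp add: kap_def power_divide flip: power_mult)

lemma ln_qo_sums:
  fixes q :: real
  assumes q: "norm q < 1" shows "(\<lambda>j. ln (1 - q ^ (2 * j + 1))) sums ln (qo q)"
proof -
  have "(\<lambda>j. 1 - q ^ (2 * j + 1)) has_prod qo q"
    unfolding qo_def by (rule convergent_prod_has_prod[OF qo_conv[OF q]])
  moreover have "1 - q ^ (2 * j + 1) > 0" for j
  proof -
    have "\<bar>q\<bar> ^ (2 * j + 1) < 1" using q power_less_one_iff[of "\<bar>q\<bar>" "2 * j + 1"] by simp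
    then show ?thesis using abs_ge_self[of "q ^ (2 * j + 1)"] unfolding power_abs by linarith
  qed
  ultimately show ?thesis by (rule has_prod_imp_sums_ln_real')
qed

definition lnk :: "nat \<Rightarrow> real \<Rightarrow> real" where
  "lnk j x = 4 * (ln (1 - exp (- (real (2 * j + 1) * (pi * x)))) - ln (1 + exp (- (real (2 * j + 1) * (pi * x)))))"

lemma ln_kap_sums:
  assumes x: "x > 0" shows "(\<lambda>j. lnk j x) sums ln (kap (exp (- pi * x)))"
proof -
  define q where "q = exp (- pi * x)"
  have q: "norm q < 1" using x by (simp add: q_def)
  have e: "q ^ (2 * j + 1) = exp (- (real (2 * j + 1) * (pi * x)))" for j
    unfolding q_def exp_of_nat_mult[symmetric] by (simp add: algebra_simps)
  have "(\<lambda>j. 4 * (ln (1 - q ^ (2 * j + 1)) - ln (1 - (- q) ^ (2 * j + 1)))) sums (4 * (ln (qo q) - ln (qo (- q))))"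
    by (intro sums_mult sums_diff ln_qo_sums) (use q in auto)
  moreover have "4 * (ln (1 - q ^ (2 * j + 1)) - ln (1 - (- q) ^ (2 * j + 1))) = lnk j x" for j
    unfolding lnk_def e[symmetric] by (simp add: power_minus_odd)
  moreover have "4 * (ln (qo q) - ln (qo (- q))) = ln (kap q)"
    unfolding kap_qo[OF q] using qo_pos[of q] qo_pos[of "- q"] q by (simp add: ln_realpow ln_div)
  ultimately show ?thesis by (simp add: q_def)
qed

lemma lnk_deriv:
  assumes x: "x > 0"
  shows "(lnk j has_field_derivative 8 * pi * (real (2 * j + 1) * cs (real (2 * j + 1) * (pi * x)))) (at x)"
proof -
  define m where "m = real (2 * j + 1)"
  have m: "m > 0" by (simp add: m_def)
  define e where "e = exp (- (m * (pi * x)))"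
  have e: "0 < e" "e < 1" using x m by (auto simp: e_def)
  have e2: "exp (- 2 * (m * (pi * x))) = e * e" by (simp add: e_def exp_add[symmetric])
  define E where "E = (\<lambda>x::real. exp (- (m * (pi * x))))"
  have Ex: "E x = e" by (simp add: E_def e_def)
  have d: "(E has_field_derivative - (m * pi) * e) (at x)"
    unfolding E_def e_def by (auto intro!: derivative_eq_intros)
  have "((\<lambda>x. 4 * (ln (1 - E x) - ln (1 + E x))) has_field_derivative
      4 * (- (- (m * pi) * e) / (1 - e) - (- (m * pi) * e) / (1 + e))) (at x)"
    using e by (auto intro!: derivative_eq_intros d simp: Ex mult_ac)
  moreover have "4 * (- (- (m * pi) * e) / (1 - e) - (- (m * pi) * e) / (1 + e)) = 8 * pi * (m * cs (m * (pi * x)))"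
  proof -
    have "e * e < 1" using e by (metis mult_less_cancel_right_disj mult_1 order_less_trans)
    then have ne: "1 - e \<noteq> 0" "1 + e \<noteq> 0" "1 - e * e \<noteq> 0" using e by auto
    show ?thesis unfolding cs_def e2 e_def[symmetric] using ne
      by (simp add: divide_simps) (simp add: algebra_simps)
  qed
  ultimately show ?thesis unfolding lnk_def m_def E_def by simp
qed

text \<open>\<open>kap\<close> is an infinite product over odd powers of q, so its logarithmic
  derivative is a Lambert series. The half-line from x / 2 on keeps away from 0, where uniform
  convergence fails.\<close>

lemma ln_kap_deriv:
  assumes x: "x > 0"
  shows "((\<lambda>x. ln (kap (exp (- pi * x)))) has_field_derivative 8 * pi * A x) (at x)"
proof -
  define a where "a = x / 2"
  have a: "0 < a" "a < x" using x by (auto simp: a_def)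
  define f' where "f' = (\<lambda>j x. 8 * pi * (real (2 * j + 1) * cs (real (2 * j + 1) * (pi * x))))"
  have uc: "uniformly_convergent_on {a<..} (\<lambda>n x. \<Sum>i<n. f' i x)"
  proof (rule Weierstrass_m_test')
    let ?K = "8 * pi / (1 - exp (- 2 * (pi * a)))"
    fix j x assume xx: "x \<in> {a<..}"
    define m where "m = real (2 * j + 1)"
    have m: "m \<ge> 1" by (simp add: m_def)
    have pa: "0 < pi * a" "pi * a \<le> m * (pi * a)" using a m by auto
    have le: "m * (pi * a) \<le> m * (pi * x)" using xx a m by (intro mult_left_mono) auto
    have "cs (m * (pi * x)) \<le> exp (- (m * (pi * x))) / (1 - exp (- 2 * (pi * a)))"
      by (rule cs_upper[OF pa(1) order_trans[OF pa(2) le]])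
    also have "\<dots> \<le> exp (- (m * (pi * a))) / (1 - exp (- 2 * (pi * a)))"
      using pa le by (intro divide_right_mono) auto
    also have "exp (- (m * (pi * a))) \<le> cs (m * (pi * a))"
    proof -
      have "0 < m * (pi * a)" using pa by linarith
      then have "0 < 1 - exp (- 2 * (m * (pi * a)))" "1 - exp (- 2 * (m * (pi * a))) \<le> 1" by auto
      then show ?thesis unfolding cs_def by (simp only: pos_le_divide_eq mult_left_le exp_ge_zero)
    qed
    then have "exp (- (m * (pi * a))) / (1 - exp (- 2 * (pi * a))) \<le> cs (m * (pi * a)) / (1 - exp (- 2 * (pi * a)))"
      using pa by (intro divide_right_mono) auto
    finally have "cs (m * (pi * x)) \<le> cs (m * (pi * a)) / (1 - exp (- 2 * (pi * a)))" .
    from mult_left_mono[OF this, of "8 * pi * m"]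
    have "8 * pi * (m * cs (m * (pi * x))) \<le> ?K * (m * cs (m * (pi * a)))" using m by simp
    moreover have "0 \<le> 8 * pi * (m * cs (m * (pi * x)))" using m cs_pos[of "m * (pi * x)"] pa le by simp
    ultimately show "norm (f' j x) \<le> ?K * (real (2 * j + 1) * cs (real (2 * j + 1) * (pi * a)))"
      unfolding f'_def m_def by simp
  next
    show "summable (\<lambda>j. 8 * pi / (1 - exp (- 2 * (pi * a))) * (real (2 * j + 1) * cs (real (2 * j + 1) * (pi * a))))"
      using A_sums[OF a(1)] by (intro summable_mult) (simp add: sums_iff)
  qed
  have "((\<lambda>x. \<Sum>j. lnk j x) has_field_derivative (\<Sum>j. f' j x)) (at x)"
  proof (rule has_field_derivative_series'(2)[OF _ _ uc])
    show "convex {a<..}" by simp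
    show "(lnk j has_field_derivative f' j x) (at x within {a<..})" if "x \<in> {a<..}" for j x
      unfolding f'_def using that a by (intro DERIV_subset[OF lnk_deriv]) auto
    show "x \<in> {a<..}" "x \<in> interior {a<..}" using a by (auto simp: interior_open)
    show "summable (\<lambda>j. lnk j x)" using ln_kap_sums[OF x] by (simp add: sums_iff)
  qed
  moreover have "(\<Sum>j. f' j x) = 8 * pi * A x"
    unfolding f'_def using sums_mult[OF A_sums[OF x], of "8 * pi"] by (simp add: sums_iff)
  moreover have "eventually (\<lambda>y. (\<Sum>j. lnk j y) = ln (kap (exp (- pi * y)))) (nhds x)"
    using eventually_nhds_in_open[of "{0<..}" x] x
    by (auto elim!: eventually_mono dest: ln_kap_sums simp: sums_iff)
  ultimately show ?thesis using DERIV_cong_ev[OF refl _ refl, of "\<lambda>y. \<Sum>j. lnk j y" "\<lambda>y. ln (kap (exp (- pi * y)))" x] by simp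
qed

text \<open>ln kap at x = h s equals ln (1 - s) / 2. Differentiating it in s directly, and through
  \<open>ln_kap_deriv\<close> and \<open>h_deriv\<close>, gives two expressions that are
  compared.\<close>

theorem A_h: assumes s: "0 < s" "s < 1" shows "A (h s) = s * (F s)\<^sup>2 / 16"
proof -
  have Fp: "F s > 0" using s by (simp add: F_pos)
  have "((\<lambda>s. ln (kap (exp (- pi * h s)))) has_field_derivative
      8 * pi * A (h s) * (- 1 / (pi * s * (1 - s) * (F s)\<^sup>2))) (at s)"
    by (rule DERIV_chain2[OF ln_kap_deriv[OF h_pos[OF s]] h_deriv[OF s]])
  moreover have "((\<lambda>s. ln (kap (exp (- pi * h s)))) has_field_derivative - 1 / (2 * (1 - s))) (at s)"
  proof -
    have "((\<lambda>s. ln (1 - s) / 2) has_field_derivative - 1 / (2 * (1 - s))) (at s)"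
      using s by (auto intro!: derivative_eq_intros simp: field_simps)
    moreover have "eventually (\<lambda>s. ln (1 - s) / 2 = ln (kap (exp (- pi * h s)))) (nhds s)"
    proof -
      have "eventually (\<lambda>s. s \<in> {0<..<1}) (nhds s)" using s by (intro eventually_nhds_in_open) auto
      then show ?thesis
      proof eventually_elim
        case (elim s)
        then have r: "0 < s" "s < 1" "0 < 1 - s" by auto
        show ?case unfolding modular_param(5)[OF r(1,2)] using r(3) by (simp only: ln_sqrt)
      qed
    qed
    ultimately show ?thesis using DERIV_cong_ev[OF refl _ refl, of "\<lambda>s. ln (1 - s) / 2" "\<lambda>s. ln (kap (exp (- pi * h s)))" s] by simp
  qed
  ultimately have "8 * pi * A (h s) * (- 1 / (pi * s * (1 - s) * (F s)\<^sup>2)) = - 1 / (2 * (1 - s))"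
    by (rule DERIV_unique)
  then have "(pi * (1 - s)) * (A (h s) * 16 - s * (F s)\<^sup>2) = 0" using s Fp by (simp add: field_simps)
  then show ?thesis using s by simp
qed

section \<open>The square of the weight two series\<close>

lemma int_has_sum_halves:
  fixes f :: "int \<Rightarrow> real"
  assumes P: "((\<lambda>k::nat. f (int k)) has_sum P) UNIV" and Q: "((\<lambda>k::nat. f (- int k - 1)) has_sum Q) UNIV"
  shows "(f has_sum (P + Q)) UNIV"
proof -
  have "(f has_sum P) {0..}"
    by (rule has_sum_reindex_bij_witness[where i = nat and j = int, THEN iffD1, OF _ _ _ _ _ refl P]) auto
  moreover have "(f has_sum Q) {..<0}"
    by (rule has_sum_reindex_bij_witness[where i = "\<lambda>n. nat (- n - 1)" and j = "\<lambda>k. - int k - 1", THEN iffD1, OF _ _ _ _ _ refl Q]) auto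
  ultimately have "(f has_sum (P + Q)) ({0..} \<union> {..<0})" by (rule has_sum_Un_disjoint) auto
  moreover have "{0..} \<union> {..<0} = (UNIV :: int set)" by auto
  ultimately show ?thesis by simp
qed

text \<open>The square of \<open>\<Sum> i / sinh (i v)\<close> over odd \<open>i\<close>, summed along \<open>i + j = 2 n\<close>: there
  \<open>1 / (sinh (i v) sinh (j v)) = (coth (i v) + coth (j v)) / sinh (2 n v)\<close> telescopes.\<close>

lemma coth_tele:
  assumes v: "v > 0"
  defines "c \<equiv> \<lambda>a::int. cosh (real_of_int (2 * a + 1) * v) / sinh (real_of_int (2 * a + 1) * v)"
  shows "((\<lambda>a. c a - c (a - n)) has_sum (2 * of_int n)) UNIV"
proof -
  have odd: "c (- a - 1) = - c a" for a
  proof -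
    have "real_of_int (2 * (- a - 1) + 1) * v = - (real_of_int (2 * a + 1) * v)" by (simp add: algebra_simps)
    then show ?thesis unfolding c_def by simp
  qed
  have s: "sinh (real_of_int (2 * a + 1) * v) > 0" if "a \<ge> 0" for a using that v by simp
  have dec: "c (int k + 1) \<le> c (int k)" for k
  proof -
    let ?y = "real_of_int (2 * int k + 1) * v" and ?z = "real_of_int (2 * (int k + 1) + 1) * v"
    have "?z = ?y + 2 * v" by (simp add: algebra_simps)
    then have "sinh (?z - ?y) \<ge> 0" using v by simp
    then have "cosh ?z * sinh ?y \<le> cosh ?y * sinh ?z" unfolding sinh_diff by (simp add: mult.commute)
    then show ?thesis unfolding c_def using s[of "int k"] s[of "int k + 1"]
      by (simp add: divide_simps mult.commute)
  qed
  have lim: "(\<lambda>k. c (int k)) \<longlonglongrightarrow> 1"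
  proof -
    have f: "filterlim (\<lambda>k. real_of_int (2 * int k + 1) * v) at_top at_top"
    proof -
      have "filterlim (\<lambda>k::nat. real_of_int (2 * int k + 1)) at_top at_top" by real_asymp
      then show ?thesis using v by (simp only: filterlim_tendsto_pos_mult_at_top[OF tendsto_const] mult.commute[of _ v])
    qed
    have "((\<lambda>y::real. cosh y / sinh y) \<longlongrightarrow> 1) at_top" unfolding cosh_field_def sinh_field_def by real_asymp
    from filterlim_compose[OF this f] show ?thesis by (simp add: c_def)
  qed
  \<comment> \<open>The total increment of coth along the odd multiples of v, from -1 at one end to
    1 at the other; the pole at 0 is skipped.\<close>
  have d: "((\<lambda>a. c a - c (a - 1)) has_sum 2) UNIV"
  proof -
    have "(\<lambda>k. c (int (Suc k)) - c (int k)) sums (1 - c 0)"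
      using telescope_sums[OF lim] by simp
    from sums_minus[OF this] have "(\<lambda>k. c (int k) - c (int (Suc k))) sums (c 0 - 1)" by simp
    then have t0: "((\<lambda>k. c (int k) - c (int (Suc k))) has_sum (c 0 - 1)) UNIV"
      by (rule sums_nonneg_imp_has_sum) (use dec in \<open>auto simp: add.commute\<close>)
    then have t: "((\<lambda>k. c (int k + 1) - c (int k)) has_sum (1 - c 0)) UNIV"
      using has_sum_cmult_right[OF t0, of "-1"] by (simp add: add.commute)
    have o1: "c (- int (Suc k)) = - c (int k)" for k
    proof -
      have "- int (Suc k) = - int k - 1" by simp
      then show ?thesis by (simp only: odd)
    qed
    have o2: "c (- int (Suc k) - 1) = - c (int k + 1)" for k
    proof -
      have "- int (Suc k) - 1 = - (int k + 1) - 1" by simp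
      then show ?thesis by (simp only: odd)
    qed
    have g: "((\<lambda>a. c (a + 1) - c a) has_sum ((1 - c 0) + (2 * c 0 + (1 - c 0)))) UNIV"
    proof (rule int_has_sum_halves)
      show "((\<lambda>k. c (int k + 1) - c (int k)) has_sum 1 - c 0) UNIV" by (rule t)
      have "(\<lambda>k. c (- int k) - c (- int k - 1)) sums (2 * c 0 + (1 - c 0))"
      proof -
        have "(\<lambda>k. c (- int (Suc k)) - c (- int (Suc k) - 1)) sums (1 - c 0)"
        proof -
          have "c (- int (Suc k)) - c (- int (Suc k) - 1) = c (int k + 1) - c (int k)" for k
            unfolding o1 o2 by simp
          then show ?thesis using has_sum_imp_sums[OF t] by simp
        qed
        then show ?thesis
          using sums_Suc_iff[of "\<lambda>k. c (- int k) - c (- int k - 1)" "1 - c 0"] odd[of 0] by (simp add: add.commute)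
      qed
      moreover have "summable (\<lambda>k. norm (c (- int k) - c (- int k - 1)))"
      proof -
        have "norm (c (- int (Suc k)) - c (- int (Suc k) - 1)) = c (int k) - c (int (Suc k))" for k
          unfolding o1 o2 using dec[of k] by (simp add: add.commute)
        then have "summable (\<lambda>k. norm (c (- int (Suc k)) - c (- int (Suc k) - 1)))"
          using \<open>(\<lambda>k. c (int k) - c (int (Suc k))) sums (c 0 - 1)\<close> by (simp add: sums_iff)
        then show ?thesis by (subst (asm) summable_Suc_iff[of "\<lambda>k. norm (c (- int k) - c (- int k - 1))"])
      qed
      ultimately show "((\<lambda>k. c (- int k - 1 + 1) - c (- int k - 1)) has_sum 2 * c 0 + (1 - c 0)) UNIV"
        using norm_summable_imp_has_sum[of "\<lambda>k. c (- int k) - c (- int k - 1)"] by simp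
    qed
    have "((\<lambda>a. c a - c (a - 1)) has_sum ((1 - c 0) + (2 * c 0 + (1 - c 0)))) UNIV"
      by (rule has_sum_reindex_bij_witness[where i = "\<lambda>a. a - 1" and j = "\<lambda>a. a + 1", THEN iffD1, OF _ _ _ _ _ refl g]) auto
    then show ?thesis by simp
  qed
  have shift: "(f has_sum S) UNIV \<Longrightarrow> ((\<lambda>a. f (a - l)) has_sum S) UNIV" for f :: "int \<Rightarrow> real" and S l
    by (rule has_sum_reindex_bij_witness[where i = "\<lambda>a. a - l" and j = "\<lambda>a. a + l", THEN iffD1]) auto
  \<comment> \<open>A difference over k places is a sum of k shifted unit differences, each of total
    2.\<close>
  have pos: "((\<lambda>a. c a - c (a - int k)) has_sum (2 * real k)) UNIV" for k
  proof (induction k)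
    case (Suc k)
    have "((\<lambda>a. (c a - c (a - int k)) + (c (a - int k) - c (a - int k - 1))) has_sum (2 * real k + 2)) UNIV"
      by (intro has_sum_add Suc shift[OF d])
    moreover have "(c a - c (a - int k)) + (c (a - int k) - c (a - int k - 1)) = c a - c (a - int (Suc k))" for a
      by (simp add: algebra_simps)
    ultimately show ?case by (simp add: algebra_simps)
  qed simp
  show ?thesis
  proof (cases "n \<ge> 0")
    case True
    then show ?thesis using pos[of "nat n"] by simp
  next
    case False
    define k where "k = nat (- n)"
    have n: "n = - int k" using False by (simp add: k_def)
    have "((\<lambda>a. - (c (a + int k) - c (a + int k - int k))) has_sum - (2 * real k)) UNIV"
      using shift[OF pos[of k], of "- int k"] by (intro has_sum_uminus[THEN iffD2]) simp
    then show ?thesis by (simp add: n)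
  qed
qed

text \<open>The weight i j is not constant along i + j = 2n, but (i + j)^2 is. Replacing the former
  by half the latter is free: i^2 + j^2 contributes nothing, because 1 / sinh is odd and sums to 0
  over the odd integers. The sum along each line is then \<open>coth_tele\<close>.\<close>

theorem A_sq:
  assumes x: "x > 0"
  shows "(\<lambda>n. real (Suc n) ^ 3 * cs (real (Suc n) * (2 * pi * x))) sums (A x)\<^sup>2"
proof -
  define v where "v = pi * x"
  have v: "v > 0" using x by (simp add: v_def)
  define od where "od = (\<lambda>a::int. real_of_int (2 * a + 1))"
  have od_ne: "od a \<noteq> 0" for a unfolding od_def by presburger
  have od_neg: "od (- a - 1) = - od a" for a by (simp add: od_def)
  have od_nat: "od (int k) = real (2 * k + 1)" for k by (simp add: od_def)
  define u where "u = (\<lambda>p a. od a ^ p / (2 * sinh (od a * v)))"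
  have u_nat: "u p (int k) = real (2 * k + 1) ^ p * cs (real (2 * k + 1) * v)" for p k
    unfolding u_def od_nat using v by (subst cs_sinh) auto
  have u_neg: "u p (- a - 1) = - ((-1) ^ p) * u p a" for p a
    unfolding u_def od_neg by (simp add: power_minus[of "od a" p])
  have nat_hs: "((\<lambda>k. u p (int k)) has_sum (\<Sum>k. real (2 * k + 1) ^ p * cs (real (2 * k + 1) * v))) UNIV" for p
    unfolding u_nat using pow_cs_summable(2)[OF v, of p] cs_pos v
    by (intro sums_nonneg_imp_has_sum summable_sums) (auto simp: less_imp_le)
  have int_hs: "(u p has_sum ((1 - (-1) ^ p) * (\<Sum>k. real (2 * k + 1) ^ p * cs (real (2 * k + 1) * v)))) UNIV" for p
  proof -
    have "((\<lambda>k. u p (- int k - 1)) has_sum (- ((-1) ^ p) * (\<Sum>k. real (2 * k + 1) ^ p * cs (real (2 * k + 1) * v)))) UNIV"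
      unfolding u_neg by (intro has_sum_cmult_right nat_hs)
    from int_has_sum_halves[OF nat_hs this] show ?thesis by (simp add: algebra_simps)
  qed
  have u0: "(u 0 has_sum 0) UNIV" and u2: "\<exists>z. (u 2 has_sum z) UNIV" using int_hs[of 0] int_hs[of 2] by auto
  have u1: "(u 1 has_sum (2 * A x)) UNIV" using int_hs[of 1] by (simp add: A_def v_def)
  obtain z where z: "(u 2 has_sum z) UNIV" using u2 by blast
  have "((\<lambda>(a, b). (od a + od b)\<^sup>2 * (u 0 a * u 0 b)) has_sum (z * 0 + 0 * z + 2 * ((2 * A x) * (2 * A x)))) (UNIV \<times> UNIV)"
  proof -
    have "((\<lambda>y. (case y of (a, b) \<Rightarrow> u 2 a * u 0 b) + (case y of (a, b) \<Rightarrow> u 0 a * u 2 b) + 2 * (case y of (a, b) \<Rightarrow> u 1 a * u 1 b))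
       has_sum (z * 0 + 0 * z + 2 * ((2 * A x) * (2 * A x)))) (UNIV \<times> UNIV)"
      by (intro has_sum_add has_sum_cmult_right has_sum_times_real u0 u1 z)
    moreover have "(case y of (a, b) \<Rightarrow> u 2 a * u 0 b) + (case y of (a, b) \<Rightarrow> u 0 a * u 2 b) + 2 * (case y of (a, b) \<Rightarrow> u 1 a * u 1 b)
       = (case y of (a, b) \<Rightarrow> (od a + od b)\<^sup>2 * (u 0 a * u 0 b))" for y
      by (cases y) (simp add: u_def power2_eq_square ring_distribs add_divide_distrib mult_ac)
    ultimately show ?thesis by simp
  qed
  then have 1: "((\<lambda>(a, b). (od a + od b)\<^sup>2 * (u 0 a * u 0 b)) has_sum (8 * (A x)\<^sup>2)) (UNIV \<times> UNIV)"
    by (simp add: power2_eq_square)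
  \<comment> \<open>The lines are indexed by n = a + b + 1, because od a + od b = 2n.\<close>
  have 2: "((\<lambda>(n, a). (2 * of_int n)\<^sup>2 * (u 0 a * u 0 (n - 1 - a))) has_sum (8 * (A x)\<^sup>2)) (UNIV \<times> UNIV)"
    by (rule has_sum_reindex_bij_witness[where j = "\<lambda>(a, b). (a + b + 1, a)" and i = "\<lambda>(n, a). (a, n - 1 - a)", THEN iffD1, OF _ _ _ _ _ refl 1])
       (auto simp: od_def algebra_simps power2_eq_square)
  define g where "g = (\<lambda>n::int. 2 * of_int n ^ 3 / sinh (of_int n * (2 * v)))"
  have 3: "(g has_sum (8 * (A x)\<^sup>2)) UNIV"
  proof (rule has_sum_SigmaD[OF 2])
    fix n :: int
    let ?c = "\<lambda>a::int. cosh (real_of_int (2 * a + 1) * v) / sinh (real_of_int (2 * a + 1) * v)"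
    have "((\<lambda>a. of_int n ^ 2 / sinh (of_int n * (2 * v)) * (?c a - ?c (a - n))) has_sum (of_int n ^ 2 / sinh (of_int n * (2 * v)) * (2 * of_int n))) UNIV"
      by (intro has_sum_cmult_right coth_tele v)
    moreover have "of_int n ^ 2 / sinh (of_int n * (2 * v)) * (?c a - ?c (a - n)) = (2 * of_int n)\<^sup>2 * (u 0 a * u 0 (n - 1 - a))" for a
    proof (cases "n = 0")
      case False
      define y w where "y = od a * v" and "w = od (a - n) * v"
      have yw: "y - w = of_int n * (2 * v)" by (simp add: y_def w_def od_def algebra_simps)
      have nz: "sinh y \<noteq> 0" "sinh w \<noteq> 0" "sinh (y - w) \<noteq> 0"
        unfolding yw using v od_ne False by (auto simp: y_def w_def)
      have "od (n - 1 - a) * v = - w" by (simp add: w_def od_def algebra_simps)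
      then have r: "u 0 a * u 0 (n - 1 - a) = - 1 / (4 * (sinh y * sinh w))" by (simp add: u_def y_def)
      have "cosh y / sinh y - cosh w / sinh w = - sinh (y - w) / (sinh y * sinh w)"
        unfolding sinh_diff using nz by (simp add: field_simps)
      then have "of_int n ^ 2 / sinh (y - w) * (cosh y / sinh y - cosh w / sinh w) = - (of_int n ^ 2) / (sinh y * sinh w)"
        using nz by simp
      then show ?thesis unfolding r yw[symmetric] by (simp add: y_def w_def od_def power_mult_distrib)
    qed simp
    ultimately show "((\<lambda>a. case (n, a) of (n, a) \<Rightarrow> (2 * of_int n)\<^sup>2 * (u 0 a * u 0 (n - 1 - a))) has_sum g n) UNIV"
      by (simp add: g_def power2_eq_square power3_eq_cube mult_ac)
  qed
  have gn: "g (- n) = g n" for n by (simp add: g_def)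
  have gS: "g (int (Suc k)) = 4 * (real (Suc k) ^ 3 * cs (real (Suc k) * (2 * v)))" for k
    unfolding g_def using v by (subst cs_sinh) (auto simp del: of_nat_Suc)
  define e where "e = (\<Sum>n. real (Suc n) ^ 3 * cs (real (Suc n) * (2 * v)))"
  have es: "(\<lambda>n. real (Suc n) ^ 3 * cs (real (Suc n) * (2 * v))) sums e"
    unfolding e_def using pow_cs_summable(1)[of "2 * v" 3] v by (intro summable_sums) auto
  have nn: "0 \<le> g (int k)" for k using v by (simp add: g_def)
  have s1: "(\<lambda>k. g (int (Suc k))) sums (4 * e)" unfolding gS by (intro sums_mult es)
  then have "(\<lambda>k. g (int k)) sums (4 * e)" using sums_Suc_iff[of "\<lambda>k. g (int k)" "4 * e"] by (simp add: g_def)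
  then have h1: "((\<lambda>k. g (int k)) has_sum (4 * e)) UNIV" using nn by (rule sums_nonneg_imp_has_sum)
  have "((\<lambda>k. g (int (Suc k))) has_sum (4 * e)) UNIV" using s1 nn by (rule sums_nonneg_imp_has_sum)
  moreover have "g (- int k - 1) = g (int (Suc k))" for k
  proof -
    have "- int k - 1 = - int (Suc k)" by simp
    then show ?thesis by (simp only: gn)
  qed
  ultimately have h2: "((\<lambda>k. g (- int k - 1)) has_sum (4 * e)) UNIV" by simp
  from has_sum_unique[OF 3 int_has_sum_halves[OF h1 h2]] have "(A x)\<^sup>2 = e" by simp
  then show ?thesis using es by (simp add: v_def mult_ac)
qed

lemma A_half_h: assumes s: "0 < s" "s < 1" shows "A (h s / 2) = sqrt s * (F s)\<^sup>2 / 4"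
proof -
  define k where "k = sqrt s"
  have k: "0 < k" "k < 1" "k\<^sup>2 = s" using s by (auto simp: k_def)
  define t where "t = 4 * k / (1 + k)\<^sup>2"
  have t: "0 < t" "t < 1" using landen_lt[of k] k by (auto simp: t_def)
  have "h t = h s / 2" using h_landen[OF k(1,2)] by (simp add: t_def k(3))
  moreover have "F t = (1 + k) * F s" using F_landen[of k] k by (simp add: t_def)
  ultimately have "A (h s / 2) = t * ((1 + k) * F s)\<^sup>2 / 16" using A_h[OF t] by (simp only:)
  also have "\<dots> = k * (F s)\<^sup>2 / 4" unfolding t_def using k by (simp add: power_mult_distrib)
  finally show ?thesis by (simp add: k_def)
qed

lemma sums_odd_part:
  fixes f :: "nat \<Rightarrow> real"
  assumes S: "(\<lambda>n. f (Suc n)) sums S" and T: "(\<lambda>n. f (2 * Suc n)) sums T"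
  shows "(\<lambda>j. f (2 * j + 1)) sums (S - T)"
proof -
  have "(\<lambda>N. \<Sum>n<2 * N. f (Suc n)) \<longlonglongrightarrow> S"
    using LIMSEQ_subseq_LIMSEQ[OF S[unfolded sums_def], of "\<lambda>n. 2 * n"] by (simp add: o_def strict_mono_def)
  then have "(\<lambda>N. (\<Sum>n<2 * N. f (Suc n)) - (\<Sum>n<N. f (2 * Suc n))) \<longlonglongrightarrow> S - T"
    using T unfolding sums_def by (intro tendsto_diff)
  moreover have "(\<Sum>n<2 * N. f (Suc n)) - (\<Sum>n<N. f (2 * Suc n)) = (\<Sum>j<N. f (2 * j + 1))" for N
    by (induction N) auto
  ultimately show ?thesis by (simp add: sums_def)
qed

text \<open>The odd terms are all terms minus the even ones, and both are given by squares of
  \<open>A\<close> through \<open>A_sq\<close>. As h s / 2 = h t for the Landen image t of k, they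
  are evaluated at h t / 2 and h t; the factor 1 + s arises as (1 + k)^2 - 2k.\<close>

theorem weight4_odd_sums:
  assumes s: "0 < s" "s < 1"
  shows "(\<lambda>j. real (2 * j + 1) ^ 3 * cs (real (2 * j + 1) * (pi * h s / 2))) sums (sqrt s * (1 + s) * (F s) ^ 4 / 4)"
proof -
  define k where "k = sqrt s"
  have k: "0 < k" "k < 1" "k\<^sup>2 = s" using s by (auto simp: k_def)
  define t where "t = 4 * k / (1 + k)\<^sup>2"
  have t: "0 < t" "t < 1" using landen_lt[of k] k by (auto simp: t_def)
  have ht: "h t = h s / 2" using h_landen[OF k(1,2)] by (simp add: t_def k(3))
  have Ft: "F t = (1 + k) * F s" using F_landen[of k] k by (simp add: t_def)
  have hs: "h s > 0" by (rule h_pos[OF s])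
  have a: "(A (h s / 4))\<^sup>2 = t * (F t) ^ 4 / 16"
  proof -
    have "A (h s / 4) = sqrt t * (F t)\<^sup>2 / 4" using A_half_h[OF t] by (simp add: ht)
    then show ?thesis using t by (simp only:) (simp add: power_mult_distrib power_divide flip: power_mult)
  qed
  have b: "(A (h s / 2))\<^sup>2 = t\<^sup>2 * (F t) ^ 4 / 256"
  proof -
    have "A (h s / 2) = t * (F t)\<^sup>2 / 16" using A_h[OF t] by (simp only: ht)
    then show ?thesis by (simp only:) (simp add: power_mult_distrib power_divide flip: power_mult)
  qed
  define f where "f = (\<lambda>n::nat. real n ^ 3 * cs (real n * (pi * h s / 2)))"
  have "(\<lambda>n. f (Suc n)) sums (A (h s / 4))\<^sup>2"
    using A_sq[of "h s / 4"] hs unfolding f_def by simp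
  moreover have "(\<lambda>n. f (2 * Suc n)) sums (8 * (A (h s / 2))\<^sup>2)"
  proof -
    have "f (2 * Suc n) = 8 * (real (Suc n) ^ 3 * cs (real (Suc n) * (2 * pi * (h s / 2))))" for n
      unfolding f_def of_nat_mult power_mult_distrib by (simp del: of_nat_Suc add: mult_ac)
    then show ?thesis using sums_mult[OF A_sq[of "h s / 2"], of 8] hs by simp
  qed
  ultimately have "(\<lambda>j. f (2 * j + 1)) sums ((A (h s / 4))\<^sup>2 - 8 * (A (h s / 2))\<^sup>2)"
    by (rule sums_odd_part)
  moreover have "(A (h s / 4))\<^sup>2 - 8 * (A (h s / 2))\<^sup>2 = k * (1 + s) * (F s) ^ 4 / 4"
  proof -
    have e: "(1 + k) ^ 4 = (1 + k)\<^sup>2 * (1 + k)\<^sup>2" by (simp add: eval_nat_numeral)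
    have F4: "(F t) ^ 4 = (1 + k)\<^sup>2 * (1 + k)\<^sup>2 * (F s) ^ 4" by (simp only: Ft power_mult_distrib e)
    define K where "K = (1 + k)\<^sup>2"
    have K: "K > 0" using k by (simp add: K_def)
    have tK: "t = 4 * k / K" by (simp add: t_def K_def)
    have "t * (F t) ^ 4 = 4 * k * (1 + k)\<^sup>2 * (F s) ^ 4"
      unfolding F4 K_def[symmetric] unfolding tK using K by simp
    moreover have "t\<^sup>2 * (F t) ^ 4 = 16 * k\<^sup>2 * (F s) ^ 4"
      unfolding F4 K_def[symmetric] unfolding tK using K by (simp add: power_divide power_mult_distrib power2_eq_square[of K])
    ultimately have "(A (h s / 4))\<^sup>2 - 8 * (A (h s / 2))\<^sup>2 = (8 * k * (1 + k)\<^sup>2 - 16 * k\<^sup>2) * (F s) ^ 4 / 32"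
      unfolding a b by (simp add: algebra_simps)
    also have "8 * k * (1 + k)\<^sup>2 - 16 * k\<^sup>2 = 8 * k * (1 + k\<^sup>2)" by (simp add: power2_eq_square algebra_simps)
    finally show ?thesis using k by simp
  qed
  ultimately show ?thesis by (simp add: f_def k_def)
qed

text \<open>The factor s (1 - s) is the one in the denominator of \<open>h_deriv\<close>.
  Integrating x^p times this form over x therefore gives, up to 1 / pi, the integral of F(s)^(2-p)
  F(1-s)^p over s.\<close>

lemma weight4_cusp:
  assumes s: "0 < s" "s < 1"
  shows "s * (1 - s) * (F s) ^ 4 = 16 * (A (h s / 2))\<^sup>2 - 256 * (A (h s))\<^sup>2"
proof -
  have "16 * (sqrt s * (F s)\<^sup>2 / 4)\<^sup>2 = s * (F s) ^ 4" "256 * (s * (F s)\<^sup>2 / 16)\<^sup>2 = s\<^sup>2 * (F s) ^ 4"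
    using s by (simp_all add: power_mult_distrib power_divide flip: power_mult)
  then show ?thesis unfolding A_half_h[OF s] A_h[OF s] by (simp add: algebra_simps power2_eq_square[of s])
qed

section \<open>The infinite product of the modular lambda function\<close>

lemma qp_range:
  fixes q :: real assumes q: "0 \<le> q" "q \<le> 1/4" shows "1/2 \<le> qp q" "qp q \<le> 1"
proof -
  have n: "norm q < 1" using q by simp
  have l: "1/2 \<le> qpf q m \<and> qpf q m \<le> 1" for m
  proof -
    have "1 - (\<Sum>k<m. q ^ Suc k) \<le> qpf q m \<and> qpf q m \<le> 1 \<and> 0 \<le> qpf q m"
    proof (induction m)
      case (Suc m)
      have "q \<le> 1" using q by linarith
      then have a: "0 \<le> q ^ Suc m" "q ^ Suc m \<le> 1" using zero_le_power[OF q(1)] power_le_one[OF q(1)] by blast+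
      have "qpf q m * q ^ Suc m \<le> q ^ Suc m" using Suc a by (intro mult_left_le_one_le) auto
      moreover have "qpf q m * q ^ Suc m \<ge> 0" using Suc a by (intro mult_nonneg_nonneg) auto
      moreover have "qpf q m * (1 - q ^ Suc m) \<ge> 0" using Suc a by (intro mult_nonneg_nonneg) auto
      ultimately show ?case using Suc unfolding qpf_Suc by (simp add: right_diff_distrib del: power_Suc)
    qed simp
    moreover have "(\<Sum>k<m. q ^ Suc k) \<le> 1/2"
    proof -
      have "(\<Sum>k<m. q ^ Suc k) = q * (\<Sum>k<m. q ^ k)" by (simp add: sum_distrib_left)
      also have "(\<Sum>k<m. q ^ k) \<le> 1 / (1 - q)"
      proof -
        have "(\<Sum>k<m. q ^ k) = (1 - q ^ m) / (1 - q)" using q by (simp add: sum_gp_strict)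
        also have "\<dots> \<le> 1 / (1 - q)" using q by (intro divide_right_mono) auto
        finally show ?thesis .
      qed
      then have "q * (\<Sum>k<m. q ^ k) \<le> q * (1 / (1 - q))" using q by (intro mult_left_mono) auto
      also have "\<dots> \<le> 1/2" using q by (simp add: field_simps)
      finally show ?thesis .
    qed
    ultimately show ?thesis by linarith
  qed
  show "1/2 \<le> qp q" by (rule LIMSEQ_le_const[OF qpf_lim[OF n]]) (use l in auto)
  show "qp q \<le> 1" by (rule LIMSEQ_le_const2[OF qpf_lim[OF n]]) (use l in auto)
qed

lemma theta_qp:
  fixes q :: real assumes q: "norm q < 1"
  shows "theta q = qp (q\<^sup>2) ^ 5 / ((qp q)\<^sup>2 * (qp (q ^ 4))\<^sup>2)" "theta (- q) = (qp q)\<^sup>2 / qp (q\<^sup>2)"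
proof -
  have q2: "norm (q\<^sup>2) < 1" by (rule norm_sq_less[OF q])
  have e4: "(q\<^sup>2)\<^sup>2 = q ^ 4" by simp
  have q4: "norm (q ^ 4) < 1" using norm_sq_less[OF q2] unfolding e4 .
  have nz: "qp q \<noteq> 0" "qp (q\<^sup>2) \<noteq> 0" "qp (q ^ 4) \<noteq> 0" using qp_nz[OF q] qp_nz[OF q2] qp_nz[OF q4] by auto
  have o1: "qo q = qp q / qp (q\<^sup>2)" using qp_split[OF q] nz by simp
  have o2: "qo (q\<^sup>2) = qp (q\<^sup>2) / qp (q ^ 4)" using qp_split[OF q2] nz unfolding e4 by simp
  have o3: "qo (- q) = qo (q\<^sup>2) / qo q" using qo_mult_minus[OF q] qo_nz[OF q] by (simp add: field_simps)
  show "theta q = qp (q\<^sup>2) ^ 5 / ((qp q)\<^sup>2 * (qp (q ^ 4))\<^sup>2)"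
    unfolding theta_product[OF q] o3 o1 o2 using nz by (simp add: field_simps eval_nat_numeral)
  have "theta (- q) = qp (q\<^sup>2) * (qo q)\<^sup>2" using theta_product[of "- q"] q by simp
  then show "theta (- q) = (qp q)\<^sup>2 / qp (q\<^sup>2)" unfolding o1 using nz by (simp add: field_simps eval_nat_numeral)
qed

text \<open>With q = exp (pi i \<tau>) this is the classical quotient 16 eta(\<tau>/2)^8 eta(2
  \<tau>)^16 / eta(\<tau>)^24.\<close>

definition lamP :: "real \<Rightarrow> real" where
  "lamP q = 16 * q * (qp q) ^ 8 * (qp (q ^ 4)) ^ 16 / (qp (q\<^sup>2)) ^ 24"

lemma lamP_pos: "0 < q \<Longrightarrow> q < 1 \<Longrightarrow> lamP q > 0"
  unfolding lamP_def using qp_pos[of q] qp_pos[of "q\<^sup>2"] qp_pos[of "q ^ 4"] by (simp add: power_less_one_iff)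

text \<open>In classical terms the fourth power of theta_2(q)^2 = 2 theta_2(q^2) theta_3(q^2). The
  product \<open>lamP\<close> obeys the same rule by \<open>lamP_sq\<close>, so the theta factors
  drop out of the quotient of the two.\<close>

lemma lam_sq:
  assumes q: "0 < q" "q < 1" shows "(lam q)\<^sup>2 * (theta q) ^ 8 = 16 * lam (q\<^sup>2) * (theta (q\<^sup>2)) ^ 8"
proof -
  define m where "m = (1 - kap q) / (1 + kap q)"
  note ks = kap_square[OF q, folded m_def]
  have "(theta q) ^ 8 = ((theta (q\<^sup>2))\<^sup>2 * (1 + m)) ^ 4" unfolding ks(3) by (simp flip: power_mult)
  also have "\<dots> = (theta (q\<^sup>2)) ^ 8 * ((1 + m)\<^sup>2)\<^sup>2" by (simp add: power_mult_distrib flip: power_mult)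
  finally have e: "(theta q) ^ 8 = (theta (q\<^sup>2)) ^ 8 * ((1 + m)\<^sup>2)\<^sup>2" .
  show ?thesis unfolding e ks(1,2) using ks(4) by (simp add: power_divide power_mult_distrib)
qed

lemma lamP_sq:
  assumes q: "0 < q" "q < 1" shows "(lamP q)\<^sup>2 * (theta q) ^ 8 = 16 * lamP (q\<^sup>2) * (theta (q\<^sup>2)) ^ 8"
proof -
  have n: "norm q < 1" "norm (q\<^sup>2) < 1" using q norm_sq_less[of q] by auto
  define a b c d where "a = qp q" and "b = qp (q\<^sup>2)" and "c = qp (q ^ 4)" and "d = qp (q ^ 8)"
  have pos: "a > 0" "b > 0" "c > 0" "d > 0"
    unfolding a_def b_def c_def d_def using q by (auto intro!: qp_pos simp: power_less_one_iff abs_square_less_1)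
  have t1: "theta q = b ^ 5 / (a\<^sup>2 * c\<^sup>2)" using theta_qp(1)[OF n(1)] by (simp add: a_def b_def c_def)
  have t2: "theta (q\<^sup>2) = c ^ 5 / (b\<^sup>2 * d\<^sup>2)" using theta_qp(1)[OF n(2)] by (simp add: b_def c_def d_def flip: power_mult)
  have l1: "lamP q = 16 * q * a ^ 8 * c ^ 16 / b ^ 24" by (simp add: lamP_def a_def b_def c_def)
  have l2: "lamP (q\<^sup>2) = 16 * q\<^sup>2 * b ^ 8 * d ^ 16 / c ^ 24" by (simp add: lamP_def d_def b_def c_def flip: power_mult)
  have "(lamP q)\<^sup>2 * (theta q) ^ 8 = 256 * q\<^sup>2 * (a ^ 16 * c ^ 32 / b ^ 48 * (b ^ 40 / (a ^ 16 * c ^ 16)))"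
    unfolding l1 t1 by (simp add: power_divide power_mult_distrib flip: power_mult)
  also have "a ^ 16 * c ^ 32 / b ^ 48 * (b ^ 40 / (a ^ 16 * c ^ 16)) = c ^ 16 / b ^ 8"
  proof -
    have "P * (C * C) / (B ^ 6) * (B ^ 5 / (P * C)) = C / B" if "P \<noteq> 0" "B \<noteq> 0" "C \<noteq> 0" for P B C :: real
      using that by (simp add: field_simps eval_nat_numeral)
    from this[of "a ^ 16" "b ^ 8" "c ^ 16"] show ?thesis using pos by (simp flip: power_mult power_add)
  qed
  also have "256 * q\<^sup>2 * (c ^ 16 / b ^ 8) = 256 * q\<^sup>2 * (b ^ 8 * d ^ 16 / c ^ 24 * (c ^ 40 / (b ^ 16 * d ^ 16)))"
  proof -
    have "C\<^sup>2 / B = B * D / C ^ 3 * (C ^ 5 / (B\<^sup>2 * D))" if "D \<noteq> 0" "B \<noteq> 0" "C \<noteq> 0" for B C D :: real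
      using that by (simp add: field_simps eval_nat_numeral)
    from this[of "d ^ 16" "b ^ 8" "c ^ 8"] show ?thesis using pos by (simp flip: power_mult)
  qed
  also have "\<dots> = 16 * lamP (q\<^sup>2) * (theta (q\<^sup>2)) ^ 8"
    unfolding l2 t2 by (simp add: power_divide power_mult_distrib flip: power_mult)
  finally show ?thesis .
qed

text \<open>The quotient of the two sides satisfies \<open>R (q\<^sup>2) = R (q)\<^sup>2\<close> and is bounded near 0.\<close>

theorem lam_product:
  assumes q: "0 < q" "q < 1" shows "lam q = lamP q"
proof -
  define R where "R = (\<lambda>q. lam q / lamP q)"
  have R_pos: "R q > 0" if "0 < q" "q < 1" for q
    using lam_range[OF that] lamP_pos[OF that] by (simp add: R_def)
  have step: "R (q\<^sup>2) = (R q)\<^sup>2" if q: "0 < q" "q < 1" for q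
  proof -
    have t: "(theta q) ^ 8 > 0" "(theta (q\<^sup>2)) ^ 8 > 0"
      using theta_pos[of q] theta_pos[of "q\<^sup>2"] q by (auto simp: abs_square_less_1)
    have p: "lamP q > 0" "lamP (q\<^sup>2) > 0" using lamP_pos[OF q] lamP_pos[of "q\<^sup>2"] q by (auto simp: power_less_one_iff)
    have "(R q)\<^sup>2 = ((lam q)\<^sup>2 * (theta q) ^ 8) / ((lamP q)\<^sup>2 * (theta q) ^ 8)"
      unfolding R_def power_divide using t by (simp only: nonzero_mult_divide_mult_cancel_right less_imp_neq[symmetric] not_False_eq_True)
    also have "\<dots> = R (q\<^sup>2)" unfolding lam_sq[OF q] lamP_sq[OF q] R_def using t p by simp
    finally show ?thesis ..
  qed
  have it: "ln (R (q ^ (2 ^ n))) = 2 ^ n * ln (R q)" for n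
  proof (induction n)
    case (Suc n)
    then show ?case using step[of "q ^ (2 ^ n)"] iter_range[OF q, of n] R_pos[of "q ^ (2 ^ n)"]
      unfolding iter_Suc by (simp add: ln_realpow)
  qed simp
  \<comment> \<open>The estimates place R between 2^(-28) and 2^27, and 2^30 covers both ends. Any
    fixed bound forces ln R to vanish, since it doubles with each squaring of the nome.\<close>
  have bnd: "\<bar>ln (R Q)\<bar> \<le> ln (2 ^ 30)" if Q: "0 < Q" "Q \<le> 1/4" for Q
  proof -
    have Q1: "0 < Q" "Q < 1" "Q\<^sup>2 \<le> 1/4" "Q ^ 4 \<le> 1/4"
    proof -
      show "0 < Q" "Q < 1" using Q by auto
      have "Q\<^sup>2 \<le> Q ^ 1" "Q ^ 4 \<le> Q ^ 1" using Q by (intro power_decreasing; simp)+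
      then show "Q\<^sup>2 \<le> 1/4" "Q ^ 4 \<le> 1/4" using Q by auto
    qed
    define a b c where "a = qp Q" and "b = qp (Q\<^sup>2)" and "c = qp (Q ^ 4)"
    have abc: "1/2 \<le> a" "a \<le> 1" "1/2 \<le> b" "b \<le> 1" "1/2 \<le> c" "c \<le> 1"
      using qp_range[of Q] qp_range[of "Q\<^sup>2"] qp_range[of "Q ^ 4"] Q Q1 by (auto simp: a_def b_def c_def)
    have pa: "(1/2) ^ 8 \<le> a ^ 8" "a ^ 8 \<le> 1" "(1/2) ^ 24 \<le> b ^ 24" "b ^ 24 \<le> 1" "(1/2) ^ 16 \<le> c ^ 16" "c ^ 16 \<le> 1"
      using abc by (auto intro!: power_mono power_le_one simp del: power_divide)
    have lq: "Q \<le> lam Q" "lam Q \<le> 128 * Q" using lam_near_0[of Q] Q by auto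
    have Req: "R Q = (lam Q / Q) * b ^ 24 / (16 * (a ^ 8 * c ^ 16))"
      unfolding R_def lamP_def using abc Q by (simp add: a_def b_def c_def divide_simps)
    have l: "1 \<le> lam Q / Q" "lam Q / Q \<le> 128" using lq Q by (auto simp: field_simps)
    have ac: "(1/2) ^ 24 \<le> a ^ 8 * c ^ 16" "a ^ 8 * c ^ 16 \<le> 1"
    proof -
      have "(1/2) ^ 8 * (1/2) ^ 16 \<le> a ^ 8 * c ^ 16" using pa by (intro mult_mono) auto
      then show "(1/2) ^ 24 \<le> a ^ 8 * c ^ 16" by simp
      show "a ^ 8 * c ^ 16 \<le> 1" using pa abc by (intro mult_le_one) auto
    qed
    have u: "1 * (1/2) ^ 24 \<le> (lam Q / Q) * b ^ 24" "(lam Q / Q) * b ^ 24 \<le> 128 * 1"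
      using l pa by (intro mult_mono; simp)+
    have p0: "0 < a ^ 8 * c ^ 16" using ac(1) by (rule less_le_trans[rotated]) simp
    have u0: "0 \<le> (lam Q / Q) * b ^ 24" using u(1) by (rule order_trans[rotated]) simp
    have "R Q \<le> 128 / (16 * (1/2) ^ 24)" unfolding Req using u ac u0 by (intro frac_le) auto
    moreover have "(1/2) ^ 24 / 16 \<le> R Q" unfolding Req using u ac u0 p0 by (intro frac_le) auto
    ultimately have "R Q \<le> 2 ^ 30" "1 / 2 ^ 30 \<le> R Q" by (simp_all add: power_divide)
    moreover have "R Q > 0" using R_pos Q1 by blast
    ultimately have "ln (R Q) \<le> ln (2 ^ 30)" "ln (1 / 2 ^ 30) \<le> ln (R Q)" by (simp_all only: ln_le_cancel_iff zero_less_power zero_less_numeral divide_pos_pos zero_less_one)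
    moreover have "ln (1 / 2 ^ 30 :: real) = - ln (2 ^ 30)" by (simp add: ln_div)
    ultimately show ?thesis by linarith
  qed
  have "(\<lambda>n. ln (R q)) \<longlonglongrightarrow> 0"
  proof (rule Lim_null_comparison)
    have "eventually (\<lambda>n. q ^ (2 ^ n) < 1/4) at_top" using iter_tendsto[OF q] by (rule order_tendstoD) auto
    then show "eventually (\<lambda>n. norm (ln (R q)) \<le> ln (2 ^ 30) * (1/2) ^ n) at_top"
    proof eventually_elim
      case (elim n)
      have "\<bar>ln (R (q ^ (2 ^ n)))\<bar> \<le> ln (2 ^ 30)" using elim q by (intro bnd) auto
      then have "2 ^ n * \<bar>ln (R q)\<bar> \<le> ln (2 ^ 30)" unfolding it abs_mult by simp
      then show ?case by (simp add: field_simps power_divide)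
    qed
    show "(\<lambda>n. ln (2 ^ 30) * (1/2) ^ n) \<longlonglongrightarrow> (0::real)"
      by (intro tendsto_mult_right_zero LIMSEQ_power_zero) simp
  qed
  then have "ln (R q) = 0" by (simp only: LIMSEQ_const_iff)
  then have "R q = 1" using R_pos[OF q] by simp
  then show ?thesis by (simp add: R_def)
qed

text \<open>The eta quotient as a function of z = exp (2 pi i \<tau>); the single factor z collects
  the exponents (4 * 2 + 4 * 4) / 24 = 1.\<close>

definition etaq :: "'a::{real_normed_field,banach} \<Rightarrow> 'a" where
  "etaq z = z * (qp (z\<^sup>2)) ^ 4 * (qp (z ^ 4)) ^ 4"

text \<open>The right side is the eta quotient at \<tau> = i x / 4. The value at 1 / x is reached by
  the reflection s -> 1 - s and contributes x^2. By \<open>theta_qp\<close> and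
  \<open>lam_product\<close> the rest is a monomial in \<open>a\<close>, \<open>b\<close>,
  \<open>c\<close>, in which \<open>c\<close> cancels and a^4 b^4 remains.\<close>

theorem A_product:
  assumes x: "x > 0"
  shows "x * A (x / 2) * A (1 / x) = x ^ 3 / 16 * etaq (exp (- (pi * x / 2)))"
proof -
  obtain s where s: "0 < s" "s < 1" "h s = x" using h_image x by (metis greaterThanLessThan_iff greaterThan_iff imageE)
  define q where "q = exp (- pi * x)"
  note mp = modular_param[OF s(1,2), unfolded s(3), folded q_def]
  define z where "z = exp (- (pi * x / 2))"
  have z: "z > 0" "z\<^sup>2 = q" "z ^ 4 = q\<^sup>2" by (auto simp: z_def q_def exp_of_nat_mult[symmetric])
  have n: "norm q < 1" using mp by simp
  define a b c where "a = qp q" and "b = qp (q\<^sup>2)" and "c = qp (q ^ 4)"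
  have pos: "a > 0" "b > 0" "c > 0"
    unfolding a_def b_def c_def using mp(1,2) by (auto intro!: qp_pos simp: power_less_one_iff abs_square_less_1)
  have F1: "F (1 - s) = x * F s" using s F_pos[of s] by (simp add: h_def field_simps)
  have "A (1 / x) = A (h (1 - s))" using h_reflect[OF s(1,2)] s(3) by simp
  also have "\<dots> = (1 - s) * (F (1 - s))\<^sup>2 / 16" using s by (intro A_h) auto
  finally have A2: "A (1 / x) = x\<^sup>2 * ((1 - s) * (F s)\<^sup>2) / 16" unfolding F1 by (simp add: power_mult_distrib)
  have A1: "A (x / 2) = sqrt s * (F s)\<^sup>2 / 4" using A_half_h[OF s(1,2)] s(3) by simp
  have t3: "(F s)\<^sup>2 = b ^ 20 / (a ^ 8 * c ^ 8)"
    unfolding mp(4)[symmetric] theta_qp(1)[OF n] by (simp add: a_def b_def c_def power_divide power_mult_distrib flip: power_mult)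
  have t4: "(1 - s) * (F s)\<^sup>2 = a ^ 8 / b ^ 4"
  proof -
    have "kap q ^ 2 = 1 - s" using mp(3) by (simp add: lam_def)
    then have "(1 - s) * (F s)\<^sup>2 = (theta (- q) / theta q) ^ 4 * theta q ^ 4"
      unfolding mp(4)[symmetric] kap_def by (simp flip: power_mult)
    also have "\<dots> = theta (- q) ^ 4" using theta_pos[OF n] by (simp add: power_divide)
    finally show ?thesis unfolding theta_qp(2)[OF n] by (simp add: a_def b_def power_divide flip: power_mult)
  qed
  have "s = (4 * z * a ^ 4 * c ^ 8 / b ^ 12)\<^sup>2"
  proof -
    have "s = 16 * q * a ^ 8 * c ^ 16 / b ^ 24"
      using lam_product[OF mp(1,2)] unfolding mp(3) lamP_def a_def b_def c_def .
    then show ?thesis unfolding z(2)[symmetric] by (simp add: power_divide power_mult_distrib flip: power_mult)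
  qed
  then have k: "sqrt s = 4 * z * a ^ 4 * c ^ 8 / b ^ 12"
    using pos z by (simp add: real_sqrt_unique)
  have "sqrt s * (F s)\<^sup>2 * ((1 - s) * (F s)\<^sup>2) = 4 * z * (a ^ 4 * c ^ 8 / b ^ 12 * (b ^ 20 / (a ^ 8 * c ^ 8)) * (a ^ 8 / b ^ 4))"
    by (subst t4, subst t3, subst k) simp
  also have "a ^ 4 * c ^ 8 / b ^ 12 * (b ^ 20 / (a ^ 8 * c ^ 8)) * (a ^ 8 / b ^ 4) = a ^ 4 * b ^ 4"
  proof -
    have "b ^ 20 = b ^ 12 * b ^ 4 * b ^ 4" by (simp flip: power_add)
    then show ?thesis using pos by (simp add: divide_simps)
  qed
  finally have "sqrt s * (F s)\<^sup>2 * ((1 - s) * (F s)\<^sup>2) = 4 * etaq z"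
    unfolding etaq_def z(2,3) a_def b_def by simp
  then have "x * (sqrt s * (F s)\<^sup>2 / 4) * (x\<^sup>2 * ((1 - s) * (F s)\<^sup>2) / 16) = x ^ 3 * (4 * etaq z) / 64"
    by (simp add: power2_eq_square power3_eq_cube mult_ac)
  then show ?thesis unfolding A1 A2 z_def by simp
qed

lemma ln_ratio_sums:
  assumes e: "0 < e" "e < 1"
  shows "(\<lambda>i. 2 * (e ^ (2 * i + 1) / real (2 * i + 1))) sums (ln (1 + e) - ln (1 - e))"
proof -
  have "(\<lambda>n. - ((- e) ^ n) / real n - - ((- (- e)) ^ n) / real n) sums (ln (1 + e) - ln (1 + - e))"
    using e by (intro sums_diff ln_series') auto
  then have s: "(\<lambda>n. (e ^ n - (- e) ^ n) / real n) sums (ln (1 + e) - ln (1 - e))"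
    by (simp add: diff_divide_distrib)
  have "strict_mono (\<lambda>i::nat. 2 * i + 1)" by (auto simp: strict_mono_def)
  moreover have "(e ^ n - (- e) ^ n) / real n = 0" if "n \<notin> range (\<lambda>i. 2 * i + 1)" for n
  proof -
    have "even n" using that by (metis oddE rangeI)
    then show ?thesis by simp
  qed
  ultimately have "(\<lambda>i. (e ^ (2 * i + 1) - (- e) ^ (2 * i + 1)) / real (2 * i + 1)) sums (ln (1 + e) - ln (1 - e))"
    using s by (rule sums_mono_reindex[THEN iffD2])
  moreover have "(e ^ (2 * i + 1) - (- e) ^ (2 * i + 1)) / real (2 * i + 1) = 2 * (e ^ (2 * i + 1) / real (2 * i + 1))" for i
    by (simp add: power_minus_odd)
  ultimately show ?thesis by simp
qed

lemma cs_sums: "y > 0 \<Longrightarrow> (\<lambda>a. exp (- (real (2 * a + 1) * y))) sums cs y"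
proof -
  assume y: "y > 0"
  have "(\<lambda>a. exp (- y) * exp (- 2 * y) ^ a) sums (exp (- y) * (1 / (1 - exp (- 2 * y))))"
    using y by (intro sums_mult geometric_sums) auto
  moreover have "exp (- y) * exp (- 2 * y) ^ a = exp (- (real (2 * a + 1) * y))" for a
    by (simp add: exp_of_nat_mult[symmetric] exp_add[symmetric] algebra_simps)
  ultimately show ?thesis by (simp add: cs_def)
qed

section \<open>The Rogers--Zudilin method\<close>

lemma ennreal_suminf_swap: "(\<Sum>i. \<Sum>j. f i j) = (\<Sum>j. \<Sum>i. f i j)" for f :: "nat \<Rightarrow> nat \<Rightarrow> ennreal"
  using nn_integral_suminf[of "\<lambda>j i. f i j" "count_space UNIV"] by (simp add: nn_integral_count_space_nat)

text \<open>Both four-fold sums keep the order b, a, i, j. They factor differently: into (b, a) and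
  (i, j) before the substitution, into (i, a) and (b, j) after it, as in
  \<open>suminf4_cross\<close>.\<close>

lemma suminf4_left:
  fixes P Q :: "nat \<Rightarrow> nat \<Rightarrow> ennreal"
  shows "(\<Sum>b. \<Sum>a. \<Sum>i. \<Sum>j. X * (P b a * Q i j)) = X * ((\<Sum>b. \<Sum>a. P b a) * (\<Sum>i. \<Sum>j. Q i j))"
  by (simp only: ennreal_suminf_cmult ennreal_suminf_multc)

lemma suminf4_cross:
  fixes P Q :: "nat \<Rightarrow> nat \<Rightarrow> ennreal"
  shows "(\<Sum>b. \<Sum>a. \<Sum>i. \<Sum>j. X * (P i a * Q b j)) = X * ((\<Sum>i. \<Sum>a. P i a) * (\<Sum>b. \<Sum>j. Q b j))"
  unfolding ennreal_suminf_swap[of P] by (simp only: ennreal_suminf_cmult ennreal_suminf_multc)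

definition od :: "nat \<Rightarrow> real" where "od j = real (2 * j + 1)"

lemma od_pos [simp]: "od j > 0" "od j \<noteq> 0" "od j \<ge> 0"
  by (simp_all add: od_def)

lemma ennreal_sums: "f sums s \<Longrightarrow> (\<And>n. 0 \<le> f n) \<Longrightarrow> (\<Sum>n. ennreal (f n)) = ennreal s"
  by (subst suminf_ennreal2) (auto simp: sums_iff)

lemma cs_ennreal: "y > 0 \<Longrightarrow> c \<ge> 0 \<Longrightarrow> (\<Sum>a. ennreal (c * exp (- (od a * y)))) = ennreal (c * cs y)"
  unfolding od_def by (intro ennreal_sums sums_mult cs_sums) auto

lemma pow_cs_ennreal:
  assumes v: "v > 0"
  shows "(\<Sum>b. \<Sum>j. ennreal (od b ^ p * exp (- (od j * (od b * v))))) = ennreal (\<Sum>b. od b ^ p * cs (od b * v))"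
proof -
  have "(\<Sum>j. ennreal (od b ^ p * exp (- (od j * (od b * v))))) = ennreal (od b ^ p * cs (od b * v))" for b
    using v by (intro cs_ennreal mult_pos_pos zero_le_power od_pos)
  moreover have "(\<Sum>b. ennreal (od b ^ p * cs (od b * v))) = ennreal (\<Sum>b. od b ^ p * cs (od b * v))"
  proof (rule ennreal_sums)
    show "(\<lambda>b. od b ^ p * cs (od b * v)) sums (\<Sum>b. od b ^ p * cs (od b * v))"
      unfolding od_def by (intro summable_sums pow_cs_summable v)
    show "0 \<le> od b ^ p * cs (od b * v)" for b
      using v by (intro mult_nonneg_nonneg zero_le_power od_pos less_imp_le[OF cs_pos] mult_pos_pos)
  qed
  ultimately show ?thesis by (simp only:)
qed

lemma A_ennreal: "x > 0 \<Longrightarrow> (\<Sum>b. \<Sum>j. ennreal (od b * exp (- (od j * (od b * (pi * x)))))) = ennreal (A x)"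
proof -
  assume "x > 0"
  then have v: "pi * x > 0" by simp
  from pow_cs_ennreal[OF v, of 1] show ?thesis by (simp only: power_one_right A_def od_def)
qed

definition C4 :: "real \<Rightarrow> real" where "C4 x = (\<Sum>b. od b ^ 3 * cs (od b * (pi * x / 2)))"

lemma C4_ennreal: "x > 0 \<Longrightarrow> (\<Sum>b. \<Sum>a. ennreal (od b ^ 3 * exp (- (od a * (od b * (pi * x / 2)))))) = ennreal (C4 x)"
proof -
  assume "x > 0"
  then have v: "pi * x / 2 > 0" by simp
  from pow_cs_ennreal[OF v, of 3] show ?thesis by (simp only: C4_def)
qed

text \<open>At x = h s the nome exp (- pi / x) belongs to 1 - s, so \<open>kap\<close> there is the
  modulus k = sqrt s. Division by -8 leaves the double series of exp (- pi i j / x) / i over odd i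
  and j.\<close>

definition Gk :: "real \<Rightarrow> real" where "Gk x = - ln (kap (exp (- pi / x))) / 8"

lemma Gk_ennreal:
  assumes x: "x > 0"
  shows "(\<Sum>i. \<Sum>j. ennreal (1 / od i * exp (- (od j * (od i * (pi / x)))))) = ennreal (Gk x)"
proof -
  define y where "y = pi * (1 / x)"
  have y: "y > 0" "pi / x = y" using x by (auto simp: y_def)
  have inner: "(\<Sum>i. ennreal (1 / od i * exp (- (od j * (od i * y))))) = ennreal (- lnk j (1 / x) / 8)" for j
  proof -
    define e where "e = exp (- (od j * y))"
    have "0 < od j * y" using y(1) by (intro mult_pos_pos od_pos)
    then have e: "0 < e" "e < 1" unfolding e_def by simp_all
    have "(\<lambda>i. (2 * (e ^ (2 * i + 1) / real (2 * i + 1))) / 2) sums ((ln (1 + e) - ln (1 - e)) / 2)"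
      by (intro sums_divide ln_ratio_sums e)
    moreover have "(2 * (e ^ (2 * i + 1) / real (2 * i + 1))) / 2 = 1 / od i * exp (- (od j * (od i * y)))" for i
    proof -
      have "e ^ (2 * i + 1) = exp (- (od j * (od i * y)))"
        unfolding e_def exp_of_nat_mult[symmetric] by (simp add: od_def algebra_simps)
      then show ?thesis unfolding od_def[of i, symmetric] by (simp only:) simp
    qed
    moreover have "(ln (1 + e) - ln (1 - e)) / 2 = - lnk j (1 / x) / 8"
    proof -
      have "lnk j (1 / x) = 4 * (ln (1 - e) - ln (1 + e))" unfolding lnk_def e_def od_def y_def by simp
      then show ?thesis by simp
    qed
    ultimately have "(\<lambda>i. 1 / od i * exp (- (od j * (od i * y)))) sums (- lnk j (1 / x) / 8)" by simp
    moreover have "0 \<le> 1 / od i * exp (- (od j * (od i * y)))" for i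
      by (intro mult_nonneg_nonneg divide_nonneg_nonneg zero_le_one od_pos exp_ge_zero)
    ultimately show ?thesis by (rule ennreal_sums)
  qed
  have nn: "0 \<le> - lnk j (1 / x) / 8" for j
  proof -
    define e where "e = exp (- (real (2 * j + 1) * (pi * (1 / x))))"
    have "0 < e" "e < 1" using x by (auto simp: e_def)
    then have "ln (1 - e) \<le> ln (1 + e)" by simp
    then show ?thesis unfolding lnk_def e_def[symmetric] by simp
  qed
  have "(\<lambda>j. - lnk j (1 / x) / 8) sums Gk x"
    using sums_divide[OF sums_minus[OF ln_kap_sums[of "1 / x"]], of 8] x by (simp add: Gk_def)
  then have "(\<Sum>j. ennreal (- lnk j (1 / x) / 8)) = ennreal (Gk x)" using nn by (rule ennreal_sums)
  then show ?thesis unfolding inner[symmetric] y(2) by (subst ennreal_suminf_swap)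
qed

lemma ennreal_mult3: "x > 0 \<Longrightarrow> ennreal (x * ((P * exp p) * (Q * exp q))) = ennreal x * (ennreal (P * exp p) * ennreal (Q * exp q))"
  if "P \<ge> 0" "Q \<ge> 0"
  using that by (simp add: ennreal_mult)

text \<open>\<open>RZT\<close> is the general term of x C4(x) Gk(x), \<open>RZU\<close> that of x
  A(x/2) A(1/x), with indices labelled so that the substitution matches term with term.\<close>

definition RZT :: "nat \<Rightarrow> nat \<Rightarrow> nat \<Rightarrow> nat \<Rightarrow> real \<Rightarrow> ennreal" where
  "RZT b a i j x = ennreal (od b ^ 3 / od i * x * exp (- (pi * (od a * od b * x / 2 + od i * od j / x)))) * indicator {0<..} x"

definition RZU :: "nat \<Rightarrow> nat \<Rightarrow> nat \<Rightarrow> nat \<Rightarrow> real \<Rightarrow> ennreal" where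
  "RZU b a i j x = ennreal (od b * od i * x * exp (- (pi * (od a * od i * x / 2 + od b * od j / x)))) * indicator {0<..} x"

lemma RZ_meas [measurable]: "RZT b a i j \<in> borel_measurable borel" "RZU b a i j \<in> borel_measurable borel"
  unfolding RZT_def[abs_def] RZU_def[abs_def] by measurable

lemma RZ_meas_lborel: "RZT b a i j \<in> borel_measurable lborel" "RZU b a i j \<in> borel_measurable lborel"
  by measurable

text \<open>The Rogers--Zudilin substitution \<open>x = (r / n) y\<close>, which exchanges the roles of \<open>n\<close> and \<open>r\<close>.\<close>

lemma RZ_substitution: "(\<integral>\<^sup>+x. RZT b a i j x \<partial>lborel) = (\<integral>\<^sup>+x. RZU b a i j x \<partial>lborel)"
proof -
  define c where "c = od i / od b"
  have c: "c > 0" by (simp add: c_def)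
  have "(\<integral>\<^sup>+x. RZT b a i j x \<partial>lborel) = ennreal \<bar>c\<bar> * (\<integral>\<^sup>+x. RZT b a i j (0 + c * x) \<partial>lborel)"
    using c by (intro nn_integral_real_affine) auto
  also have "\<dots> = (\<integral>\<^sup>+x. ennreal c * RZT b a i j (0 + c * x) \<partial>lborel)"
    using c by (subst nn_integral_cmult) auto
  also have "\<dots> = (\<integral>\<^sup>+x. RZU b a i j x \<partial>lborel)"
  proof (intro nn_integral_cong)
    fix x :: real
    show "ennreal c * RZT b a i j (0 + c * x) = RZU b a i j x"
    proof (cases "x > 0")
      case True
      \<comment> \<open>The measure and the factor x each contribute c = i / b, so the weight b^3 /
        i turns into b i: a form of weight four and a logarithm are traded for two forms of weight
        two.\<close>
      have e1: "c * (od b ^ 3 / od i * (c * x)) = od b * od i * x"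
        unfolding c_def by (simp add: field_simps power3_eq_cube)
      have "od a * od b * (c * x) / 2 = od a * od i * x / 2" "od i * od j / (c * x) = od b * od j / x"
        unfolding c_def using True by (simp_all add: field_simps)
      then have e2: "od a * od b * (c * x) / 2 + od i * od j / (c * x) = od a * od i * x / 2 + od b * od j / x" by simp
      have "ennreal c * ennreal (od b ^ 3 / od i * (c * x) * E) = ennreal (od b * od i * x * E)" if "E \<ge> 0" for E
        unfolding e1[symmetric] using c True that by (subst ennreal_mult[symmetric]) (auto simp: mult_ac)
      then show ?thesis unfolding RZT_def RZU_def using True c by (simp add: e2)
    next
      case False
      then have "\<not> c * x > 0" using c by (simp add: zero_less_mult_iff)
      then show ?thesis using False by (simp add: RZT_def RZU_def)
    qed
  qed
  finally show ?thesis .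
qed

lemma RZT_sum:
  assumes x: "x > 0"
  shows "(\<Sum>b. \<Sum>a. \<Sum>i. \<Sum>j. RZT b a i j x) = ennreal (x * C4 x * Gk x)"
proof -
  have "RZT b a i j x = ennreal x * (ennreal (od b ^ 3 * exp (- (od a * (od b * (pi * x / 2))))) *
      ennreal (1 / od i * exp (- (od j * (od i * (pi / x))))))" for b a i j
  proof -
    have "exp (- (pi * (od a * od b * x / 2 + od i * od j / x))) = exp (- (od a * (od b * (pi * x / 2)))) * exp (- (od j * (od i * (pi / x))))"
      by (simp add: exp_add[symmetric] algebra_simps)
    then have "od b ^ 3 / od i * x * exp (- (pi * (od a * od b * x / 2 + od i * od j / x))) =
       x * ((od b ^ 3 * exp (- (od a * (od b * (pi * x / 2))))) * (1 / od i * exp (- (od j * (od i * (pi / x))))))"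
      by simp
    then show ?thesis unfolding RZT_def using x by (simp only:) (subst ennreal_mult3, simp_all)
  qed
  then have "(\<Sum>b. \<Sum>a. \<Sum>i. \<Sum>j. RZT b a i j x) = ennreal x * (ennreal (C4 x) * ennreal (Gk x))"
    by (simp only: suminf4_left C4_ennreal[OF x] Gk_ennreal[OF x])
  also have "\<dots> = ennreal (x * C4 x * Gk x)"
  proof -
    have "0 \<le> C4 x" unfolding C4_def using x cs_pos pow_cs_summable(2)[of "pi * x / 2" 3]
      by (intro suminf_nonneg) (auto simp: od_def less_imp_le simp del: of_nat_add of_nat_mult)
    moreover have "0 \<le> Gk x" using kap_range[of "exp (- pi / x)"] x by (simp add: Gk_def)
    ultimately show ?thesis using x by (simp add: ennreal_mult mult.assoc)
  qed
  finally show ?thesis .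
qed

lemma A_nonneg: "x > 0 \<Longrightarrow> 0 \<le> A x"
  using sums_le[OF _ sums_zero A_sums[of x]] cs_pos by (simp add: less_imp_le)

lemma RZU_sum:
  assumes x: "x > 0"
  shows "(\<Sum>b. \<Sum>a. \<Sum>i. \<Sum>j. RZU b a i j x) = ennreal (x * A (x / 2) * A (1 / x))"
proof -
  have "RZU b a i j x = ennreal x * (ennreal (od i * exp (- (od a * (od i * (pi * (x / 2)))))) *
      ennreal (od b * exp (- (od j * (od b * (pi * (1 / x)))))))" for b a i j
  proof -
    have "exp (- (pi * (od a * od i * x / 2 + od b * od j / x))) = exp (- (od a * (od i * (pi * (x / 2))))) * exp (- (od j * (od b * (pi * (1 / x)))))"
      by (simp add: exp_add[symmetric] algebra_simps)
    then have "od b * od i * x * exp (- (pi * (od a * od i * x / 2 + od b * od j / x))) =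
       x * ((od i * exp (- (od a * (od i * (pi * (x / 2)))))) * (od b * exp (- (od j * (od b * (pi * (1 / x)))))))"
      by simp
    then show ?thesis unfolding RZU_def using x by (simp only:) (subst ennreal_mult3, simp_all)
  qed
  then have "(\<Sum>b. \<Sum>a. \<Sum>i. \<Sum>j. RZU b a i j x) = ennreal x * (ennreal (A (x / 2)) * ennreal (A (1 / x)))"
    using x by (simp only: suminf4_cross[of _ "\<lambda>i a. ennreal (od i * exp (- (od a * (od i * (pi * (x / 2))))))"] A_ennreal half_gt_zero zero_less_divide_1_iff)
  also have "\<dots> = ennreal (x * A (x / 2) * A (1 / x))"
    using x A_nonneg[of "x / 2"] A_nonneg[of "1 / x"] by (simp add: ennreal_mult mult.assoc)
  finally show ?thesis .
qed

lemma nn_integral_suminf4: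
  fixes T :: "nat \<Rightarrow> nat \<Rightarrow> nat \<Rightarrow> nat \<Rightarrow> 'a \<Rightarrow> ennreal"
  assumes [measurable]: "\<And>b a i j. T b a i j \<in> borel_measurable M"
  shows "(\<integral>\<^sup>+x. (\<Sum>b. \<Sum>a. \<Sum>i. \<Sum>j. T b a i j x) \<partial>M) = (\<Sum>b. \<Sum>a. \<Sum>i. \<Sum>j. (\<integral>\<^sup>+x. T b a i j x \<partial>M))"
proof -
  have "(\<integral>\<^sup>+x. (\<Sum>b. \<Sum>a. \<Sum>i. \<Sum>j. T b a i j x) \<partial>M) = (\<Sum>b. (\<integral>\<^sup>+x. (\<Sum>a. \<Sum>i. \<Sum>j. T b a i j x) \<partial>M))"
    by (rule nn_integral_suminf) measurable
  also have "\<dots> = (\<Sum>b. \<Sum>a. (\<integral>\<^sup>+x. (\<Sum>i. \<Sum>j. T b a i j x) \<partial>M))"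
    by (intro suminf_cong nn_integral_suminf) measurable
  also have "\<dots> = (\<Sum>b. \<Sum>a. \<Sum>i. (\<integral>\<^sup>+x. (\<Sum>j. T b a i j x) \<partial>M))"
    by (intro suminf_cong nn_integral_suminf) measurable
  also have "\<dots> = (\<Sum>b. \<Sum>a. \<Sum>i. \<Sum>j. (\<integral>\<^sup>+x. T b a i j x \<partial>M))"
    by (intro suminf_cong nn_integral_suminf) measurable
  finally show ?thesis .
qed

text \<open>Since every term is nonnegative, Tonelli's theorem moves the integral inside and out
  again without any integrability; that both sides are finite emerges only from
  \<open>eta_mellin\<close>.\<close>

theorem rogers_zudilin:
  "(\<integral>\<^sup>+x. ennreal (x * C4 x * Gk x) * indicator {0<..} x \<partial>lborel) =
   (\<integral>\<^sup>+x. ennreal (x ^ 3 / 16 * etaq (exp (- (pi * x / 2)))) * indicator {0<..} x \<partial>lborel)"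
proof -
  have "(\<integral>\<^sup>+x. ennreal (x * C4 x * Gk x) * indicator {0<..} x \<partial>lborel) = (\<integral>\<^sup>+x. (\<Sum>b. \<Sum>a. \<Sum>i. \<Sum>j. RZT b a i j x) \<partial>lborel)"
  proof (intro nn_integral_cong)
    fix x :: real
    show "ennreal (x * C4 x * Gk x) * indicator {0<..} x = (\<Sum>b. \<Sum>a. \<Sum>i. \<Sum>j. RZT b a i j x)"
    proof (cases "x > 0")
      case True
      then show ?thesis unfolding RZT_sum[OF True] by simp
    next
      case False
      then have "RZT b a i j x = 0" for b a i j by (simp add: RZT_def)
      then show ?thesis using False by simp
    qed
  qed
  also have "\<dots> = (\<Sum>b. \<Sum>a. \<Sum>i. \<Sum>j. (\<integral>\<^sup>+x. RZT b a i j x \<partial>lborel))"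
    by (rule nn_integral_suminf4) (rule RZ_meas_lborel)
  also have "\<dots> = (\<Sum>b. \<Sum>a. \<Sum>i. \<Sum>j. (\<integral>\<^sup>+x. RZU b a i j x \<partial>lborel))"
    by (simp only: RZ_substitution)
  also have "\<dots> = (\<integral>\<^sup>+x. (\<Sum>b. \<Sum>a. \<Sum>i. \<Sum>j. RZU b a i j x) \<partial>lborel)"
    by (rule nn_integral_suminf4[symmetric]) (rule RZ_meas_lborel)
  also have "\<dots> = (\<integral>\<^sup>+x. ennreal (x ^ 3 / 16 * etaq (exp (- (pi * x / 2)))) * indicator {0<..} x \<partial>lborel)"
  proof (intro nn_integral_cong)
    fix x :: real
    show "(\<Sum>b. \<Sum>a. \<Sum>i. \<Sum>j. RZU b a i j x) = ennreal (x ^ 3 / 16 * etaq (exp (- (pi * x / 2)))) * indicator {0<..} x"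
    proof (cases "x > 0")
      case True
      then show ?thesis unfolding RZU_sum[OF True] A_product[OF True] by simp
    next
      case False
      then have "RZU b a i j x = 0" for b a i j by (simp add: RZU_def)
      then show ?thesis using False by simp
    qed
  qed
  finally show ?thesis .
qed

section \<open>The eta quotient and its Mellin transform\<close>

lemma qp_holomorphic: "(qp :: complex \<Rightarrow> complex) holomorphic_on ball 0 1"
proof (rule holomorphic_uniform_sequence[of _ "\<lambda>n q. qpf q n"])
  show "open (ball 0 1 :: complex set)" by simp
  show "(\<lambda>q. qpf q n) holomorphic_on ball 0 1" for n
    unfolding qpf_def by (intro holomorphic_intros)
  fix x :: complex assume x: "x \<in> ball 0 1"
  define d where "d = (1 - norm x) / 2"
  have d: "d > 0" "norm x + d < 1" using x by (simp_all add: d_def field_simps)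
  have sub: "norm y \<le> norm x + d" if "y \<in> cball x d" for y
    using that norm_triangle_ineq2[of y x] by (simp add: dist_norm norm_minus_commute)
  have "uniformly_convergent_on (cball x d) (\<lambda>N y. \<Prod>n<N. 1 - y ^ Suc n)"
  proof (rule uniformly_convergent_on_prod')
    show "continuous_on (cball x d) (\<lambda>y. 1 - y ^ Suc n)" for n by (intro continuous_intros)
    show "compact (cball x d)" by simp
    show "uniformly_convergent_on (cball x d) (\<lambda>N y. \<Sum>n<N. norm (1 - y ^ Suc n - 1))"
    proof (rule Weierstrass_m_test')
      fix n y assume y: "y \<in> cball x d"
      show "norm (norm (1 - y ^ Suc n - 1)) \<le> (norm x + d) ^ Suc n"
      proof -
        have "1 - y ^ Suc n - 1 = - (y ^ Suc n)" by simp
        then have "norm (norm (1 - y ^ Suc n - 1)) = norm y ^ Suc n"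
          by (simp only: norm_minus_cancel norm_power real_norm_def abs_norm_cancel abs_power2 power_abs)
        then show ?thesis using power_mono[OF sub[OF y] norm_ge_zero, of "Suc n"] by (simp only:)
      qed
    next
      show "summable (\<lambda>n. (norm x + d) ^ Suc n)"
        by (subst summable_Suc_iff) (use d in \<open>auto intro!: summable_geometric\<close>)
    qed
  qed
  then have ul: "uniform_limit (cball x d) (\<lambda>N y. qpf y N) (\<lambda>y. lim (\<lambda>N. qpf y N)) sequentially"
    unfolding qpf_def[symmetric] uniformly_convergent_uniform_limit_iff .
  have "lim (\<lambda>N. qpf y N) = qp y" if "y \<in> cball x d" for y
    using sub[OF that] d by (intro limI qpf_lim) auto
  then have "uniform_limit (cball x d) (\<lambda>N y. qpf y N) qp sequentially"
    by (intro uniform_limit_cong'[THEN iffD1, OF _ _ ul] refl)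
  moreover have "cball x d \<subseteq> ball 0 1" using sub d by force
  ultimately show "\<exists>d. 0 < d \<and> cball x d \<subseteq> ball 0 1 \<and> uniform_limit (cball x d) (\<lambda>n q. qpf q n) qp sequentially"
    using d by blast
qed

lemma etaq_holomorphic: "(etaq :: complex \<Rightarrow> complex) holomorphic_on ball 0 1"
proof -
  have "(\<lambda>z::complex. qp (z ^ n)) holomorphic_on ball 0 1" if "n > 0" for n
  proof -
    have "(qp \<circ> (\<lambda>z::complex. z ^ n)) holomorphic_on ball 0 1"
      by (rule holomorphic_on_compose_gen[OF _ qp_holomorphic])
         (use that in \<open>auto simp: norm_power power_less_one_iff intro!: holomorphic_intros\<close>)
    then show ?thesis by (simp add: o_def)
  qed
  from this[of 2] this[of 4] show ?thesis unfolding etaq_def[abs_def] by (intro holomorphic_intros) auto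
qed

definition etac :: "nat \<Rightarrow> complex" where "etac n = (deriv ^^ n) etaq 0 / fact n"

lemma etac_sums: "norm z < 1 \<Longrightarrow> (\<lambda>n. etac n * z ^ n) sums etaq z"
  unfolding etac_def using holomorphic_power_series[OF etaq_holomorphic, of z] by simp

lemma etac_0: "etac 0 = 0"
  by (simp add: etac_def etaq_def)

text \<open>The point z = 0 is not a value of the exponential, so the coefficients are peeled off
  one by one: each is a limit at 0, after which the series is divided by z.\<close>

lemma powser_coeffs_zero:
  fixes d :: "nat \<Rightarrow> complex"
  assumes "\<And>z. z \<noteq> 0 \<Longrightarrow> norm z < 1 \<Longrightarrow> (\<lambda>n. d n * z ^ n) sums 0"
  shows "d k = 0"
proof -
  have "(\<forall>z. z \<noteq> 0 \<longrightarrow> norm z < 1 \<longrightarrow> (\<lambda>n. d (n + k) * z ^ n) sums 0) \<and> d k = 0" for k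
  proof (induction k)
    have lim: "d k = 0" if "\<forall>z. z \<noteq> 0 \<longrightarrow> norm z < 1 \<longrightarrow> (\<lambda>n. d (n + k) * z ^ n) sums 0" for k
    proof -
      have "((\<lambda>_. 0) \<longlongrightarrow> d k) (at (0::complex))"
        using powser_limit_0_strong[of 1 "\<lambda>n. d (n + k)" "\<lambda>_. 0"] that by simp
      from tendsto_unique[OF at_neq_bot this tendsto_const] show ?thesis by simp
    qed
    {
      case 0
      show ?case using lim[of 0] assms by simp
    next
      case (Suc k)
      have "(\<lambda>n. d (n + Suc k) * z ^ n) sums 0" if z: "z \<noteq> 0" "norm z < 1" for z
      proof -
        have "(\<lambda>n. d (n + k) * z ^ n) sums 0" using Suc z by blast
        then have "(\<lambda>n. d (Suc n + k) * z ^ Suc n) sums 0" using Suc by (subst sums_Suc_iff) simp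
        from sums_divide[OF this, of z] show ?thesis using z by simp
      qed
      then show ?case using lim[of "Suc k"] by blast
    }
  qed
  then show ?thesis by blast
qed

lemma eta_form_etaq:
  assumes "Im \<tau> > 0"
  defines "z \<equiv> exp (2 * of_real pi * \<i> * \<tau>)"
  shows "norm z < 1" "z \<noteq> 0" "eta_form \<tau> = etaq z"
proof -
  show "norm z < 1" "z \<noteq> 0" using assms(1) by (simp_all add: z_def norm_exp_eq_Re)
  have z2: "exp (2 * of_real pi * \<i> * (2 * \<tau>)) = z\<^sup>2" "exp (2 * of_real pi * \<i> * (4 * \<tau>)) = z ^ 4"
    unfolding z_def exp_of_nat_mult[symmetric] by (simp_all add: algebra_simps)
  have d: "dedekind_eta (2 * \<tau>) = exp (2 * of_real pi * \<i> * (2 * \<tau>) / 24) * qp (z\<^sup>2)"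
    "dedekind_eta (4 * \<tau>) = exp (2 * of_real pi * \<i> * (4 * \<tau>) / 24) * qp (z ^ 4)"
    unfolding dedekind_eta_def qp_def z2 by simp_all
  have "exp (2 * of_real pi * \<i> * (2 * \<tau>) / 24) ^ 4 * exp (2 * of_real pi * \<i> * (4 * \<tau>) / 24) ^ 4 = z"
    unfolding z_def exp_of_nat_mult[symmetric] exp_add[symmetric] by (simp add: algebra_simps)
  then show "eta_form \<tau> = etaq z"
    unfolding eta_form_def d etaq_def power_mult_distrib by (simp add: mult_ac)
qed

lemma exp_2pii_surj:
  assumes "z \<noteq> 0" "norm z < 1" obtains \<tau> where "Im \<tau> > 0" "z = exp (2 * of_real pi * \<i> * \<tau>)"
proof
  define \<tau> where "\<tau> = Ln z / (2 * of_real pi * \<i>)"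
  have e: "2 * of_real pi * \<i> * \<tau> = Ln z" by (simp add: \<tau>_def)
  then show "z = exp (2 * of_real pi * \<i> * \<tau>)" using assms(1) by simp
  have "Re (2 * of_real pi * \<i> * \<tau>) < 0" unfolding e using assms by (simp add: ln_less_zero)
  then show "Im \<tau> > 0" by (simp add: zero_less_mult_iff)
qed

text \<open>Holomorphy on the disc gives existence for the definite description. Uniqueness holds
  because the exponential maps the upper half-plane onto the punctured disc.\<close>

theorem q_coeff_eta_form: "q_coeff eta_form = etac"
  unfolding q_coeff_def
proof (rule the_equality)
  show "\<forall>\<tau>. 0 < Im \<tau> \<longrightarrow> (\<lambda>n. etac n * exp (2 * of_real pi * \<i> * \<tau>) ^ n) sums eta_form \<tau>"
    using etac_sums eta_form_etaq by simp
  fix a assume a: "\<forall>\<tau>. 0 < Im \<tau> \<longrightarrow> (\<lambda>n. a n * exp (2 * of_real pi * \<i> * \<tau>) ^ n) sums eta_form \<tau>"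
  have "(\<lambda>n. (a n - etac n) * z ^ n) sums 0" if "z \<noteq> 0" "norm z < 1" for z
  proof -
    from exp_2pii_surj[OF that] obtain \<tau> where t: "Im \<tau> > 0" "z = exp (2 * of_real pi * \<i> * \<tau>)" .
    have "(\<lambda>n. a n * z ^ n - etac n * z ^ n) sums (eta_form \<tau> - etaq z)"
      using a t etac_sums[OF that(2)] by (intro sums_diff) auto
    then show ?thesis using eta_form_etaq(3)[OF t(1)] t(2) by (simp add: left_diff_distrib)
  qed
  then show "a = etac" using powser_coeffs_zero[of "\<lambda>n. a n - etac n"] by (intro ext) simp
qed

section \<open>Growth of the coefficients of the eta quotient\<close>

lemma etaq_bound:
  fixes z :: complex assumes z: "norm z = r" "r < 1"
  shows "norm (etaq z) \<le> (16 / (1 - r)\<^sup>2) powr (4/3)"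
proof -
  have r: "0 \<le> r" using z by auto
  have q: "norm (qp (z ^ n)) ^ 3 \<le> 4 / (1 - r)" if "n > 0" for n
  proof -
    have le: "norm (z ^ n) \<le> r" using z r that power_decreasing[of 1 n r] by (simp add: norm_power)
    then have "norm (z ^ n) < 1" using z by linarith
    then have "norm (qp (z ^ n)) ^ 3 \<le> 4 / (1 - norm (z ^ n))" by (rule qp_cube_bound)
    also have "\<dots> \<le> 4 / (1 - r)" using le z by (intro divide_left_mono) auto
    finally show ?thesis .
  qed
  define X where "X = norm (qp (z\<^sup>2)) * norm (qp (z ^ 4))"
  have X: "X > 0"
  proof -
    have "norm (z\<^sup>2) < 1" "norm (z ^ 4) < 1" using z r by (auto simp: norm_power power_less_one_iff)
    then show ?thesis using qp_nz[of "z\<^sup>2"] qp_nz[of "z ^ 4"] by (simp add: X_def)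
  qed
  have "X ^ 3 \<le> 4 / (1 - r) * (4 / (1 - r))"
    unfolding X_def power_mult_distrib using z by (intro mult_mono q) auto
  also have "\<dots> = 16 / (1 - r)\<^sup>2" by (simp add: power2_eq_square)
  finally have X3: "X ^ 3 \<le> 16 / (1 - r)\<^sup>2" .
  have "norm (etaq z) = r * X ^ 4" unfolding etaq_def norm_mult norm_power z X_def by (simp add: power_mult_distrib)
  also have "\<dots> \<le> X ^ 4" using z r X by (intro mult_left_le_one_le) auto
  also have "\<dots> = (X ^ 3) powr (4/3)"
  proof -
    have "(X ^ 3) powr (4/3) = (X powr 3) powr (4/3)" by (simp only: powr_numeral[OF less_imp_le[OF X]])
    also have "\<dots> = X powr (3 * (4/3))" by (rule powr_powr)
    also have "3 * (4/3) = (4::real)" by simp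
    also have "X powr 4 = X ^ 4" by (rule powr_numeral[OF less_imp_le[OF X]])
    finally show ?thesis by (rule sym)
  qed
  also have "\<dots> \<le> (16 / (1 - r)\<^sup>2) powr (4/3)" using X X3 by (intro powr_mono2) auto
  finally show ?thesis .
qed

text \<open>Cauchy's estimate on the circle of radius r = n / (n + 1): there 1 / (1 - r) = n + 1 and
  r^(-n) = (1 + 1/n)^n \<le> 3. The growth exponent 8/3 from \<open>etaq_bound\<close> lies below 3,
  which is what absolute convergence at 4 calls for.\<close>

lemma etac_bound: "norm (etac n) \<le> 3 * (16 * (real n + 1)\<^sup>2) powr (4/3)"
proof (cases "n = 0")
  case False
  define r where "r = real n / (real n + 1)"
  have r: "0 < r" "r < 1" "1 - r = 1 / (real n + 1)" using False by (auto simp: r_def field_simps)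
  define B where "B = (16 * (real n + 1)\<^sup>2) powr (4/3)"
  have "norm ((deriv ^^ n) etaq 0 :: complex) \<le> fact n * B / r ^ n"
  proof (rule Cauchy_inequality)
    show "(etaq :: complex \<Rightarrow> complex) holomorphic_on ball 0 r"
      by (rule holomorphic_on_subset[OF etaq_holomorphic]) (use r in auto)
    show "continuous_on (cball 0 r) (etaq :: complex \<Rightarrow> complex)"
      by (rule continuous_on_subset[OF holomorphic_on_imp_continuous_on[OF etaq_holomorphic]]) (use r in auto)
    show "0 < r" by fact
    show "norm (etaq x) \<le> B" if "norm (0 - x) = r" for x :: complex
      using etaq_bound[of x r] that r by (simp add: B_def power_divide)
  qed
  then have "norm (etac n) \<le> B * (1 / r) ^ n"
    by (simp add: etac_def norm_divide field_simps power_one_over)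
  also have "(1 / r) ^ n \<le> 3"
  proof -
    have "1 / r = 1 + 1 / real n" using False by (simp add: r_def field_simps)
    then have "(1 / r) ^ n \<le> exp (1 / real n) ^ n" using r by (intro power_mono) auto
    also have "\<dots> = exp 1" using False by (simp flip: exp_of_nat_mult)
    also have "\<dots> \<le> 3" by (rule exp_le)
    finally show ?thesis .
  qed
  then have "B * (1 / r) ^ n \<le> B * 3" by (intro mult_left_mono) (auto simp: B_def)
  finally show ?thesis by (simp add: B_def)
qed (simp add: etac_0)

lemma etac_summable: "summable (\<lambda>n. norm (etac (Suc n)) / real (Suc n) ^ 4)"
proof (rule summable_comparison_test_bigo)
  show "summable (\<lambda>n. norm (real (Suc n) powr (-4/3)))"
    using summable_Suc_iff[of "\<lambda>n. real n powr (-4/3)"] by (simp add: summable_real_powr_iff)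
  have "(\<lambda>n. norm (etac (Suc n)) / real (Suc n) ^ 4) \<in> O(\<lambda>n. 3 * (16 * (real (Suc n) + 1)\<^sup>2) powr (4/3) / real (Suc n) ^ 4)"
    by (intro bigoI[of _ 1] always_eventually allI) (use etac_bound[of "Suc n" for n] in \<open>auto intro!: divide_right_mono simp del: of_nat_Suc\<close>)
  also have "(\<lambda>n. 3 * (16 * (real (Suc n) + 1)\<^sup>2) powr (4/3) / real (Suc n) ^ 4) \<in> O(\<lambda>n. real (Suc n) powr (-4/3))"
    by real_asymp
  finally show "(\<lambda>n. norm (etac (Suc n)) / real (Suc n) ^ 4) \<in> O(\<lambda>n. real (Suc n) powr (-4/3))" .
qed

section \<open>The Mellin transform of the eta quotient\<close>

lemma power3_exp_integral:
  assumes c: "c > 0"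
  shows "has_bochner_integral lborel (\<lambda>x::real. indicator {0<..} x * (x ^ 3 * exp (- (c * x)))) (6 / c ^ 4)"
proof (rule has_bochner_integral_nn_integral)
  define P where "P = (\<lambda>x::real. - (x ^ 3 / c + 3 * x\<^sup>2 / c\<^sup>2 + 6 * x / c ^ 3 + 6 / c ^ 4) * exp (- (c * x)))"
  have "(\<integral>\<^sup>+x. ennreal (x ^ 3 * exp (- (c * x))) * indicator {0..} x \<partial>lborel) = ennreal (0 - P 0)"
  proof (rule nn_integral_FTC_atLeast)
    show "DERIV P x :> x ^ 3 * exp (- (c * x))" for x
      unfolding P_def using c by (auto intro!: derivative_eq_intros simp: field_simps) (simp add: eval_nat_numeral algebra_simps)
    show "(P \<longlongrightarrow> 0) at_top" unfolding P_def using c by real_asymp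
  qed auto
  also have "0 - P 0 = 6 / c ^ 4" by (simp add: P_def)
  also have "(\<integral>\<^sup>+x. ennreal (x ^ 3 * exp (- (c * x))) * indicator {0..} x \<partial>lborel) =
     (\<integral>\<^sup>+x. ennreal (indicator {0<..} x * (x ^ 3 * exp (- (c * x)))) \<partial>lborel)"
    by (intro nn_integral_cong) (auto simp: indicator_def)
  finally show "(\<integral>\<^sup>+x. ennreal (indicator {0<..} x * (x ^ 3 * exp (- (c * x)))) \<partial>lborel) = ennreal (6 / c ^ 4)" .
qed (use c in \<open>auto simp: indicator_def\<close>)

lemma qp_of_real: "norm q < 1 \<Longrightarrow> qp (of_real q :: complex) = of_real (qp q)"
proof -
  assume q: "norm q < 1"
  have "(\<lambda>n. complex_of_real (qpf q n)) \<longlonglongrightarrow> of_real (qp q)" by (intro tendsto_of_real qpf_lim q)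
  moreover have "complex_of_real (qpf q n) = qpf (of_real q) n" for n by (simp add: qpf_def)
  ultimately have a: "qpf (complex_of_real q) \<longlonglongrightarrow> of_real (qp q)" by simp
  have b: "qpf (complex_of_real q) \<longlonglongrightarrow> qp (of_real q)" using q by (intro qpf_lim) simp
  show "qp (of_real q :: complex) = of_real (qp q)" by (rule LIMSEQ_unique[OF b a])
qed

lemma etaq_of_real:
  fixes q :: real
  assumes q: "norm q < 1" shows "etaq (of_real q :: complex) = of_real (etaq q)"
proof -
  have n2: "norm (q\<^sup>2) < 1" by (rule norm_sq_less[OF q])
  have n4: "norm (q ^ 4) < 1" using norm_sq_less[OF n2] by simp
  have "qp ((of_real q :: complex)\<^sup>2) = of_real (qp (q\<^sup>2))" using qp_of_real[OF n2] by simp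
  moreover have "qp ((of_real q :: complex) ^ 4) = of_real (qp (q ^ 4))" using qp_of_real[OF n4] by simp
  ultimately show ?thesis by (simp add: etaq_def)
qed

text \<open>Termwise 6 / (n pi / 2)^4 = 96 / (pi^4 n^4). The coefficients carry signs, so the
  interchange rests on \<open>etac_summable\<close>. As the integral is real, the second claim comes
  out of the same identity.\<close>

theorem eta_mellin:
  "has_bochner_integral lborel (\<lambda>x. indicator {0<..} x * (x ^ 3 * etaq (exp (- (pi * x / 2)))))
     (96 / pi ^ 4 * Re (\<Sum>n. etac (Suc n) / of_nat (Suc n) ^ 4))"
  "Im (\<Sum>n. etac (Suc n) / of_nat (Suc n) ^ 4) = 0"
proof -
  define f where "f = (\<lambda>n x. etac (Suc n) * of_real (indicator {0<..} x * (x ^ 3 * exp (- (real (Suc n) * (pi / 2) * x)))))"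
  have c: "real (Suc n) * (pi / 2) > 0" for n by simp
  note pe = power3_exp_integral[OF c]
  have i: "integrable lborel (f n)" for n
    unfolding f_def using pe[of n] by (intro integrable_mult_right integrable_of_real) (simp add: has_bochner_integral_iff)
  have nf: "norm (f n x) = norm (etac (Suc n)) * (indicator {0<..} x * (x ^ 3 * exp (- (real (Suc n) * (pi / 2) * x))))" for n x
    unfolding f_def by (auto simp: norm_mult norm_power indicator_def)
  have val: "6 / (real (Suc n) * (pi / 2)) ^ 4 = 96 / pi ^ 4 * (1 / real (Suc n) ^ 4)" for n
    by (simp add: power_mult_distrib power_divide)
  have inf: "(\<integral>x. norm (f n x) \<partial>lborel) = 96 / pi ^ 4 * (norm (etac (Suc n)) / real (Suc n) ^ 4)" for n
    unfolding nf integral_mult_right_zero using pe[of n] unfolding has_bochner_integral_iff val by simp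
  have ifn: "(\<integral>x. f n x \<partial>lborel) = of_real (96 / pi ^ 4) * (etac (Suc n) / of_nat (Suc n) ^ 4)" for n
  proof -
    have "(\<integral>x. f n x \<partial>lborel) = etac (Suc n) * of_real (\<integral>x. indicator {0<..} x * (x ^ 3 * exp (- (real (Suc n) * (pi / 2) * x))) \<partial>lborel)"
      unfolding f_def integral_mult_right_zero integral_complex_of_real ..
    also have "(\<integral>x. indicator {0<..} x * (x ^ 3 * exp (- (real (Suc n) * (pi / 2) * x))) \<partial>lborel) = 96 / pi ^ 4 * (1 / real (Suc n) ^ 4)"
      using pe[of n] unfolding has_bochner_integral_iff val by simp
    finally show ?thesis by simp
  qed
  have sm: "(\<lambda>n. f n x) sums of_real (indicator {0<..} x * (x ^ 3 * etaq (exp (- (pi * x / 2)))))"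
    and nsm: "summable (\<lambda>n. norm (f n x))" for x
  proof -
    have "(\<lambda>n. f n x) sums of_real (indicator {0<..} x * (x ^ 3 * etaq (exp (- (pi * x / 2))))) \<and> summable (\<lambda>n. norm (f n x))"
    proof (cases "x > 0")
      case True
      define z where "z = exp (- (pi * x / 2))"
      have z: "norm z < 1" "0 < z" using True by (auto simp: z_def)
      have e: "exp (- (real (Suc n) * (pi / 2) * x)) = z ^ Suc n" for n
        unfolding z_def exp_of_nat_mult[symmetric] by (simp add: algebra_simps)
      have "(\<lambda>n. etac n * of_real z ^ n) sums etaq (of_real z)" using z by (intro etac_sums) simp
      then have s: "(\<lambda>n. etac (Suc n) * of_real z ^ Suc n) sums etaq (of_real z)"
        by (subst sums_Suc_iff) (simp add: etac_0)
      have "(\<lambda>n. of_real (x ^ 3) * (etac (Suc n) * of_real z ^ Suc n)) sums (of_real (x ^ 3) * etaq (of_real z))"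
        by (intro sums_mult s)
      moreover have "of_real (x ^ 3) * (etac (Suc n) * of_real z ^ Suc n) = f n x" for n
        unfolding f_def e using True by (simp add: mult_ac)
      moreover have "summable (\<lambda>n. norm (f n x))"
      proof -
        \<comment> \<open>The midpoint of z and 1 lies in the disc; convergence there gives absolute
          convergence at the smaller z.\<close>
        have "norm (of_real ((z + 1) / 2) :: complex) < 1" using z by simp
        from etac_sums[OF this] have "summable (\<lambda>n. etac n * of_real ((z + 1) / 2) ^ n)" by (simp add: sums_iff)
        then have "summable (\<lambda>n. norm (etac n * of_real z ^ n))"
          by (rule powser_insidea) (use z in auto)
        then have "summable (\<lambda>n. norm (etac (Suc n) * of_real z ^ Suc n))"
          using summable_Suc_iff[of "\<lambda>n. norm (etac n * of_real z ^ n)"] by blast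
        moreover have eq: "norm (f n x) = \<bar>x ^ 3\<bar> * norm (etac (Suc n) * of_real z ^ Suc n)" for n
          unfolding f_def e using True by (simp add: norm_mult norm_power)
        ultimately show ?thesis unfolding eq by (intro summable_mult)
      qed
      ultimately show ?thesis using True etaq_of_real[OF z(1)] by (simp add: z_def)
    qed (simp add: f_def)
    then show "(\<lambda>n. f n x) sums of_real (indicator {0<..} x * (x ^ 3 * etaq (exp (- (pi * x / 2)))))" "summable (\<lambda>n. norm (f n x))" by auto
  qed
  have AEs: "AE x in lborel. summable (\<lambda>n. norm (f n x))" using nsm by simp
  have Ss: "summable (\<lambda>n. \<integral>x. norm (f n x) \<partial>lborel)" unfolding inf by (intro summable_mult etac_summable)
  have "(\<lambda>n. \<integral>x. f n x \<partial>lborel) sums (\<integral>x. (\<Sum>n. f n x) \<partial>lborel)"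
    by (rule sums_integral[OF i AEs Ss])
  moreover have "(\<Sum>n. f n x) = of_real (indicator {0<..} x * (x ^ 3 * etaq (exp (- (pi * x / 2)))))" for x
    using sm by (simp add: sums_iff)
  ultimately have 1: "(\<lambda>n. of_real (96 / pi ^ 4) * (etac (Suc n) / of_nat (Suc n) ^ 4)) sums
      of_real (\<integral>x. indicator {0<..} x * (x ^ 3 * etaq (exp (- (pi * x / 2)))) \<partial>lborel)"
    unfolding ifn by (simp only: integral_complex_of_real)
  have int: "integrable lborel (\<lambda>x. complex_of_real (indicator {0<..} x * (x ^ 3 * etaq (exp (- (pi * x / 2))))))"
    using integrable_suminf[OF i AEs Ss] sm by (simp add: sums_iff)
  have "summable (\<lambda>n. norm (etac (Suc n) / of_nat (Suc n) ^ 4))"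
    using etac_summable by (simp add: norm_divide norm_power del: of_nat_Suc)
  then have "(\<lambda>n. etac (Suc n) / of_nat (Suc n) ^ 4) sums (\<Sum>n. etac (Suc n) / of_nat (Suc n) ^ 4)"
    by (rule summable_sums[OF summable_norm_cancel])
  then have 2: "(\<lambda>n. of_real (96 / pi ^ 4) * (etac (Suc n) / of_nat (Suc n) ^ 4)) sums (of_real (96 / pi ^ 4) * (\<Sum>n. etac (Suc n) / of_nat (Suc n) ^ 4))"
    by (rule sums_mult)
  define I where "I = (\<integral>x. indicator {0<..} x * (x ^ 3 * etaq (exp (- (pi * x / 2)))) \<partial>lborel)"
  define S where "S = (\<Sum>n. etac (Suc n) / of_nat (Suc n) ^ 4)"
  have eq: "complex_of_real I = of_real (96 / pi ^ 4) * S"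
    using 1 2 unfolding I_def[symmetric] S_def[symmetric] by (rule sums_unique2)
  have Re_Im: "x = r * Re S \<and> (r = 0 \<or> Im S = 0)" if "complex_of_real x = of_real r * S" for x r S
  proof -
    have "Re (complex_of_real x) = Re (of_real r * S)" "Im (complex_of_real x) = Im (of_real r * S)"
      by (simp_all only: that)
    then show ?thesis
      by simp
  qed
  have p: "96 / pi ^ 4 \<noteq> 0" by simp
  have RI: "I = 96 / pi ^ 4 * Re S" and II: "Im S = 0" using Re_Im[OF eq] p by blast+
  have ig: "integrable lborel (\<lambda>x. indicator {0<..} x * (x ^ 3 * etaq (exp (- (pi * x / 2)))))"
    by (rule complex_of_real_integrable_eq[THEN iffD1, OF int])
  show "has_bochner_integral lborel (\<lambda>x. indicator {0<..} x * (x ^ 3 * etaq (exp (- (pi * x / 2)))))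
     (96 / pi ^ 4 * Re (\<Sum>n. etac (Suc n) / of_nat (Suc n) ^ 4))"
    by (rule has_bochner_integral_iff[THEN iffD2, OF conjI[OF ig RI[unfolded I_def S_def]]])
  show "Im (\<Sum>n. etac (Suc n) / of_nat (Suc n) ^ 4) = 0"
    by (rule II[unfolded S_def])
qed

section \<open>Integrals of products of two hypergeometric functions\<close>

lemma exp_le_cs: "y > 0 \<Longrightarrow> exp (- y) \<le> cs y"
proof -
  assume "y > 0"
  then have "0 < 1 - exp (- 2 * y)" "1 - exp (- 2 * y) \<le> 1" by auto
  then show ?thesis unfolding cs_def by (simp only: pos_le_divide_eq mult_left_le exp_ge_zero)
qed

lemma pow_exp_summable:
  assumes z: "z > 0" shows "summable (\<lambda>n. real (Suc n) ^ p * exp (- z) ^ Suc n)"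
proof (rule summable_comparison_test'[OF pow_cs_summable(1)[OF z, of p], of 0])
  fix n
  have "exp (- z) ^ Suc n = exp (- (real (Suc n) * z))" by (simp add: exp_of_nat_mult[symmetric] del: power_Suc of_nat_Suc)
  also have "\<dots> \<le> cs (real (Suc n) * z)" using z by (intro exp_le_cs mult_pos_pos) auto
  finally show "norm (real (Suc n) ^ p * exp (- z) ^ Suc n) \<le> real (Suc n) ^ p * cs (real (Suc n) * z)"
    by (simp add: abs_mult mult_left_mono del: power_Suc of_nat_Suc)
qed

text \<open>Multiplying by 1 - w replaces n^p by (n + 1)^p - n^p, a combination of lower powers, so
  the closed forms follow one after the other.\<close>

lemma cube_sums:
  assumes z: "z > 0"
  defines "w \<equiv> exp (- z)"
  shows "(\<lambda>n. real (Suc n) ^ 3 * w ^ Suc n) sums (w * (1 + 4 * w + w\<^sup>2) / (1 - w) ^ 4)"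
proof -
  have w: "0 < w" "w < 1" using z by (auto simp: w_def)
  define T where "T = (\<lambda>p. \<Sum>n. real (Suc n) ^ p * w ^ Suc n)"
  have T: "(\<lambda>n. real (Suc n) ^ p * w ^ Suc n) sums T p" for p
    unfolding T_def w_def by (intro summable_sums pow_exp_summable z)
  have S: "(\<lambda>n. real n ^ p * w ^ Suc n) sums (w * T p)" if "p > 0" for p
  proof -
    have "(\<lambda>n. w * (real (Suc n) ^ p * w ^ Suc n)) sums (w * T p)" by (intro sums_mult T)
    then have "(\<lambda>n. real (Suc n) ^ p * w ^ Suc (Suc n)) sums (w * T p)" by (simp add: mult_ac)
    then show ?thesis using sums_Suc_iff[of "\<lambda>n. real n ^ p * w ^ Suc n" "w * T p"] zero_power[OF that, where 'a = real] by (simp del: power_Suc of_nat_Suc)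
  qed
  have S0: "(\<lambda>n. w ^ Suc n) sums (w / (1 - w))"
    using sums_mult[OF geometric_sums[of w], of w] w by simp
  have T1: "T 1 = w / (1 - w)\<^sup>2"
  proof -
    have "(\<lambda>n. (real (Suc n) ^ 1 * w ^ Suc n) - (real n ^ 1 * w ^ Suc n)) sums (T 1 - w * T 1)"
      by (intro sums_diff T S) simp
    moreover have "(real (Suc n) ^ 1 * w ^ Suc n) - (real n ^ 1 * w ^ Suc n) = w ^ Suc n" for n by (simp add: algebra_simps)
    ultimately have "T 1 - w * T 1 = w / (1 - w)" using S0 sums_unique2 by simp
    then have "(1 - w) * T 1 = w / (1 - w)" by (simp add: algebra_simps)
    then have "T 1 = w / (1 - w) / (1 - w)" using w by (simp only: eq_divide_eq) (simp add: mult.commute)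
    then show ?thesis by (simp add: power2_eq_square)
  qed
  have T2: "T 2 = w * (1 + w) / (1 - w) ^ 3"
  proof -
    have "(\<lambda>n. (real (Suc n) ^ 2 * w ^ Suc n) - (real n ^ 2 * w ^ Suc n)) sums (T 2 - w * T 2)"
      by (intro sums_diff T S) simp
    moreover have "(\<lambda>n. 2 * (real n ^ 1 * w ^ Suc n) + w ^ Suc n) sums (2 * (w * T 1) + w / (1 - w))"
      by (intro sums_add sums_mult S S0) simp
    moreover have "(real (Suc n) ^ 2 * w ^ Suc n) - (real n ^ 2 * w ^ Suc n) = 2 * (real n ^ 1 * w ^ Suc n) + w ^ Suc n" for n
      by (simp add: algebra_simps power2_eq_square)
    ultimately have "T 2 - w * T 2 = 2 * (w * T 1) + w / (1 - w)" using sums_unique2 by simp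
    then have "(1 - w) * T 2 = 2 * (w * T 1) + w / (1 - w)" by (simp add: algebra_simps)
    also have "\<dots> = w * (1 + w) / (1 - w)\<^sup>2"
      unfolding T1 using w by (simp add: divide_simps eval_nat_numeral) (simp add: algebra_simps)
    finally have "T 2 = w * (1 + w) / (1 - w)\<^sup>2 / (1 - w)" using w by (simp only: eq_divide_eq) (simp add: mult.commute)
    then show ?thesis by (simp add: power3_eq_cube power2_eq_square)
  qed
  have "(\<lambda>n. (real (Suc n) ^ 3 * w ^ Suc n) - (real n ^ 3 * w ^ Suc n)) sums (T 3 - w * T 3)"
    by (intro sums_diff T S) simp
  moreover have "(\<lambda>n. 3 * (real n ^ 2 * w ^ Suc n) + 3 * (real n ^ 1 * w ^ Suc n) + w ^ Suc n) sums (3 * (w * T 2) + 3 * (w * T 1) + w / (1 - w))"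
    by (intro sums_add sums_mult S S0) simp_all
  moreover have "(real (Suc n) ^ 3 * w ^ Suc n) - (real n ^ 3 * w ^ Suc n) = 3 * (real n ^ 2 * w ^ Suc n) + 3 * (real n ^ 1 * w ^ Suc n) + w ^ Suc n" for n
    by (simp add: algebra_simps power2_eq_square power3_eq_cube)
  ultimately have "T 3 - w * T 3 = 3 * (w * T 2) + 3 * (w * T 1) + w / (1 - w)" using sums_unique2 by simp
  then have "(1 - w) * T 3 = 3 * (w * T 2) + 3 * (w * T 1) + w / (1 - w)" by (simp add: algebra_simps)
  also have "\<dots> = w * (1 + 4 * w + w\<^sup>2) / (1 - w) ^ 3"
    unfolding T1 T2 using w by (simp add: divide_simps eval_nat_numeral) (simp add: algebra_simps)
  finally have "T 3 = w * (1 + 4 * w + w\<^sup>2) / (1 - w) ^ 3 / (1 - w)" using w by (simp only: eq_divide_eq) (simp add: mult.commute)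
  then have "T 3 = w * (1 + 4 * w + w\<^sup>2) / (1 - w) ^ 4" by (simp add: eval_nat_numeral)
  then show ?thesis using T[of 3] by simp
qed

text \<open>Expanding \<open>1 / sinh\<close> geometrically and interchanging the sums.\<close>

lemma cube_cs_swap:
  assumes z: "z > 0" and v: "(\<lambda>n. real (Suc n) ^ 3 * cs (real (Suc n) * z)) sums v"
  shows "(\<lambda>j. \<Sum>n. real (Suc n) ^ 3 * exp (- (od j * z)) ^ Suc n) sums v"
proof -
  have nn: "0 \<le> real (Suc n) ^ 3 * cs (real (Suc n) * z)" for n
    using cs_pos[of "real (Suc n) * z"] z by (intro mult_nonneg_nonneg) auto
  have v0: "v \<ge> 0" by (rule sums_le[OF nn sums_zero v])
  have "ennreal v = (\<Sum>n. ennreal (real (Suc n) ^ 3 * cs (real (Suc n) * z)))"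
    by (rule ennreal_sums[symmetric, OF v nn])
  also have "\<dots> = (\<Sum>n. \<Sum>j. ennreal (real (Suc n) ^ 3 * exp (- (od j * (real (Suc n) * z)))))"
  proof (intro suminf_cong)
    fix n
    show "ennreal (real (Suc n) ^ 3 * cs (real (Suc n) * z)) = (\<Sum>j. ennreal (real (Suc n) ^ 3 * exp (- (od j * (real (Suc n) * z)))))"
      using z by (intro cs_ennreal[symmetric] mult_pos_pos) auto
  qed
  also have "\<dots> = (\<Sum>j. \<Sum>n. ennreal (real (Suc n) ^ 3 * exp (- (od j * (real (Suc n) * z)))))"
    by (rule ennreal_suminf_swap)
  also have "\<dots> = (\<Sum>j. ennreal (\<Sum>n. real (Suc n) ^ 3 * exp (- (od j * z)) ^ Suc n))"
  proof (intro suminf_cong)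
    fix j
    have e: "exp (- (od j * (real (Suc n) * z))) = exp (- (od j * z)) ^ Suc n" for n
      unfolding exp_of_nat_mult[symmetric] by (simp add: mult_ac)
    show "(\<Sum>n. ennreal (real (Suc n) ^ 3 * exp (- (od j * (real (Suc n) * z))))) = ennreal (\<Sum>n. real (Suc n) ^ 3 * exp (- (od j * z)) ^ Suc n)"
      unfolding e using z by (intro ennreal_sums summable_sums pow_exp_summable mult_pos_pos mult_nonneg_nonneg zero_le_power) auto
  qed
  finally have eq: "(\<Sum>j. ennreal (\<Sum>n. real (Suc n) ^ 3 * exp (- (od j * z)) ^ Suc n)) = ennreal v" ..
  have nn2: "0 \<le> (\<Sum>n. real (Suc n) ^ 3 * exp (- (od j * z)) ^ Suc n)" for j
    using z by (intro suminf_nonneg pow_exp_summable mult_pos_pos mult_nonneg_nonneg zero_le_power) auto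
  have "(\<lambda>j. ennreal (\<Sum>n. real (Suc n) ^ 3 * exp (- (od j * z)) ^ Suc n)) sums ennreal v"
    unfolding eq[symmetric] by (intro summable_sums) simp
  then show ?thesis using nn2 v0 by (simp only: sums_ennreal)
qed

text \<open>With w = exp (- z), the closed form of the alternating series of (-1)^(n-1) n^3 w^n.
  Unlike the series without signs it stays bounded as z tends to 0, which makes the Mellin integrals
  of \<open>Bc\<close> converge termwise.\<close>

definition psi :: "real \<Rightarrow> real" where
  "psi z = exp (- z) * (1 - 4 * exp (- z) + (exp (- z))\<^sup>2) / (1 + exp (- z)) ^ 4"

definition Bc :: "real \<Rightarrow> real" where "Bc x = 16 * (A (x / 2))\<^sup>2 - 256 * (A x)\<^sup>2"

lemma Bc_sums:
  assumes x: "x > 0" shows "(\<lambda>j. 16 * psi (od j * pi * x)) sums Bc x"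
proof -
  have s: "(\<lambda>n. real (Suc n) ^ 3 * cs (real (Suc n) * (pi * x))) sums (A (x / 2))\<^sup>2"
    "(\<lambda>n. real (Suc n) ^ 3 * cs (real (Suc n) * (2 * (pi * x)))) sums (A x)\<^sup>2"
    using A_sq[of "x / 2"] A_sq[of x] x by (simp_all add: mult.assoc del: of_nat_Suc)
  have "(\<lambda>j. 16 * (\<Sum>n. real (Suc n) ^ 3 * exp (- (od j * (pi * x))) ^ Suc n) - 256 * (\<Sum>n. real (Suc n) ^ 3 * exp (- (od j * (2 * (pi * x)))) ^ Suc n)) sums Bc x"
    unfolding Bc_def using x by (intro sums_diff sums_mult cube_cs_swap s) auto
  moreover have "16 * (\<Sum>n. real (Suc n) ^ 3 * exp (- (od j * (pi * x))) ^ Suc n) - 256 * (\<Sum>n. real (Suc n) ^ 3 * exp (- (od j * (2 * (pi * x)))) ^ Suc n) = 16 * psi (od j * pi * x)" for j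
  proof -
    define z where "z = od j * (pi * x)"
    have z: "z > 0" using x by (simp add: z_def)
    have z2: "od j * (2 * (pi * x)) = 2 * z" by (simp add: z_def)
    define w where "w = exp (- z)"
    have w: "0 < w" "w < 1" using z by (auto simp: w_def)
    have w2: "exp (- (2 * z)) = w\<^sup>2" by (simp add: w_def exp_of_nat_mult[symmetric])
    have 1: "(\<Sum>n. real (Suc n) ^ 3 * exp (- z) ^ Suc n) = w * (1 + 4 * w + w\<^sup>2) / (1 - w) ^ 4"
      using sums_unique[OF cube_sums[OF z]] by (simp only: w_def)
    have 2: "(\<Sum>n. real (Suc n) ^ 3 * exp (- (2 * z)) ^ Suc n) = w\<^sup>2 * (1 + 4 * w\<^sup>2 + (w\<^sup>2)\<^sup>2) / (1 - w\<^sup>2) ^ 4"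
      using sums_unique[OF cube_sums[of "2 * z"]] z by (simp only: w2)
    have f: "(1 - w\<^sup>2) ^ 4 = (1 - w) ^ 4 * (1 + w) ^ 4"
      unfolding power_mult_distrib[symmetric] by (intro arg_cong[of _ _ "\<lambda>y. y ^ 4"]) (simp add: power2_eq_square algebra_simps)
    define P Q where "P = (1 - w) ^ 4" and "Q = (1 + w) ^ 4"
    have PQ: "P > 0" "Q > 0" using w by (auto simp: P_def Q_def)
    \<comment> \<open>With denominators cleared: the sum of n^3 w^n minus 16 times that of n^3
      w^(2n) is the sum of (-1)^(n-1) n^3 w^n.\<close>
    have key: "w * (1 + 4 * w + w\<^sup>2) * Q - 16 * (w\<^sup>2 * (1 + 4 * w\<^sup>2 + (w\<^sup>2)\<^sup>2)) = w * (1 - 4 * w + w\<^sup>2) * P"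
      unfolding P_def Q_def by (simp add: eval_nat_numeral algebra_simps)
    have "16 * (w * (1 + 4 * w + w\<^sup>2) / P) - 256 * (w\<^sup>2 * (1 + 4 * w\<^sup>2 + (w\<^sup>2)\<^sup>2) / (P * Q)) =
       16 * ((w * (1 + 4 * w + w\<^sup>2) * Q - 16 * (w\<^sup>2 * (1 + 4 * w\<^sup>2 + (w\<^sup>2)\<^sup>2))) / (P * Q))"
      using PQ by (simp add: field_simps)
    also have "\<dots> = 16 * (w * (1 - 4 * w + w\<^sup>2) / Q)"
      unfolding key using PQ by simp
    finally show ?thesis unfolding z2 z_def[symmetric] 1 2 f P_def[symmetric] Q_def[symmetric]
      by (simp add: psi_def z_def w_def Q_def mult.assoc)
  qed
  ultimately show ?thesis by simp
qed

lemma psi_bound: "z \<ge> 0 \<Longrightarrow> \<bar>psi z\<bar> \<le> 6 * exp (- z)"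
proof -
  assume z: "z \<ge> 0"
  define w where "w = exp (- z)"
  have w: "0 < w" "w \<le> 1" using z by (auto simp: w_def)
  have w2: "0 \<le> w\<^sup>2" "w\<^sup>2 \<le> 1" using w by (auto intro!: power_le_one)
  have "1 \<le> (1 + w) ^ 4" using w by (intro one_le_power) auto
  have "\<bar>1 - 4 * w + w\<^sup>2\<bar> \<le> 6" unfolding abs_le_iff using w w2 by linarith
  then have "\<bar>w * (1 - 4 * w + w\<^sup>2)\<bar> \<le> 6 * w" using w by (simp add: abs_mult)
  then have "\<bar>w * (1 - 4 * w + w\<^sup>2)\<bar> / (1 + w) ^ 4 \<le> 6 * w / 1"
    using \<open>1 \<le> (1 + w) ^ 4\<close> w by (intro frac_le) auto
  then show ?thesis using w by (simp add: psi_def w_def[symmetric] abs_divide)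
qed

lemma psi_meas [measurable]: "psi \<in> borel_measurable borel"
  unfolding psi_def[abs_def] by measurable

lemma pow_exp_bochner:
  assumes c: "c > 0" and p: "p = 1 \<or> p = 2"
  shows "has_bochner_integral lborel (\<lambda>x::real. indicator {0<..} x * (x ^ p * exp (- (c * x)))) (real p / c ^ (p + 1))"
proof (rule has_bochner_integral_nn_integral)
  define P1 where "P1 = (\<lambda>x::real. - (x / c + 1 / c\<^sup>2) * exp (- (c * x)))"
  define P2 where "P2 = (\<lambda>x::real. - (x\<^sup>2 / c + 2 * x / c\<^sup>2 + 2 / c ^ 3) * exp (- (c * x)))"
  define P where "P = (if p = 1 then P1 else P2)"
  have D1: "DERIV P1 x :> x ^ 1 * exp (- (c * x))" for x
    unfolding P1_def using c by (auto intro!: derivative_eq_intros simp: field_simps power2_eq_square)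
  have D2: "DERIV P2 x :> x ^ 2 * exp (- (c * x))" for x
    unfolding P2_def using c by (auto intro!: derivative_eq_intros simp: field_simps) (simp add: eval_nat_numeral algebra_simps)
  have L: "(P1 \<longlongrightarrow> 0) at_top" "(P2 \<longlongrightarrow> 0) at_top" unfolding P1_def P2_def using c by real_asymp+
  have "(\<integral>\<^sup>+x. ennreal (x ^ p * exp (- (c * x))) * indicator {0..} x \<partial>lborel) = ennreal (0 - P 0)"
    by (rule nn_integral_FTC_atLeast) (use p D1 D2 L in \<open>auto simp: P_def\<close>)
  also have "0 - P 0 = real p / c ^ (p + 1)" using p by (auto simp: P_def P1_def P2_def power2_eq_square power3_eq_cube)
  also have "(\<integral>\<^sup>+x. ennreal (x ^ p * exp (- (c * x))) * indicator {0..} x \<partial>lborel) =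
     (\<integral>\<^sup>+x. ennreal (indicator {0<..} x * (x ^ p * exp (- (c * x)))) \<partial>lborel)"
    using p by (intro nn_integral_cong) (auto simp: indicator_def)
  finally show "(\<integral>\<^sup>+x. ennreal (indicator {0<..} x * (x ^ p * exp (- (c * x)))) \<partial>lborel) = ennreal (real p / c ^ (p + 1))" .
qed (use c in \<open>auto simp: indicator_def\<close>)

text \<open>\<open>Y0\<close> is the logistic function 1 / (exp (c x) + 1), and each of
  \<open>Y1\<close>, \<open>Y2\<close>, \<open>psi\<close> is - 1/c times the derivative of its
  predecessor. Repeated integration by parts leaves only Y1(0) = 1/4 for p = 1 and Y0(0) = 1/2 for p
  = 2.\<close>

lemma psi_mellin:
  assumes c: "c > 0" and p: "p = 1 \<or> p = 2"
  shows "integrable lborel (\<lambda>x. indicator {0<..} x * (x ^ p * psi (c * x)))"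
    and "(\<integral>x. indicator {0<..} x * (x ^ p * psi (c * x)) \<partial>lborel) = (if p = 1 then 1 / (4 * c\<^sup>2) else 1 / c ^ 3)"
proof -
  have meas: "(\<lambda>x. indicator {0<..} x * (x ^ p * psi (c * x))) \<in> borel_measurable lborel" by measurable
  have dom: "integrable lborel (\<lambda>x::real. 6 * (indicator {0<..} x * (x ^ p * exp (- (c * x)))))"
    using pow_exp_bochner[OF c p] by (intro integrable_mult_right) (simp add: has_bochner_integral_iff)
  show int: "integrable lborel (\<lambda>x. indicator {0<..} x * (x ^ p * psi (c * x)))"
  proof (rule Bochner_Integration.integrable_bound[OF dom meas], intro AE_I2)
    fix x :: real
    show "norm (indicator {0<..} x * (x ^ p * psi (c * x))) \<le> norm (6 * (indicator {0<..} x * (x ^ p * exp (- (c * x)))))"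
    proof (cases "x > 0")
      case True
      have "x ^ p * \<bar>psi (c * x)\<bar> \<le> x ^ p * (6 * exp (- (c * x)))"
        using True c by (intro mult_left_mono psi_bound) auto
      then show ?thesis using True by (simp add: abs_mult)
    qed simp
  qed
  define w where "w = (\<lambda>x. exp (- (c * x)))"
  define Y0 Y1 Y2 where "Y0 = (\<lambda>x. w x / (1 + w x))" and "Y1 = (\<lambda>x. w x / (1 + w x)\<^sup>2)" and "Y2 = (\<lambda>x. w x * (1 - w x) / (1 + w x) ^ 3)"
  have w: "w x > 0" "1 + w x > 0" for x by (auto simp: w_def add_pos_pos)
  have dw: "(w has_field_derivative - c * w x) (at x)" for x
    unfolding w_def by (auto intro!: derivative_eq_intros)
  have psi_w: "psi (c * x) = w x * (1 - 4 * w x + (w x)\<^sup>2) / (1 + w x) ^ 4" for x by (simp add: psi_def w_def)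
  have d0: "(Y0 has_field_derivative - c * Y1 x) (at x)" for x
    unfolding Y0_def Y1_def using w[of x]
    by (auto intro!: derivative_eq_intros dw simp: divide_simps) (simp add: eval_nat_numeral algebra_simps)?
  have d1: "(Y1 has_field_derivative - c * Y2 x) (at x)" for x
  proof -
    have n: "((\<lambda>x. (1 + w x)\<^sup>2) has_field_derivative 2 * (1 + w x) * (- c * w x)) (at x)"
      by (auto intro!: derivative_eq_intros dw)
    have "(Y1 has_field_derivative ((- c * w x) * (1 + w x)\<^sup>2 - w x * (2 * (1 + w x) * (- c * w x))) / ((1 + w x)\<^sup>2 * (1 + w x)\<^sup>2)) (at x)"
      unfolding Y1_def using w[of x] by (intro DERIV_divide dw n) auto
    moreover have "((- c * v) * (1 + v)\<^sup>2 - v * (2 * (1 + v) * (- c * v))) / ((1 + v)\<^sup>2 * (1 + v)\<^sup>2) = - c * (v * (1 - v) / (1 + v) ^ 3)" if "1 + v > 0" for v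
      using that by (simp add: divide_simps) (simp add: eval_nat_numeral algebra_simps)
    ultimately show ?thesis unfolding Y2_def using w[of x] by metis
  qed
  have d2: "(Y2 has_field_derivative - c * psi (c * x)) (at x)" for x
  proof -
    have n: "((\<lambda>x. w x * (1 - w x)) has_field_derivative - c * w x * (1 - 2 * w x)) (at x)"
      by (auto intro!: derivative_eq_intros dw simp: algebra_simps)
    have n2: "((\<lambda>x. (1 + w x) ^ 3) has_field_derivative 3 * (1 + w x)\<^sup>2 * (- c * w x)) (at x)"
      by (auto intro!: derivative_eq_intros dw)
    have "(Y2 has_field_derivative ((- c * w x * (1 - 2 * w x)) * (1 + w x) ^ 3 - w x * (1 - w x) * (3 * (1 + w x)\<^sup>2 * (- c * w x))) / ((1 + w x) ^ 3 * (1 + w x) ^ 3)) (at x)"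
      unfolding Y2_def using w[of x] by (intro DERIV_divide n n2) auto
    moreover have "((- c * v * (1 - 2 * v)) * (1 + v) ^ 3 - v * (1 - v) * (3 * (1 + v)\<^sup>2 * (- c * v))) / ((1 + v) ^ 3 * (1 + v) ^ 3) = - c * (v * (1 - 4 * v + v\<^sup>2) / (1 + v) ^ 4)" if "1 + v > 0" for v
      using that by (simp add: divide_simps) (simp add: eval_nat_numeral algebra_simps)
    ultimately show ?thesis unfolding psi_w using w[of x] by metis
  qed
  \<comment> \<open>The antiderivative found by integrating by parts twice or three times.\<close>
  define P where "P = (if p = 1 then (\<lambda>x. - (x * Y2 x / c + Y1 x / c\<^sup>2)) else (\<lambda>x. - (x\<^sup>2 * Y2 x / c + 2 * x * Y1 x / c\<^sup>2 + 2 * Y0 x / c ^ 3)))"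
  have dP: "(P has_field_derivative x ^ p * psi (c * x)) (at x)" for x
  proof (cases "p = 1")
    case True
    have "((\<lambda>x. - (x * Y2 x / c + Y1 x / c\<^sup>2)) has_field_derivative x * psi (c * x)) (at x)"
      using c by (auto intro!: derivative_eq_intros d1 d2 simp: field_simps power2_eq_square)
    then show ?thesis using True by (simp add: P_def)
  next
    case False
    have "((\<lambda>x. - (x\<^sup>2 * Y2 x / c + 2 * x * Y1 x / c\<^sup>2 + 2 * Y0 x / c ^ 3)) has_field_derivative x\<^sup>2 * psi (c * x)) (at x)"
      using c by (auto intro!: derivative_eq_intros d0 d1 d2 simp: field_simps power2_eq_square power3_eq_cube)
    then show ?thesis using False p by (auto simp: P_def)
  qed
  have bd: "\<bar>Y0 x\<bar> \<le> w x \<and> \<bar>Y1 x\<bar> \<le> w x \<and> \<bar>Y2 x\<bar> \<le> w x" if "x > 0" for x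
  proof -
    have v: "w x > 0" "w x < 1" using that c by (auto simp: w_def)
    have *: "1 \<le> (1 + w x)\<^sup>2" "1 \<le> (1 + w x) ^ 3" using v by (intro one_le_power; simp)+
    have **: "\<bar>w x * (1 - w x)\<bar> \<le> w x" using v by (simp add: abs_mult mult_left_le)
    have q: "\<bar>a / b\<bar> \<le> w x" if "\<bar>a\<bar> \<le> w x" "1 \<le> b" for a b
    proof -
      have "\<bar>a\<bar> / \<bar>b\<bar> \<le> w x / 1" using that v by (intro frac_le) auto
      then show ?thesis by (simp add: abs_divide)
    qed
    show ?thesis unfolding Y0_def Y1_def Y2_def using v * ** by (intro conjI q) auto
  qed
  have lw: "((\<lambda>x. x ^ m * w x) \<longlongrightarrow> 0) at_top" for m
    unfolding w_def using c by real_asymp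
  have lY: "((\<lambda>x. x ^ m * Y x) \<longlongrightarrow> 0) at_top" if "\<And>x. x > 0 \<Longrightarrow> \<bar>Y x\<bar> \<le> w x" for m Y
  proof (rule Lim_null_comparison[OF _ lw[of m]])
    show "\<forall>\<^sub>F x in at_top. norm (x ^ m * Y x) \<le> x ^ m * w x"
      using eventually_gt_at_top[of 0] by eventually_elim (use that in \<open>auto simp: abs_mult intro!: mult_left_mono\<close>)
  qed
  have l0: "(Y0 \<longlongrightarrow> 0) at_top" "(Y1 \<longlongrightarrow> 0) at_top" using lY[of _ 0] bd by auto
  have l1: "((\<lambda>x. x * Y1 x) \<longlongrightarrow> 0) at_top" "((\<lambda>x. x * Y2 x) \<longlongrightarrow> 0) at_top" using lY[of _ 1] bd by auto
  have l2: "((\<lambda>x. x\<^sup>2 * Y2 x) \<longlongrightarrow> 0) at_top" using lY[of _ 2] bd by auto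
  have Pinf: "(P \<longlongrightarrow> 0) at_top"
  proof (cases "p = 1")
    case True
    have "((\<lambda>x. - (x * Y2 x / c + Y1 x / c\<^sup>2)) \<longlongrightarrow> - (0 / c + 0 / c\<^sup>2)) at_top"
      using c by (intro tendsto_intros l0 l1) auto
    then show ?thesis using True by (simp add: P_def)
  next
    case False
    have "((\<lambda>x. - (x\<^sup>2 * Y2 x / c + 2 * (x * Y1 x) / c\<^sup>2 + 2 * Y0 x / c ^ 3)) \<longlongrightarrow> - (0 / c + 2 * 0 / c\<^sup>2 + 2 * 0 / c ^ 3)) at_top"
      using c by (intro tendsto_intros l0 l1 l2) auto
    then show ?thesis using False by (simp add: P_def mult.assoc)
  qed
  have "isCont P 0" by (rule DERIV_isCont[OF dP])
  then have P0: "(P \<longlongrightarrow> P 0) (at_right 0)"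
    unfolding isCont_def by (rule tendsto_within_subset) auto
  have cont: "isCont (\<lambda>x. x ^ p * psi (c * x)) x" for x
  proof -
    have "1 + exp (- (c * x)) \<noteq> 0" using exp_gt_zero[of "- (c * x)"] by linarith
    then show ?thesis unfolding psi_def by (intro continuous_intros) auto
  qed
  have e: "einterval 0 \<infinity> = {0<..}" by (auto simp: einterval_def zero_ereal_def)
  have "(LBINT x=ereal 0..\<infinity>. x ^ p * psi (c * x)) = 0 - P 0"
  proof (rule interval_integral_FTC_integrable)
    show "set_integrable lborel (einterval (ereal 0) \<infinity>) (\<lambda>x. x ^ p * psi (c * x))"
      using int unfolding set_integrable_def zero_ereal_def[symmetric] e by simp
    show "((P \<circ> real_of_ereal) \<longlongrightarrow> P 0) (at_right (ereal 0))" "((P \<circ> real_of_ereal) \<longlongrightarrow> 0) (at_left \<infinity>)"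
      unfolding ereal_tendsto_simps using P0 Pinf by simp_all
  qed (use cont dP in \<open>auto simp: has_real_derivative_iff_has_vector_derivative\<close>)
  moreover have "(LBINT x=ereal 0..\<infinity>. x ^ p * psi (c * x)) = (\<integral>x. indicator {0<..} x * (x ^ p * psi (c * x)) \<partial>lborel)"
    by (simp add: interval_lebesgue_integral_def set_lebesgue_integral_def zero_ereal_def[symmetric] e)
  moreover have "0 - P 0 = (if p = 1 then 1 / (4 * c\<^sup>2) else 1 / c ^ 3)"
    using c by (simp add: P_def Y0_def Y1_def Y2_def w_def power2_eq_square)
  ultimately show "(\<integral>x. indicator {0<..} x * (x ^ p * psi (c * x)) \<partial>lborel) = (if p = 1 then 1 / (4 * c\<^sup>2) else 1 / c ^ 3)"
    by simp
qed

lemma change_of_variables_Ioo: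
  fixes g g' f k :: "real \<Rightarrow> real"
  assumes der: "\<And>x. x \<in> {a<..<b} \<Longrightarrow> (g has_field_derivative g' x) (at x)"
    and inj: "inj_on g {a<..<b}"
    and eq: "\<And>x. x \<in> {a<..<b} \<Longrightarrow> \<bar>g' x\<bar> * f (g x) = k x"
    and int: "f absolutely_integrable_on (g ` {a<..<b})" "integral (g ` {a<..<b}) f = I"
  shows "k absolutely_integrable_on {a<..<b}" "integral {a<..<b} k = I"
proof -
  have "(\<lambda>x. \<bar>g' x\<bar> *\<^sub>R f (g x)) absolutely_integrable_on {a<..<b} \<and> integral {a<..<b} (\<lambda>x. \<bar>g' x\<bar> *\<^sub>R f (g x)) = I"
    using has_absolute_integral_change_of_variables_1'[OF _ has_field_derivative_at_within[OF der] inj, of f I] int by simp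
  moreover have "((\<lambda>x. \<bar>g' x\<bar> *\<^sub>R f (g x)) absolutely_integrable_on {a<..<b}) = (k absolutely_integrable_on {a<..<b})"
    by (intro set_integrable_cong) (simp_all add: eq)
  moreover have "integral {a<..<b} (\<lambda>x. \<bar>g' x\<bar> *\<^sub>R f (g x)) = integral {a<..<b} k"
    by (intro integral_cong) (simp add: eq)
  ultimately show "k absolutely_integrable_on {a<..<b}" "integral {a<..<b} k = I" by simp_all
qed

lemma lborel_integrable_imp_absolutely_integrable:
  fixes f :: "real \<Rightarrow> real"
  assumes "integrable lborel (\<lambda>x. indicator S x * f x)" "S \<in> sets borel"
  shows "f absolutely_integrable_on S" "integral S f = (\<integral>x. indicator S x * f x \<partial>lborel)"
proof -
  have s: "set_integrable lborel S f" using assms by (simp add: set_integrable_def)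
  show "f absolutely_integrable_on S"
    using assms(1) integrable_completion[of "\<lambda>x. indicator S x * f x" lborel] borel_measurable_integrable[OF assms(1)]
    by (simp add: set_integrable_def)
  show "integral S f = (\<integral>x. indicator S x * f x \<partial>lborel)"
    using set_borel_integral_eq_integral(2)[OF s] by (simp add: set_lebesgue_integral_def)
qed

section \<open>Mellin transforms of the weight four form\<close>

definition zeta3 :: real where "zeta3 = (\<Sum>n. 1 / real (Suc n) ^ 3)"

lemma zeta3_sums: "(\<lambda>n. 1 / real (Suc n) ^ 3) sums zeta3"
proof -
  have "summable (\<lambda>n. inverse (real n ^ 3))" by (rule inverse_power_summable) simp
  then have "summable (\<lambda>n. inverse (real (Suc n) ^ 3))" by (subst summable_Suc_iff)
  then show ?thesis unfolding zeta3_def by (intro summable_sums) (simp add: inverse_eq_divide)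
qed

lemma odd_recip_sums:
  shows "(\<lambda>j. 1 / od j ^ 2) sums (pi\<^sup>2 / 8)" "(\<lambda>j. 1 / od j ^ 3) sums (7 / 8 * zeta3)"
proof -
  have "(\<lambda>n. 1 / real (Suc n) ^ 2) sums (pi\<^sup>2 / 6)" using inverse_squares_sums by (simp add: add.commute)
  moreover from sums_mult[OF this, of "1 / 4"] have "(\<lambda>n. 1 / real (2 * Suc n) ^ 2) sums (1 / 4 * (pi\<^sup>2 / 6))"
    by (simp only: of_nat_mult power_mult_distrib of_nat_numeral times_divide_times_eq) simp
  ultimately have "(\<lambda>j. 1 / real (2 * j + 1) ^ 2) sums (pi\<^sup>2 / 6 - 1 / 4 * (pi\<^sup>2 / 6))"
    by (rule sums_odd_part[where f = "\<lambda>n. 1 / real n ^ 2"])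
  then show "(\<lambda>j. 1 / od j ^ 2) sums (pi\<^sup>2 / 8)" by (simp add: od_def field_simps)
  from sums_mult[OF zeta3_sums, of "1 / 8"] have "(\<lambda>n. 1 / real (2 * Suc n) ^ 3) sums (1 / 8 * zeta3)"
    by (simp only: of_nat_mult power_mult_distrib of_nat_numeral times_divide_times_eq) simp
  with zeta3_sums have "(\<lambda>j. 1 / real (2 * j + 1) ^ 3) sums (zeta3 - 1 / 8 * zeta3)"
    by (rule sums_odd_part[where f = "\<lambda>n. 1 / real n ^ 3"])
  moreover have "zeta3 - 1 / 8 * zeta3 = 7 / 8 * zeta3" by simp
  ultimately show "(\<lambda>j. 1 / od j ^ 3) sums (7 / 8 * zeta3)" by (simp only: od_def)
qed

text \<open>Summing \<open>psi_mellin\<close> over odd multiples of pi gives the odd parts of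
  zeta(2) and zeta(3): 4 / pi^2 times pi^2 / 8, and 16 / pi^3 times 7/8 zeta(3). As
  \<open>psi\<close> changes sign, the interchange uses absolute bounds of order j^(-2).\<close>

lemma Bc_mellin:
  assumes p: "p = 1 \<or> p = 2"
  shows "integrable lborel (\<lambda>x. indicator {0<..} x * (x ^ p * Bc x))"
    and "(\<integral>x. indicator {0<..} x * (x ^ p * Bc x) \<partial>lborel) = (if p = 1 then 1 / 2 else 14 * zeta3 / pi ^ 3)"
proof -
  define g where "g = (\<lambda>j x. 16 * (indicator {0<..} x * (x ^ p * psi (od j * pi * x))) :: real)"
  have c: "od j * pi > 0" for j by simp
  have int: "integrable lborel (g j)" for j
    unfolding g_def using psi_mellin(1)[OF c p] by (intro integrable_mult_right) (simp add: mult.assoc)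
  have eb: "norm (g j x) \<le> 96 * (indicator {0<..} x * (x ^ p * exp (- (od j * pi * x))))" for j x
  proof (cases "x > 0")
    case True
    have "x ^ p * \<bar>psi (od j * pi * x)\<bar> \<le> x ^ p * (6 * exp (- (od j * pi * x)))"
      using True by (intro mult_left_mono psi_bound) auto
    then show ?thesis using True by (simp add: g_def abs_mult)
  qed (simp add: g_def)
  have sm: "summable (\<lambda>j. norm (g j x))" for x
  proof (cases "x > 0")
    case True
    then have "pi * x > 0" by simp
    then have "summable (\<lambda>j. exp (- (od j * (pi * x))))" using cs_sums[of "pi * x"] unfolding od_def by (simp add: sums_iff)
    then have "summable (\<lambda>j. 96 * (x ^ p * exp (- (od j * pi * x))))" by (intro summable_mult) (simp add: mult.assoc)
    then show ?thesis by (rule summable_comparison_test'[where N = 0]) (use True eb[of _ x] in simp)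
  qed (simp add: g_def)
  have Inn: "(\<integral>x. norm (g j x) \<partial>lborel) \<le> 192 / real (Suc j) ^ 2" for j
  proof -
    define d where "d = od j * pi"
    have d: "d \<ge> real (Suc j)"
    proof -
      have "real (Suc j) * 1 \<le> od j * pi" using pi_ge_two by (intro mult_mono) (auto simp: od_def)
      then show ?thesis by (simp add: d_def)
    qed
    have "(\<integral>x. norm (g j x) \<partial>lborel) \<le> (\<integral>x. 96 * (indicator {0<..} x * (x ^ p * exp (- (d * x)))) \<partial>lborel)"
      using pow_exp_bochner[OF c[of j] p] eb[of j] int[of j] unfolding d_def
      by (intro integral_mono integrable_norm) (auto simp: has_bochner_integral_iff)
    also have "\<dots> = 96 * (real p / d ^ (p + 1))"
      using pow_exp_bochner[OF c[of j] p] unfolding d_def by (simp add: has_bochner_integral_iff)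
    also have "\<dots> \<le> 96 * (2 / real (Suc j) ^ 2)"
    proof (intro mult_left_mono frac_le)
      have "real (Suc j) ^ 2 \<le> d ^ 2" using d by (intro power_mono) auto
      also have "\<dots> \<le> d ^ (p + 1)" using d p by (intro power_increasing) auto
      finally show "real (Suc j) ^ 2 \<le> d ^ (p + 1)" .
    qed (use p in auto)
    finally show ?thesis by simp
  qed
  have ss: "summable (\<lambda>j. \<integral>x. norm (g j x) \<partial>lborel)"
  proof (rule summable_comparison_test'[where N = 0 and g = "\<lambda>j. 192 / real (Suc j) ^ 2"])
    have "summable (\<lambda>n. inverse (real n ^ 2))" by (rule inverse_power_summable) simp
    then have "summable (\<lambda>n. inverse (real (Suc n) ^ 2))" by (subst summable_Suc_iff)
    from summable_mult[OF this, of 192] show "summable (\<lambda>j. 192 / real (Suc j) ^ 2)" by (simp add: inverse_eq_divide)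
  qed (use Inn in auto)
  have G: "(\<Sum>j. g j x) = indicator {0<..} x * (x ^ p * Bc x)" for x
  proof (cases "x > 0")
    case True
    from sums_mult[OF Bc_sums[OF True], of "x ^ p"] have "(\<lambda>j. g j x) sums (x ^ p * Bc x)"
      using True by (simp add: g_def mult.left_commute)
    then show ?thesis using True by (simp add: sums_iff)
  qed (simp add: g_def)
  from integrable_suminf[of lborel g] int sm ss show "integrable lborel (\<lambda>x. indicator {0<..} x * (x ^ p * Bc x))"
    unfolding G by auto
  have S: "(\<lambda>j. integral\<^sup>L lborel (g j)) sums (\<integral>x. indicator {0<..} x * (x ^ p * Bc x) \<partial>lborel)"
    using sums_integral[of lborel g] int sm ss unfolding G by auto
  have v: "integral\<^sup>L lborel (g j) = 16 * (if p = 1 then 1 / (4 * (od j * pi)\<^sup>2) else 1 / (od j * pi) ^ 3)" for j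
    unfolding g_def using psi_mellin(2)[OF c[of j] p] by simp
  show "(\<integral>x. indicator {0<..} x * (x ^ p * Bc x) \<partial>lborel) = (if p = 1 then 1 / 2 else 14 * zeta3 / pi ^ 3)"
  proof (cases "p = 1")
    case True
    have "(\<lambda>j. 4 / pi\<^sup>2 * (1 / od j ^ 2)) sums (4 / pi\<^sup>2 * (pi\<^sup>2 / 8))" by (intro sums_mult odd_recip_sums)
    moreover have "integral\<^sup>L lborel (g j) = 4 / pi\<^sup>2 * (1 / od j ^ 2)" for j
      unfolding v using True by (simp add: power_mult_distrib)
    ultimately show ?thesis using S True sums_unique2 by fastforce
  next
    case False
    have "(\<lambda>j. 16 / pi ^ 3 * (1 / od j ^ 3)) sums (16 / pi ^ 3 * (7 / 8 * zeta3))" by (intro sums_mult odd_recip_sums)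
    moreover have "integral\<^sup>L lborel (g j) = 16 / pi ^ 3 * (1 / od j ^ 3)" for j
      unfolding v using False by (simp add: power_mult_distrib)
    ultimately show ?thesis using S False sums_unique2 by fastforce
  qed
qed

lemma Bc_h: "0 < s \<Longrightarrow> s < 1 \<Longrightarrow> Bc (h s) = s * (1 - s) * (F s) ^ 4"
  unfolding Bc_def using weight4_cusp[of s] by simp

lemma F_products_integral:
  shows "(\<lambda>t. F t * F (1 - t)) absolutely_integrable_on {0<..<1}" "integral {0<..<1} (\<lambda>t. F t * F (1 - t)) = pi / 2"
    and "(\<lambda>t. (F (1 - t))\<^sup>2) absolutely_integrable_on {0<..<1}" "integral {0<..<1} (\<lambda>t. (F (1 - t))\<^sup>2) = 14 * zeta3 / pi\<^sup>2"
proof -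
  define h' where "h' = (\<lambda>t. - 1 / (pi * t * (1 - t) * (F t)\<^sup>2))"
  have dh: "(h has_field_derivative h' t) (at t)" if "t \<in> {0<..<1}" for t
    unfolding h'_def using that h_deriv[of t] by auto
  define k where "k = (\<lambda>(p::nat) t. if p = 1 then F t * F (1 - t) else (F (1 - t))\<^sup>2)"
  have eq: "\<bar>h' t\<bar> * (pi * (h t ^ p * Bc (h t))) = k p t"
    if t: "t \<in> {0<..<1}" and p: "p = 1 \<or> p = 2" for t p
  proof -
    have pos: "F t > 0" "t > 0" "1 - t > 0" using t by (auto intro!: F_pos)
    have "\<bar>h' t\<bar> = 1 / (pi * t * (1 - t) * (F t)\<^sup>2)" using pos unfolding h'_def by (simp add: abs_mult)
    moreover have "Bc (h t) = t * (1 - t) * (F t) ^ 4" using t by (intro Bc_h) auto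
    moreover define u where "u = 1 - t"
    ultimately show ?thesis using pos p unfolding h_def k_def u_def[symmetric] by (auto simp: field_simps eval_nat_numeral)
  qed
  have CV: "k p absolutely_integrable_on {0<..<1}" "integral {0<..<1} (k p) = (if p = 1 then pi / 2 else 14 * zeta3 / pi\<^sup>2)"
    if p: "p = 1 \<or> p = 2" for p
  proof -
    note m = lborel_integrable_imp_absolutely_integrable[OF Bc_mellin(1)[OF p]]
    have 1: "(\<lambda>x. pi * (x ^ p * Bc x)) absolutely_integrable_on h ` {0<..<1}"
      unfolding h_image using m(1) by (intro set_integrable_mult_right) auto
    have 2: "integral (h ` {0<..<1}) (\<lambda>x. pi * (x ^ p * Bc x)) = (if p = 1 then pi / 2 else 14 * zeta3 / pi\<^sup>2)"
    proof -
      have "integral (h ` {0<..<1}) (\<lambda>x. pi * (x ^ p * Bc x)) = pi * (if p = 1 then 1 / 2 else 14 * zeta3 / pi ^ 3)"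
        unfolding h_image integral_mult_right using m(2) Bc_mellin(2)[OF p] by auto
      also have "\<dots> = (if p = 1 then pi / 2 else 14 * zeta3 / pi\<^sup>2)" by (simp add: power2_eq_square power3_eq_cube)
      finally show ?thesis .
    qed
    show "k p absolutely_integrable_on {0<..<1}" "integral {0<..<1} (k p) = (if p = 1 then pi / 2 else 14 * zeta3 / pi\<^sup>2)"
      using change_of_variables_Ioo[OF dh h_inj eq[OF _ p] 1 2] by blast+
  qed
  have k: "k 1 = (\<lambda>t. F t * F (1 - t))" "k 2 = (\<lambda>t. (F (1 - t))\<^sup>2)" by (simp_all add: k_def fun_eq_iff)
  show "(\<lambda>t. F t * F (1 - t)) absolutely_integrable_on {0<..<1}" "integral {0<..<1} (\<lambda>t. F t * F (1 - t)) = pi / 2"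
    using CV[of 1] unfolding k by simp_all
  show "(\<lambda>t. (F (1 - t))\<^sup>2) absolutely_integrable_on {0<..<1}" "integral {0<..<1} (\<lambda>t. (F (1 - t))\<^sup>2) = 14 * zeta3 / pi\<^sup>2"
    using CV[of 2] unfolding k by simp_all
qed

lemma F_sq_integral: "(\<lambda>t. (F t)\<^sup>2) absolutely_integrable_on {0<..<1}" "integral {0<..<1} (\<lambda>t. (F t)\<^sup>2) = 14 * zeta3 / pi\<^sup>2"
proof -
  have "x \<in> (\<lambda>t. 1 - t) ` {0<..<1}" if "0 < x" "x < 1" for x :: real
    using that by (intro image_eqI[of _ _ "1 - x"]) auto
  then have im: "(\<lambda>t. 1 - t) ` {0<..<1::real} = {0<..<1}" by auto
  have d: "((\<lambda>t. 1 - t) has_field_derivative - 1) (at x)" for x :: real by (auto intro!: derivative_eq_intros)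
  have i: "inj_on (\<lambda>t. 1 - t) {0<..<1::real}" by (auto simp: inj_on_def)
  have eq: "\<bar>- 1\<bar> * (F (1 - (1 - x)))\<^sup>2 = (F x)\<^sup>2" for x :: real by simp
  have "(\<lambda>t. (F (1 - t))\<^sup>2) absolutely_integrable_on (\<lambda>t. 1 - t) ` {0<..<1}"
    "integral ((\<lambda>t. 1 - t) ` {0<..<1}) (\<lambda>t. (F (1 - t))\<^sup>2) = 14 * zeta3 / pi\<^sup>2"
    unfolding im by (rule F_products_integral)+
  from change_of_variables_Ioo[OF d i eq this]
  show "(\<lambda>t. (F t)\<^sup>2) absolutely_integrable_on {0<..<1}" "integral {0<..<1} (\<lambda>t. (F t)\<^sup>2) = 14 * zeta3 / pi\<^sup>2" .
qed

section \<open>Moments and Taylor coefficients\<close>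

definition gc :: "nat \<Rightarrow> real" where "gc n = fps_nth (Ffps * Ffps) n"

text \<open>The symmetric square. With u = p f' and u' = f / 4, applying p d/dx to products of f and
  u yields only f^2, f u and u^2 with polynomial coefficients, so three derivatives of f^2 close
  up.\<close>

lemma square_fps_ode:
  fixes f p :: "real fps"
  defines "p \<equiv> fps_X * (1 - fps_X)"
  assumes ode: "p * fps_deriv (fps_deriv f) + (1 - 2 * fps_X) * fps_deriv f = fps_const (1/4) * f"
  shows "fps_deriv (p * fps_deriv (p * fps_deriv (f * f))) = p * fps_deriv (f * f) + fps_const (1/2) * (1 - 2 * fps_X) * (f * f)"
proof -
  define c :: "real fps" where "c = fps_const (1/4)"
  have c2: "fps_const (1/2) = 2 * c" by (simp add: c_def fps_numeral_fps_const)
  have c8: "8 * c = 2" by (simp add: c_def fps_numeral_fps_const)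
  have Dc: "fps_deriv c = 0" by (simp add: c_def)
  define p1 :: "real fps" where "p1 = 1 - 2 * fps_X"
  have Dp: "fps_deriv p = p1" by (simp add: p_def p1_def algebra_simps)
  define f1 where "f1 = fps_deriv f"
  define u where "u = p * f1"
  have Du: "fps_deriv u = c * f"
    using ode unfolding u_def f1_def[symmetric] p1_def[symmetric] c_def[symmetric] by (simp add: Dp algebra_simps)
  have 1: "p * fps_deriv (f * f) = 2 * f * u" by (simp add: u_def f1_def[symmetric] algebra_simps)
  have D2: "fps_deriv (2 * x) = 2 * fps_deriv x" for x :: "real fps" by (simp add: fps_numeral_fps_const)
  have 2: "p * fps_deriv (2 * (f * u)) = 2 * (u * u) + 2 * (c * (p * (f * f)))"
  proof -
    have "fps_deriv (f * u) = f1 * u + f * (c * f)" by (simp add: Du f1_def)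
    then have "p * fps_deriv (2 * (f * u)) = 2 * ((p * f1) * u) + 2 * (c * (p * (f * f)))" unfolding D2 by (simp add: algebra_simps)
    then show ?thesis by (simp only: u_def)
  qed
  have 3: "fps_deriv (2 * (u * u) + 2 * (c * (p * (f * f)))) = 8 * c * (f * u) + 2 * c * p1 * (f * f)"
  proof -
    have "fps_deriv (u * u) = 2 * (c * (f * u))" by (simp add: Du algebra_simps)
    moreover have "fps_deriv (c * (p * (f * f))) = c * (p1 * (f * f)) + 2 * (c * (f * (p * f1)))"
      by (simp add: Dc Dp f1_def[symmetric] algebra_simps)
    ultimately show ?thesis unfolding fps_deriv_add D2 u_def[symmetric] by (simp add: algebra_simps)
  qed
  show ?thesis unfolding 1 unfolding c2 p1_def[symmetric] using 2 3 unfolding c8 by (simp only: mult.assoc)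
qed

lemma gc_rec:
  "real (Suc (Suc m)) ^ 3 * gc (Suc (Suc m)) = (2 * real (Suc m) + 1) * (real (Suc m) ^ 2 + real (Suc m) + 1 / 2) * gc (Suc m) - real (Suc m) ^ 3 * gc m"
proof -
  define p :: "real fps" where "p = fps_X * (1 - fps_X)"
  define G where "G = Ffps * Ffps"
  have g: "gc n = fps_nth G n" for n by (simp add: gc_def G_def)
  have ps: "fps_nth (p * g) (Suc n) = fps_nth g n - (if n = 0 then 0 else fps_nth g (n - 1))" for g n
  proof -
    have "p * g = fps_X * g - fps_X * (fps_X * g)" by (simp add: p_def algebra_simps)
    then show ?thesis by simp
  qed
  have pn: "fps_nth p 0 = 0" "fps_nth p (Suc 0) = 1" by (simp_all add: p_def)
  have ode: "fps_deriv (p * fps_deriv (p * fps_deriv G)) = p * fps_deriv G + fps_const (1/2) * (1 - 2 * fps_X) * G"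
    unfolding G_def p_def using Ffps_ode by (intro square_fps_ode) simp
  have r: "fps_nth (fps_const (1/2) * (1 - 2 * fps_X) * G) (Suc m) = gc (Suc m) / 2 - gc m"
  proof -
    have "fps_const (1/2) * (1 - 2 * fps_X) * G = fps_const (1/2) * G - fps_X * G"
    proof -
      have "fps_const (1/2 :: real) * (2 * fps_X) = fps_X" by (simp add: fps_numeral_fps_const mult.assoc[symmetric])
      then show ?thesis by (simp only: right_diff_distrib left_diff_distrib mult_1_right)
    qed
    then show ?thesis by (simp add: g)
  qed
  from arg_cong[OF ode, of "\<lambda>f. fps_nth f (Suc m)", unfolded fps_add_nth r]
  have "real (Suc (Suc m)) * (real (Suc (Suc m)) * (real (Suc (Suc m)) * gc (Suc (Suc m)) - real (Suc m) * gc (Suc m)) - real (Suc m) * (real (Suc m) * gc (Suc m) - real m * gc m))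
     = real (Suc m) * gc (Suc m) - real m * gc m + (gc (Suc m) / 2 - gc m)"
    by (cases m) (simp_all add: ps g pn del: of_nat_Suc fps_deriv_mult fps_mult_nth_0 fps_mult_nth_1 fps_mult_nth_1')
  then show ?thesis by (simp add: algebra_simps eval_nat_numeral)
qed

lemma gc_0: "gc 0 = 1" and gc_1: "gc 1 = 1 / 2"
  by (simp_all add: gc_def fps_mult_nth Ffps_def hcoef_0 hcoef_Suc power2_eq_square)

lemma gc_nonneg: "gc n \<ge> 0"
  unfolding gc_def fps_mult_nth by (intro sum_nonneg mult_nonneg_nonneg) (auto simp: Ffps_def intro: less_imp_le[OF hcoef_pos])

lemma gc_sums:
  assumes "0 \<le> t" "t < (1::real)" shows "(\<lambda>n. gc n * t ^ n) sums (F t)\<^sup>2"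
proof -
  have s: "(\<lambda>n. hcoef n * t ^ n) sums F t" using F_sums[of t] assms by simp
  have sm: "summable (\<lambda>n. norm (hcoef n * t ^ n))"
    using s assms less_imp_le[OF hcoef_pos] by (simp add: sums_iff abs_mult)
  have "(\<lambda>n. \<Sum>i\<le>n. (hcoef i * t ^ i) * (hcoef (n - i) * t ^ (n - i))) sums (F t * F t)"
    using Cauchy_product_sums[OF sm sm] s by (simp add: sums_iff)
  moreover have "(\<Sum>i\<le>n. (hcoef i * t ^ i) * (hcoef (n - i) * t ^ (n - i))) = gc n * t ^ n" for n
  proof -
    have "(\<Sum>i\<le>n. (hcoef i * t ^ i) * (hcoef (n - i) * t ^ (n - i))) = (\<Sum>i\<le>n. hcoef i * hcoef (n - i) * t ^ n)"
      by (intro sum.cong refl) (simp add: mult_ac power_add[symmetric])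
    then show ?thesis by (simp add: gc_def fps_mult_nth Ffps_def sum_distrib_right atLeast0AtMost)
  qed
  ultimately show ?thesis by (simp add: power2_eq_square)
qed

section \<open>Moments of the product of the two solutions\<close>

definition mF :: "nat \<Rightarrow> real" where "mF n = integral {0<..<1} (\<lambda>t. t ^ n * (F t * F (1 - t)))"

lemma mF_integrable: "(\<lambda>t. t ^ n * (F t * F (1 - t))) absolutely_integrable_on {0<..<1}"
proof (rule absolutely_integrable_bounded_measurable_product_real[OF _ _ _ F_products_integral(1)])
  show "(\<lambda>t::real. t ^ n) \<in> borel_measurable (lebesgue_on {0<..<1})"
    by (intro continuous_imp_measurable_on_sets_lebesgue continuous_intros) auto
  show "bounded ((\<lambda>t::real. t ^ n) ` {0<..<1})"
    unfolding bounded_iff by (intro exI[of _ 1]) (auto intro!: power_le_one)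
qed auto

lemma mF_has_integral: "((\<lambda>t. t ^ n * (F t * F (1 - t))) has_integral mF n) {0..1}"
proof -
  have "(\<lambda>t. t ^ n * (F t * F (1 - t))) integrable_on {0<..<1}"
    using mF_integrable[of n] by (rule set_lebesgue_integral_eq_integral(1))
  then have "((\<lambda>t. t ^ n * (F t * F (1 - t))) has_integral mF n) {0<..<1}" by (simp add: mF_def has_integral_integral)
  then show ?thesis by (simp add: has_integral_Icc_iff_Ioo)
qed

text \<open>With p = t (1 - t), these are the quasi-derivatives p y' of \<open>F t\<close> and of
  \<open>F (1 - t)\<close>. For their product w, \<open>af\<close> is p w', while \<open>Xf\<close>,
  \<open>Zf\<close>, \<open>Yf\<close> are p w, p (p w') and the product of the quasi-derivatives;
  \<open>xyz_deriv\<close> is the resulting first-order system.\<close>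

definition Uf :: "real \<Rightarrow> real" where "Uf t = t * (1 - t) * dF t"
definition Vf :: "real \<Rightarrow> real" where "Vf t = - (t * (1 - t) * dF (1 - t))"
definition Xf :: "real \<Rightarrow> real" where "Xf t = t * (1 - t) * (F t * F (1 - t))"
definition af :: "real \<Rightarrow> real" where "af t = Uf t * F (1 - t) + F t * Vf t"
definition Zf :: "real \<Rightarrow> real" where "Zf t = t * (1 - t) * af t"
definition Yf :: "real \<Rightarrow> real" where "Yf t = Uf t * Vf t"

lemma xyz_deriv:
  assumes t: "0 < t" "t < 1"
  shows "(Xf has_field_derivative (1 - 2 * t) * (F t * F (1 - t)) + af t) (at t)"
    and "(Yf has_field_derivative af t / 4) (at t)"
    and "(Zf has_field_derivative (1 - 2 * t) * af t + Xf t / 2 + 2 * Yf t) (at t)"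
proof -
  have dFt: "(F has_field_derivative dF t) (at t)" using t by (intro F_deriv) auto
  have dF1: "((\<lambda>t. F (1 - t)) has_field_derivative - dF (1 - t)) (at t)" using t by (intro F_deriv_at_1_minus) auto
  have dU: "(Uf has_field_derivative F t / 4) (at t)" unfolding Uf_def using t by (intro pdF_deriv) auto
  have dV: "(Vf has_field_derivative F (1 - t) / 4) (at t)"
  proof -
    have "((\<lambda>t. t * (1 - t) * dF (1 - t)) has_field_derivative - F (1 - t) / 4) (at t)" using t by (intro pdF_deriv_at_1_minus) auto
    from DERIV_minus[OF this] show ?thesis unfolding Vf_def by simp
  qed
  define a b a' b' where "a = F t" "b = F (1 - t)" "a' = dF t" "b' = dF (1 - t)"
  show "(Xf has_field_derivative (1 - 2 * t) * (F t * F (1 - t)) + af t) (at t)"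
    unfolding Xf_def[abs_def]
    apply (rule DERIV_cong[OF DERIV_mult[OF DERIV_mult[OF DERIV_ident DERIV_diff[OF DERIV_const DERIV_ident]] DERIV_mult[OF dFt dF1]]])
    unfolding af_def Uf_def Vf_def a_b_a'_b'_def[symmetric] by (simp add: algebra_simps)
  show "(Yf has_field_derivative af t / 4) (at t)"
    unfolding Yf_def[abs_def]
    apply (rule DERIV_cong[OF DERIV_mult[OF dU dV]])
    unfolding af_def by (simp add: algebra_simps)
  have da: "(af has_field_derivative (F t / 4 * F (1 - t) + - dF (1 - t) * Uf t + (dF t * Vf t + F (1 - t) / 4 * F t))) (at t)"
    unfolding af_def[abs_def] by (intro DERIV_add DERIV_mult dU dF1 dFt dV)
  show "(Zf has_field_derivative (1 - 2 * t) * af t + Xf t / 2 + 2 * Yf t) (at t)"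
    unfolding Zf_def[abs_def]
    apply (rule DERIV_cong[OF DERIV_mult[OF DERIV_mult[OF DERIV_ident DERIV_diff[OF DERIV_const DERIV_ident]] da]])
    unfolding Xf_def Yf_def af_def Uf_def Vf_def a_b_a'_b'_def[symmetric] by (simp add: algebra_simps)
qed

lemma U_bounds: "0 < t \<Longrightarrow> t < 1 \<Longrightarrow> 0 \<le> Uf t \<and> Uf t \<le> t"
  using dF_upper[of t] dF_nonneg[of t] unfolding Uf_def by (simp add: mult.assoc mult_left_le)

lemma V_bounds: "0 < t \<Longrightarrow> t < 1 \<Longrightarrow> \<bar>Vf t\<bar> \<le> 1 - t"
proof -
  assume t: "0 < t" "t < 1"
  have "Vf t = - Uf (1 - t)" by (simp add: Vf_def Uf_def mult_ac)
  then show ?thesis using U_bounds[of "1 - t"] t by simp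
qed

lemma xyz_bounds:
  assumes t: "0 < t" "t < 1"
  defines "b \<equiv> t * (1 - t) * (1 - ln t / pi) * (1 - ln (1 - t) / pi)"
  shows "\<bar>Xf t\<bar> \<le> b" "\<bar>Yf t\<bar> \<le> t * (1 - t)"
    "\<bar>Zf t\<bar> \<le> t * (1 - t) * ((1 - ln t / pi) + (1 - ln (1 - t) / pi))"
proof -
  have f: "0 \<le> F t" "F t \<le> 1 - ln (1 - t) / pi" "0 \<le> F (1 - t)" "F (1 - t) \<le> 1 - ln t / pi"
    using t F_upper[of t] F_upper[of "1 - t"] F_pos[of t] F_pos[of "1 - t"] by auto
  have l: "ln t \<le> pi" "ln (1 - t) \<le> pi" using t ln_le_zero_iff[of t] ln_le_zero_iff[of "1 - t"] pi_gt_zero by linarith+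
  have uv: "\<bar>Uf t\<bar> \<le> t" "\<bar>Vf t\<bar> \<le> 1 - t" using U_bounds[OF t] V_bounds[OF t] by auto
  have "F t * F (1 - t) \<le> (1 - ln (1 - t) / pi) * (1 - ln t / pi)" using f l by (intro mult_mono) auto
  from mult_left_mono[OF this, of "t * (1 - t)"] show "\<bar>Xf t\<bar> \<le> b"
    using t f unfolding Xf_def b_def by (simp add: abs_mult mult_ac)
  show "\<bar>Yf t\<bar> \<le> t * (1 - t)" unfolding Yf_def abs_mult using uv t by (intro mult_mono) auto
  have "\<bar>Uf t * F (1 - t)\<bar> \<le> 1 * (1 - ln t / pi)" unfolding abs_mult using uv t f l by (intro mult_mono) auto
  moreover have "\<bar>F t * Vf t\<bar> \<le> (1 - ln (1 - t) / pi) * 1" unfolding abs_mult using uv t f l by (intro mult_mono) auto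
  ultimately have "\<bar>af t\<bar> \<le> 1 * (1 - ln t / pi) + (1 - ln (1 - t) / pi) * 1"
    unfolding af_def by (intro order_trans[OF abs_triangle_ineq add_mono])
  then have "\<bar>af t\<bar> \<le> (1 - ln t / pi) + (1 - ln (1 - t) / pi)" by (simp only: mult_1_left mult_1_right)
  from mult_left_mono[OF this, of "t * (1 - t)"] show "\<bar>Zf t\<bar> \<le> t * (1 - t) * ((1 - ln t / pi) + (1 - ln (1 - t) / pi))"
    using t unfolding Zf_def by (simp add: abs_mult)
qed

lemma xyz_lim:
  shows "(Xf \<longlongrightarrow> 0) (at_right 0)" "(Xf \<longlongrightarrow> 0) (at_left 1)" "(Yf \<longlongrightarrow> 0) (at_right 0)" "(Yf \<longlongrightarrow> 0) (at_left 1)"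
    "(Zf \<longlongrightarrow> 0) (at_right 0)" "(Zf \<longlongrightarrow> 0) (at_left 1)"
proof -
  have ev: "eventually (\<lambda>t::real. 0 < t \<and> t < 1) (at_right 0)" "eventually (\<lambda>t::real. 0 < t \<and> t < 1) (at_left 1)"
    unfolding eventually_at_right_field eventually_at_left_field by (auto intro: exI[of _ 1] exI[of _ 0])
  have x: "((\<lambda>t::real. t * (1 - t) * (1 - ln t / pi) * (1 - ln (1 - t) / pi)) \<longlongrightarrow> 0) (at_right 0)"
    "((\<lambda>t::real. t * (1 - t) * (1 - ln t / pi) * (1 - ln (1 - t) / pi)) \<longlongrightarrow> 0) (at_left 1)"
    by real_asymp+
  have y: "((\<lambda>t::real. t * (1 - t)) \<longlongrightarrow> 0) (at_right 0)" "((\<lambda>t::real. t * (1 - t)) \<longlongrightarrow> 0) (at_left 1)"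
    by real_asymp+
  have z: "((\<lambda>t::real. t * (1 - t) * ((1 - ln t / pi) + (1 - ln (1 - t) / pi))) \<longlongrightarrow> 0) (at_right 0)"
    "((\<lambda>t::real. t * (1 - t) * ((1 - ln t / pi) + (1 - ln (1 - t) / pi))) \<longlongrightarrow> 0) (at_left 1)"
    by real_asymp+
  show "(Xf \<longlongrightarrow> 0) (at_right 0)" "(Xf \<longlongrightarrow> 0) (at_left 1)"
    by (rule Lim_null_comparison[OF _ x(1)], use ev(1) in eventually_elim, use xyz_bounds in simp)
       (rule Lim_null_comparison[OF _ x(2)], use ev(2) in eventually_elim, use xyz_bounds in simp)
  show "(Yf \<longlongrightarrow> 0) (at_right 0)" "(Yf \<longlongrightarrow> 0) (at_left 1)"
    by (rule Lim_null_comparison[OF _ y(1)], use ev(1) in eventually_elim, use xyz_bounds in simp)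
       (rule Lim_null_comparison[OF _ y(2)], use ev(2) in eventually_elim, use xyz_bounds in simp)
  show "(Zf \<longlongrightarrow> 0) (at_right 0)" "(Zf \<longlongrightarrow> 0) (at_left 1)"
    by (rule Lim_null_comparison[OF _ z(1)], use ev(1) in eventually_elim, use xyz_bounds in simp)
       (rule Lim_null_comparison[OF _ z(2)], use ev(2) in eventually_elim, use xyz_bounds in simp)
qed

text \<open>At the endpoints \<open>F t\<close> or \<open>F (1 - t)\<close> is a divergent series
  without a meaningful value, so H is replaced there by its limit 0 before the fundamental theorem
  is applied.\<close>

lemma FTC_vanishing:
  fixes H H' :: "real \<Rightarrow> real"
  assumes der: "\<And>t. 0 < t \<Longrightarrow> t < 1 \<Longrightarrow> (H has_field_derivative H' t) (at t)"
    and lim: "(H \<longlongrightarrow> 0) (at_right 0)" "(H \<longlongrightarrow> 0) (at_left 1)"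
  shows "(H' has_integral 0) {0..1}"
proof -
  define H0 where "H0 = (\<lambda>t. if 0 < t \<and> t < 1 then H t else 0)"
  have "continuous_on {0..1} H0"
  proof (rule continuous_on_IccI)
    have "eventually (\<lambda>t::real. 0 < t \<and> t < 1) (at_right 0)" "eventually (\<lambda>t::real. 0 < t \<and> t < 1) (at_left 1)"
      unfolding eventually_at_right_field eventually_at_left_field by (auto intro: exI[of _ 1] exI[of _ 0])
    then have "eventually (\<lambda>t. H0 t = H t) (at_right 0)" "eventually (\<lambda>t. H0 t = H t) (at_left 1)"
      by (simp_all add: H0_def eventually_mono)
    then have "(H0 \<longlongrightarrow> 0) (at_right 0)" "(H0 \<longlongrightarrow> 0) (at_left 1)"
      using lim by (simp_all only: tendsto_cong)
    then show "(H0 \<longlongrightarrow> H0 0) (at_right 0)" "(H0 \<longlongrightarrow> H0 1) (at_left 1)" by (simp_all add: H0_def)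
    show "H0 \<midarrow>x\<rightarrow> H0 x" if x: "0 < x" "x < 1" for x
    proof -
      have "eventually (\<lambda>t. t \<in> {0<..<1}) (at x)" using x by (intro eventually_at_in_open') auto
      then have "eventually (\<lambda>t. H0 t = H t) (at x)" by eventually_elim (simp add: H0_def)
      moreover have "H \<midarrow>x\<rightarrow> H x" using DERIV_isCont[OF der[OF x]] by (simp add: isCont_def)
      ultimately have "H0 \<midarrow>x\<rightarrow> H x" by (simp only: tendsto_cong)
      then show ?thesis using x by (simp add: H0_def)
    qed
  qed simp
  moreover have "(H0 has_vector_derivative H' x) (at x)" if x: "x \<in> {0<..<1}" for x
  proof -
    have "(H has_field_derivative H' x) (at x)" using der x by simp
    then have "(H0 has_field_derivative H' x) (at x)"
      by (rule DERIV_cong_ev[THEN iffD1, rotated 3])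
         (use x eventually_nhds_in_open[of "{0<..<1}" x] in \<open>auto simp: H0_def elim!: eventually_mono\<close>)
    then show ?thesis by (simp add: has_real_derivative_iff_has_vector_derivative)
  qed
  ultimately have "(H' has_integral H0 1 - H0 0) {0..1}" by (intro fundamental_theorem_of_calculus_interior) auto
  then show ?thesis by (simp add: H0_def)
qed

text \<open>The second initial value for the three-term recurrence: (t - 1/2) w is the derivative of
  2 Yf - Xf / 2, which vanishes at both ends.\<close>

lemma mF_1: "mF 1 = mF 0 / 2"
proof -
  have "((\<lambda>t. t ^ 1 * (F t * F (1 - t)) - 1 / 2 * (t ^ 0 * (F t * F (1 - t)))) has_integral 0) {0..1}"
  proof (rule FTC_vanishing)
    fix t :: real assume t: "0 < t" "t < 1"
    show "((\<lambda>t. - (Xf t / 2) + 2 * Yf t) has_field_derivative t ^ 1 * (F t * F (1 - t)) - 1 / 2 * (t ^ 0 * (F t * F (1 - t)))) (at t)"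
      using xyz_deriv[OF t] by (auto intro!: derivative_eq_intros simp: field_simps)
  next
    have "((\<lambda>t. - (Xf t / 2) + 2 * Yf t) \<longlongrightarrow> - (0 / 2) + 2 * 0) (at_right 0)" by (intro tendsto_intros xyz_lim) auto
    then show "((\<lambda>t. - (Xf t / 2) + 2 * Yf t) \<longlongrightarrow> 0) (at_right 0)" by simp
    have "((\<lambda>t. - (Xf t / 2) + 2 * Yf t) \<longlongrightarrow> - (0 / 2) + 2 * 0) (at_left 1)" by (intro tendsto_intros xyz_lim) auto
    then show "((\<lambda>t. - (Xf t / 2) + 2 * Yf t) \<longlongrightarrow> 0) (at_left 1)" by simp
  qed
  moreover have "((\<lambda>t. t ^ 1 * (F t * F (1 - t)) - 1 / 2 * (t ^ 0 * (F t * F (1 - t)))) has_integral (mF 1 - 1 / 2 * mF 0)) {0..1}"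
    by (intro has_integral_diff has_integral_mult_right mF_has_integral)
  ultimately have "mF 1 - 1 / 2 * mF 0 = 0" using has_integral_unique by blast
  then show ?thesis by simp
qed

text \<open>The pointwise algebra of \<open>mF_rec\<close>, with t^m, w, p w' and \<open>Yf\<close>
  as independent unknowns. The derivative of t^m is already gone, as t times it equals (N - 1)
  t^m.\<close>

lemma moment_identity: fixes N t T w a Y :: real
  shows "((1 * T + (N - 1) * T) * (t * (1 - t) * w / 2 + 2 * Y) + (((1 - 2 * t) * w + a) / 2 + 2 * (a / 4)) * (t * T)
        - N * ((N - 1) * T * ((1 - t) * a) + ((1 - 2 * t) * a + t * (1 - t) * w / 2 + 2 * Y) * T)
        - ((N - 1) * T * (((N\<^sup>2 + N + 1) * t - N\<^sup>2) * ((1 - t) * w)) + (((N\<^sup>2 + N + 1) * 1 - 0) * (t * (1 - t) * w) + ((1 - 2 * t) * w + a) * ((N\<^sup>2 + N + 1) * t - N\<^sup>2)) * T)) =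
   N ^ 3 * (T * w) - (2 * N + 1) * (N\<^sup>2 + N + 1 / 2) * (t * T * w) + (N + 1) ^ 3 * (t * (t * T) * w)" (is "?lhs = ?rhs")
proof -
  have 1: "(((1 - 2 * t) * w + a) / 2 + 2 * (a / 4)) = (1 - 2 * t) * (w / 2) + a" by (simp add: field_simps)
  have 2: "t * (1 - t) * w / 2 = t * (1 - t) * (w / 2)" by simp
  define v where "v = w / 2"
  have w: "w = 2 * v" by (simp add: v_def)
  have h: "(2 * N + 1) * (N\<^sup>2 + N + 1 / 2) * (t * T * (2 * v)) = (2 * N + 1) * (2 * N\<^sup>2 + 2 * N + 1) * (t * T * v)" by (simp add: field_simps)
  show ?thesis unfolding 1 2 v_def[symmetric] unfolding w h
    by (simp add: algebra_simps power2_eq_square power3_eq_cube)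
qed

text \<open>The operator of \<open>square_fps_ode\<close> is anti-self-adjoint and sends t^N to N^3
  t^(N-1) - (2N + 1)(N^2 + N + 1/2) t^N + (N + 1)^3 t^(N+1). The outer coefficients are one cubic at
  N and at N + 1, so integrating this against w yields the same recurrence as collecting powers does
  in \<open>gc_rec\<close>.\<close>

lemma mF_rec:
  fixes m :: nat
  defines "N \<equiv> real (Suc m)"
  shows "N ^ 3 * mF m - (2 * N + 1) * (N\<^sup>2 + N + 1 / 2) * mF (Suc m) + (N + 1) ^ 3 * mF (Suc (Suc m)) = 0"
proof -
  define K where "K = N\<^sup>2 + N + 1"
  \<comment> \<open>\<open>H\<close> is what repeated integration by parts of the third order equation leaves behind.\<close>
  define H where "H = (\<lambda>t. t * t ^ m * (Xf t / 2 + 2 * Yf t) - N * (t ^ m * Zf t) - t ^ m * ((K * t - N\<^sup>2) * Xf t))"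
  define H' where "H' = (\<lambda>t. N ^ 3 * (t ^ m * (F t * F (1 - t))) - (2 * N + 1) * (N\<^sup>2 + N + 1 / 2) * (t ^ Suc m * (F t * F (1 - t))) + (N + 1) ^ 3 * (t ^ Suc (Suc m) * (F t * F (1 - t))))"
  have "(H' has_integral 0) {0..1}"
  proof (rule FTC_vanishing)
    fix t :: real assume t: "0 < t" "t < 1"
    define e where "e = real m * t ^ (m - 1)"
    have et: "e * t = (N - 1) * t ^ m" unfolding e_def N_def by (cases m) auto
    have dT: "((\<lambda>t. t ^ m) has_field_derivative e) (at t)" unfolding e_def by (auto intro!: derivative_eq_intros)
    define w where "w = F t * F (1 - t)"
    define a where "a = af t"
    define T where "T = t ^ m"
    define Y where "Y = Yf t"
    have X: "Xf t = t * (1 - t) * w" by (simp add: Xf_def w_def)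
    have Z: "Zf t = t * (1 - t) * a" by (simp add: Zf_def a_def)
    note d = xyz_deriv[OF t, folded w_def a_def Y_def]
    have "(H has_field_derivative ((1 * T + e * t) * (Xf t / 2 + 2 * Y) + (((1 - 2 * t) * w + a) / 2 + 2 * (a / 4)) * (t * T)
        - N * (e * Zf t + ((1 - 2 * t) * a + Xf t / 2 + 2 * Y) * T)
        - (e * ((K * t - N\<^sup>2) * Xf t) + ((K * 1 - 0) * Xf t + ((1 - 2 * t) * w + a) * (K * t - N\<^sup>2)) * T))) (at t)"
      unfolding H_def T_def Y_def
      by (intro DERIV_diff DERIV_add DERIV_mult DERIV_cmult DERIV_cdivide DERIV_ident DERIV_const dT d[unfolded Y_def])
    moreover have "((1 * T + e * t) * (Xf t / 2 + 2 * Y) + (((1 - 2 * t) * w + a) / 2 + 2 * (a / 4)) * (t * T)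
        - N * (e * Zf t + ((1 - 2 * t) * a + Xf t / 2 + 2 * Y) * T)
        - (e * ((K * t - N\<^sup>2) * Xf t) + ((K * 1 - 0) * Xf t + ((1 - 2 * t) * w + a) * (K * t - N\<^sup>2)) * T)) = H' t"
    proof -
      have eX: "e * ((K * t - N\<^sup>2) * Xf t) = (N - 1) * T * ((K * t - N\<^sup>2) * ((1 - t) * w))"
        unfolding X T_def et[symmetric] by (simp add: mult_ac)
      have eZ: "e * Zf t = (N - 1) * T * ((1 - t) * a)"
        unfolding Z T_def et[symmetric] by (simp add: mult_ac)
      have H't: "H' t = N ^ 3 * (T * w) - (2 * N + 1) * (N\<^sup>2 + N + 1 / 2) * (t * T * w) + (N + 1) ^ 3 * (t * (t * T) * w)"
        by (simp add: H'_def T_def w_def mult.assoc)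
      show ?thesis unfolding H't eX eZ unfolding et T_def[symmetric] X K_def by (rule moment_identity)
    qed
    ultimately show "(H has_field_derivative H' t) (at t)" by simp
  next
    have p: "((\<lambda>t. t ^ m) \<longlongrightarrow> 0 ^ m) (at_right (0::real))" "((\<lambda>t. t ^ m) \<longlongrightarrow> 1 ^ m) (at_left (1::real))"
      by (intro tendsto_intros)+
    have "(H \<longlongrightarrow> 0 * 0 ^ m * (0 / 2 + 2 * 0) - N * (0 ^ m * 0) - 0 ^ m * ((K * 0 - N\<^sup>2) * 0)) (at_right 0)"
      unfolding H_def by (intro tendsto_intros xyz_lim p) auto
    then show "(H \<longlongrightarrow> 0) (at_right 0)" by simp
    have "(H \<longlongrightarrow> 1 * 1 ^ m * (0 / 2 + 2 * 0) - N * (1 ^ m * 0) - 1 ^ m * ((K * 1 - N\<^sup>2) * 0)) (at_left 1)"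
      unfolding H_def by (intro tendsto_intros xyz_lim p) auto
    then show "(H \<longlongrightarrow> 0) (at_left 1)" by simp
  qed
  moreover have "(H' has_integral (N ^ 3 * mF m - (2 * N + 1) * (N\<^sup>2 + N + 1 / 2) * mF (Suc m) + (N + 1) ^ 3 * mF (Suc (Suc m)))) {0..1}"
    unfolding H'_def by (intro has_integral_diff has_integral_add has_integral_mult_right mF_has_integral)
  ultimately show ?thesis using has_integral_unique by blast
qed

lemma mF_gc: "mF n = pi / 2 * gc n"
proof -
  have "mF n = pi / 2 * gc n \<and> mF (Suc n) = pi / 2 * gc (Suc n)"
  proof (induction n)
    case 0
    have "mF 0 = pi / 2" using F_products_integral(2) by (simp add: mF_def)
    with mF_1 have "mF (Suc 0) = pi / 2 / 2" by simp
    moreover have "gc (Suc 0) = 1 / 2" using gc_1 by simp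
    ultimately have "mF (Suc 0) = pi / 2 * gc (Suc 0)" by (simp only:)
    with \<open>mF 0 = pi / 2\<close> gc_0 show ?case by simp
  next
    case (Suc n)
    define N where "N = real (Suc n)"
    have N: "real (Suc (Suc n)) = N + 1" by (simp add: N_def)
    have "(N + 1) ^ 3 * mF (Suc (Suc n)) = (2 * N + 1) * (N\<^sup>2 + N + 1 / 2) * mF (Suc n) - N ^ 3 * mF n"
      using mF_rec[of n] unfolding N_def by linarith
    also have "\<dots> = pi / 2 * ((2 * N + 1) * (N\<^sup>2 + N + 1 / 2) * gc (Suc n) - N ^ 3 * gc n)"
    proof -
      from Suc have "mF n = pi / 2 * gc n" "mF (Suc n) = pi / 2 * gc (Suc n)" by auto
      then show ?thesis by (simp only:) (simp add: algebra_simps)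
    qed
    also have "\<dots> = pi / 2 * ((N + 1) ^ 3 * gc (Suc (Suc n)))" using gc_rec[of n] unfolding N_def[symmetric] N by simp
    finally have "(N + 1) ^ 3 * mF (Suc (Suc n)) = (N + 1) ^ 3 * (pi / 2 * gc (Suc (Suc n)))" by simp
    moreover have "(N + 1) ^ 3 \<noteq> 0" by (simp add: N_def)
    ultimately show ?case using Suc by simp
  qed
  then show ?thesis ..
qed

section \<open>Pairing with the logarithm\<close>

lemma absolutely_integrable_imp_nn_integral:
  fixes f :: "real \<Rightarrow> real"
  assumes f: "f absolutely_integrable_on S" and nn: "\<And>x. x \<in> S \<Longrightarrow> f x \<ge> 0"
    and m: "(\<lambda>x. indicator S x * f x) \<in> borel_measurable borel" and S: "S \<in> sets borel"
  shows "(\<integral>\<^sup>+x. ennreal (indicator S x * f x) \<partial>lborel) = ennreal (integral S f)"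
proof -
  have i: "integrable lborel (\<lambda>x. indicator S x * f x)"
    using f m integrable_completion[of "\<lambda>x. indicator S x * f x" lborel] by (simp add: set_integrable_def)
  then have "(\<integral>\<^sup>+x. ennreal (indicator S x * f x) \<partial>lborel) = ennreal (\<integral>x. indicator S x * f x \<partial>lborel)"
    by (intro nn_integral_eq_integral) (auto simp: indicator_def nn)
  then show ?thesis using lborel_integrable_imp_absolutely_integrable(2)[OF i S] by simp
qed

lemma F_measurable_Ioo:
  "(\<lambda>t. indicator {0<..<1} t * F t) \<in> borel_measurable borel" "(\<lambda>t. indicator {0<..<1} t * F (1 - t)) \<in> borel_measurable borel"
proof -
  have c: "continuous_on {0<..<1} F"
  proof (rule DERIV_continuous_on)
    show "(F has_field_derivative dF x) (at x within {0<..<1})" if "x \<in> {0<..<1}" for x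
      using F_deriv[of x] that by (auto intro: has_field_derivative_at_within)
  qed
  have "continuous_on {0<..<1} (\<lambda>t. F (1 - t))"
    by (rule continuous_on_compose2[OF c]) (auto intro!: continuous_intros)
  with c show "(\<lambda>t. indicator {0<..<1} t * F t) \<in> borel_measurable borel" "(\<lambda>t. indicator {0<..<1} t * F (1 - t)) \<in> borel_measurable borel"
    using borel_measurable_continuous_on_indicator[of "{0<..<1}" F] borel_measurable_continuous_on_indicator[of "{0<..<1}" "\<lambda>t. F (1 - t)"]
    by simp_all
qed

text \<open>Both sides are the integral of F^2: on the left by integrating its Taylor series
  termwise, on the right by \<open>F_sq_integral\<close>.\<close>

lemma gc_weighted_sum: "(\<Sum>n. ennreal (gc n / real (Suc n))) = ennreal (14 * zeta3 / pi\<^sup>2)"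
proof -
  have m: "(\<lambda>t. indicator {0<..<1} t * (F t)\<^sup>2) \<in> borel_measurable borel"
  proof -
    have "(\<lambda>t. (indicator {0<..<1} t * F t)\<^sup>2) \<in> borel_measurable borel"
      by (intro borel_measurable_power F_measurable_Ioo)
    moreover have "(indicator {0<..<1} t * F t)\<^sup>2 = indicator {0<..<1} t * (F t)\<^sup>2" for t by (simp add: indicator_def)
    ultimately show ?thesis by simp
  qed
  have pw: "(\<integral>\<^sup>+t. ennreal (indicator {0<..<1} t * (gc n * t ^ n)) \<partial>lborel) = ennreal (gc n / real (Suc n))" for n
  proof -
    have "(\<integral>\<^sup>+t. ennreal (indicator {0<..<1} t * (gc n * t ^ n)) \<partial>lborel) = (\<integral>\<^sup>+t. ennreal (gc n * t ^ n) * indicator {0..1} t \<partial>lborel)"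
    proof (rule nn_integral_cong_AE)
      show "AE t in lborel. ennreal (indicator {0<..<1} t * (gc n * t ^ n)) = ennreal (gc n * t ^ n) * indicator {0..1} t"
        using AE_lborel_singleton[of "0 :: real"] AE_lborel_singleton[of "1 :: real"]
        by eventually_elim (auto simp: indicator_def)
    qed
    also have "\<dots> = ennreal (gc n * 1 ^ Suc n / real (Suc n) - gc n * 0 ^ Suc n / real (Suc n))"
    proof (rule nn_integral_FTC_Icc)
      show "((\<lambda>t. gc n * t ^ Suc n / real (Suc n)) has_real_derivative gc n * x ^ n) (at x)" for x :: real
        by (rule DERIV_cong[OF DERIV_cdivide[OF DERIV_cmult[OF DERIV_pow]]]) (simp del: of_nat_Suc)
      show "0 \<le> gc n * x ^ n" if "x \<in> {0..1}" for x :: real using that gc_nonneg by simp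
    qed auto
    finally show ?thesis by simp
  qed
  have "ennreal (14 * zeta3 / pi\<^sup>2) = (\<integral>\<^sup>+t. ennreal (indicator {0<..<1} t * (F t)\<^sup>2) \<partial>lborel)"
    using absolutely_integrable_imp_nn_integral[OF F_sq_integral(1) _ m] F_sq_integral(2) by simp
  also have "\<dots> = (\<integral>\<^sup>+t. (\<Sum>n. ennreal (indicator {0<..<1} t * (gc n * t ^ n))) \<partial>lborel)"
  proof (intro nn_integral_cong)
    fix t :: real
    show "ennreal (indicator {0<..<1} t * (F t)\<^sup>2) = (\<Sum>n. ennreal (indicator {0<..<1} t * (gc n * t ^ n)))"
    proof (cases "t \<in> {0<..<1}")
      case True
      then have "(\<Sum>n. ennreal (gc n * t ^ n)) = ennreal ((F t)\<^sup>2)"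
        by (intro ennreal_sums gc_sums mult_nonneg_nonneg gc_nonneg zero_le_power) auto
      then show ?thesis using True by simp
    qed simp
  qed
  also have "\<dots> = (\<Sum>n. ennreal (gc n / real (Suc n)))"
    by (subst nn_integral_suminf) (simp_all add: pw)
  finally show ?thesis ..
qed

lemma neg_ln_1_minus_sums: "0 < t \<Longrightarrow> t < (1::real) \<Longrightarrow> (\<lambda>n. t ^ n / real (Suc n)) sums (- ln (1 - t) / t)"
proof -
  assume t: "0 < t" "t < 1"
  have e: "(- 1) ^ n * (1 / real (n + 1)) * (- t) ^ Suc n = - (t ^ Suc n / real (Suc n))" for n
  proof -
    have "(- 1) ^ n * (- t) ^ n = (- 1 * - t) ^ n" by (simp only: power_mult_distrib)
    also have "\<dots> = t ^ n" by simp
    finally have "(- 1) ^ n * (- t) ^ n = t ^ n" .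
    then have "(- 1) ^ n * (1 / real (n + 1)) * (- t) ^ Suc n = - (1 / real (n + 1) * (t * t ^ n))"
      by (simp only: power_Suc mult.assoc mult.left_commute) simp
    then show ?thesis by simp
  qed
  have "(\<lambda>n. - (t ^ Suc n / real (Suc n))) sums ln (1 - t)"
  proof -
    have "(\<lambda>n. (- 1) ^ n * (1 / real (n + 1)) * (- t) ^ Suc n) sums ln (1 + - t)"
    proof -
      have "ln (1 - t) = (\<Sum>n. (- 1) ^ n * (1 / real (n + 1)) * ((1 - t) - 1) ^ Suc n)"
        using t by (intro ln_series) auto
      moreover have "summable (\<lambda>n. (- 1) ^ n * (1 / real (n + 1)) * ((1 - t) - 1) ^ Suc n)"
      proof (rule summable_comparison_test'[where N = 0 and g = "\<lambda>n. t ^ Suc n"])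
        show "summable (\<lambda>n. t ^ Suc n)" using t summable_geometric[of t] by (subst summable_Suc_iff) auto
        show "norm ((- 1) ^ n * (1 / real (n + 1)) * ((1 - t) - 1) ^ Suc n) \<le> t ^ Suc n" for n
        proof -
          have m: "1 - t - 1 = - t" by simp
          have "norm ((- 1) ^ n * (1 / real (n + 1)) * (- t) ^ Suc n) = t ^ Suc n / real (Suc n)" unfolding e using t by simp
          also have "\<dots> \<le> t ^ Suc n / 1" using t by (intro divide_left_mono) auto
          finally show ?thesis unfolding m by simp
        qed
      qed
      ultimately show ?thesis by (simp add: sums_iff)
    qed
    then show ?thesis unfolding e by simp
  qed
  from sums_mult[OF this, of "- 1 / t"] show ?thesis using t by simp
qed

text \<open>Everything is nonnegative, so integrability is a by-product of the finite value that
  \<open>mF_gc\<close> and \<open>gc_weighted_sum\<close> give for the sum.\<close>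

lemma wF_log_integral:
  shows "(\<lambda>t. F t * F (1 - t) * (- ln (1 - t) / t)) absolutely_integrable_on {0<..<1}"
    and "integral {0<..<1} (\<lambda>t. F t * F (1 - t) * (- ln (1 - t) / t)) = 7 * zeta3 / pi"
proof -
  define L where "L = (\<lambda>t::real. - ln (1 - t) / t)"
  define w where "w = (\<lambda>t. F t * F (1 - t))"
  have we: "F t * F (1 - t) = w t" for t by (simp add: w_def)
  have wm: "(\<lambda>t. indicator {0<..<1} t * w t) \<in> borel_measurable borel"
  proof -
    have "(\<lambda>t. (indicator {0<..<1} t * F t) * (indicator {0<..<1} t * F (1 - t))) \<in> borel_measurable borel"
      by (intro borel_measurable_times F_measurable_Ioo)
    moreover have "(indicator {0<..<1} t * F t) * (indicator {0<..<1} t * F (1 - t)) = indicator {0<..<1} t * w t" for t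
      by (simp add: indicator_def w_def)
    ultimately show ?thesis by simp
  qed
  have Lm [measurable]: "L \<in> borel_measurable borel" unfolding L_def by measurable
  have wnn: "w t \<ge> 0" if "t \<in> {0<..<1}" for t
    unfolding w_def using that by (intro mult_nonneg_nonneg less_imp_le[OF F_pos]) auto
  have tm: "(\<lambda>t. indicator {0<..<1} t * (t ^ n * w t)) \<in> borel_measurable borel" for n
  proof -
    have "(\<lambda>t. t ^ n * (indicator {0<..<1} t * w t)) \<in> borel_measurable borel"
      by (intro borel_measurable_times wm) measurable
    then show ?thesis by (simp add: mult.left_commute)
  qed
  have M: "(\<integral>\<^sup>+t. ennreal (indicator {0<..<1} t * (t ^ n * w t)) \<partial>lborel) = ennreal (pi / 2 * gc n)" for n
    using absolutely_integrable_imp_nn_integral[OF mF_integrable[of n, unfolded we] _ tm] wnn mF_gc[of n]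
    unfolding mF_def we by simp
  have Lnn: "L t \<ge> 0" if "t \<in> {0<..<1}" for t using that by (auto simp: L_def divide_nonneg_pos divide_nonpos_pos)
  have nn: "0 \<le> indicator {0<..<1} t * (w t * L t)" for t using wnn[of t] Lnn[of t] by (simp add: indicator_def)
  have "(\<integral>\<^sup>+t. ennreal (indicator {0<..<1} t * (w t * L t)) \<partial>lborel) = (\<integral>\<^sup>+t. (\<Sum>n. ennreal (1 / real (Suc n)) * ennreal (indicator {0<..<1} t * (t ^ n * w t))) \<partial>lborel)"
  proof (intro nn_integral_cong)
    fix t :: real
    show "ennreal (indicator {0<..<1} t * (w t * L t)) = (\<Sum>n. ennreal (1 / real (Suc n)) * ennreal (indicator {0<..<1} t * (t ^ n * w t)))"
    proof (cases "t \<in> {0<..<1}")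
      case True
      have "(\<lambda>n. w t * (t ^ n / real (Suc n))) sums (w t * L t)" unfolding L_def using True by (intro sums_mult neg_ln_1_minus_sums) auto
      then have "(\<Sum>n. ennreal (w t * (t ^ n / real (Suc n)))) = ennreal (w t * L t)"
        by (rule ennreal_sums) (use True wnn in auto)
      moreover have "ennreal (w t * (t ^ n / real (Suc n))) = ennreal (1 / real (Suc n)) * ennreal (t ^ n * w t)" for n
        using True wnn[of t] by (simp add: ennreal_mult'[symmetric] mult_ac)
      ultimately show ?thesis using True by simp
    qed simp
  qed
  also have "\<dots> = (\<Sum>n. \<integral>\<^sup>+t. ennreal (1 / real (Suc n)) * ennreal (indicator {0<..<1} t * (t ^ n * w t)) \<partial>lborel)"
    using tm by (intro nn_integral_suminf borel_measurable_times_ennreal) auto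
  also have "\<dots> = (\<Sum>n. ennreal (pi / 2) * ennreal (gc n / real (Suc n)))"
  proof (intro suminf_cong)
    fix n
    have "(\<integral>\<^sup>+t. ennreal (1 / real (Suc n)) * ennreal (indicator {0<..<1} t * (t ^ n * w t)) \<partial>lborel) = ennreal (1 / real (Suc n)) * ennreal (pi / 2 * gc n)"
      using tm[of n] by (subst nn_integral_cmult) (simp_all add: M)
    then show "(\<integral>\<^sup>+t. ennreal (1 / real (Suc n)) * ennreal (indicator {0<..<1} t * (t ^ n * w t)) \<partial>lborel) = ennreal (pi / 2) * ennreal (gc n / real (Suc n))"
      using gc_nonneg[of n] by (simp add: ennreal_mult'[symmetric] del: of_nat_Suc)
  qed
  also have "\<dots> = ennreal (pi / 2 * (14 * zeta3 / pi\<^sup>2))"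
    by (subst ennreal_suminf_cmult) (simp add: gc_weighted_sum ennreal_mult'[symmetric] del: of_nat_Suc)
  also have "pi / 2 * (14 * zeta3 / pi\<^sup>2) = 7 * zeta3 / pi" by (simp add: power2_eq_square)
  finally have I: "(\<integral>\<^sup>+t. ennreal (indicator {0<..<1} t * (w t * L t)) \<partial>lborel) = ennreal (7 * zeta3 / pi)" .
  have "zeta3 \<ge> 0" by (rule sums_le[OF _ sums_zero zeta3_sums]) simp
  have mm: "(\<lambda>t. indicator {0<..<1} t * (w t * L t)) \<in> borel_measurable borel"
  proof -
    have "(\<lambda>t. (indicator {0<..<1} t * w t) * L t) \<in> borel_measurable borel" by (intro borel_measurable_times wm Lm)
    then show ?thesis by (simp add: mult.assoc)
  qed
  have "has_bochner_integral lborel (\<lambda>t. indicator {0<..<1} t * (w t * L t)) (7 * zeta3 / pi)"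
    by (rule has_bochner_integral_nn_integral[OF _ _ _ I]) (use mm nn \<open>zeta3 \<ge> 0\<close> in auto)
  then have i: "integrable lborel (\<lambda>t. indicator {0<..<1} t * (w t * L t))" "(\<integral>t. indicator {0<..<1} t * (w t * L t) \<partial>lborel) = 7 * zeta3 / pi"
    by (simp_all add: has_bochner_integral_iff)
  show "(\<lambda>t. F t * F (1 - t) * (- ln (1 - t) / t)) absolutely_integrable_on {0<..<1}"
    "integral {0<..<1} (\<lambda>t. F t * F (1 - t) * (- ln (1 - t) / t)) = 7 * zeta3 / pi"
    using lborel_integrable_imp_absolutely_integrable[OF i(1)] i(2) unfolding w_def L_def by simp_all
qed

lemma zeta_integral:
  shows "(\<lambda>k. 2 * k / (1 - k\<^sup>2) * ellK k * ellK' k * ln k) absolutely_integrable_on {0<..<1}"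
    and "integral {0<..<1} (\<lambda>k. 2 * k / (1 - k\<^sup>2) * ellK k * ellK' k * ln k) = - (7 * pi * zeta3 / 8)"
proof -
  \<comment> \<open>Under t = 1 - k^2 the product of the two solutions is unchanged, dt supplies 2k,
    and ln (1 - t) = 2 ln k. The factor pi^2 / 8 is pi^2 / 4 from the two elliptic integrals, halved
    for that 2.\<close>
  define f where "f = (\<lambda>t. - (pi\<^sup>2 / 8) * (F t * F (1 - t) * (- ln (1 - t) / t)))"
  have sq: "0 < x\<^sup>2 \<and> x\<^sup>2 < 1" if "0 < x" "x < 1" for x :: real
    using that power_less_one_iff[of x 2] by simp
  have "x \<in> (\<lambda>k. 1 - k\<^sup>2) ` {0<..<1}" if "0 < x" "x < 1" for x :: real
  proof (rule image_eqI)
    show "x = 1 - (sqrt (1 - x))\<^sup>2" "sqrt (1 - x) \<in> {0<..<1}" using that by auto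
  qed
  then have im: "(\<lambda>k. 1 - k\<^sup>2) ` {0<..<1::real} = {0<..<1}" using sq by auto
  have d: "((\<lambda>k. 1 - k\<^sup>2) has_field_derivative - 2 * x) (at x)" for x :: real by (auto intro!: derivative_eq_intros)
  have i: "inj_on (\<lambda>k. 1 - k\<^sup>2) {0<..<1::real}" by (auto simp: inj_on_def power2_eq_iff_nonneg)
  have eq: "\<bar>- 2 * x\<bar> * f (1 - x\<^sup>2) = 2 * x / (1 - x\<^sup>2) * ellK x * ellK' x * ln x" if "x \<in> {0<..<1}" for x :: real
  proof -
    have "ln (x\<^sup>2) = 2 * ln x" using that by (simp add: ln_realpow)
    moreover define D where "D = 1 - x\<^sup>2"
    moreover have "D \<noteq> 0" "D > 0" using sq[of x] that by (auto simp: D_def)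
    moreover have "1 - D = x\<^sup>2" by (simp add: D_def)
    ultimately show ?thesis using that unfolding f_def ellK_def ellK'_def hyp2F1_eq_F by (simp add: field_simps power2_eq_square)
  qed
  have "f absolutely_integrable_on {0<..<1}" unfolding f_def
    using wF_log_integral(1) by (intro set_integrable_mult_right) auto
  moreover have "integral {0<..<1} f = - (7 * pi * zeta3 / 8)"
    unfolding f_def integral_mult_right wF_log_integral(2) by (simp add: power2_eq_square)
  ultimately show "(\<lambda>k. 2 * k / (1 - k\<^sup>2) * ellK k * ellK' k * ln k) absolutely_integrable_on {0<..<1}"
    "integral {0<..<1} (\<lambda>k. 2 * k / (1 - k\<^sup>2) * ellK k * ellK' k * ln k) = - (7 * pi * zeta3 / 8)"
    using change_of_variables_Ioo[OF d i eq, of "- (7 * pi * zeta3 / 8)"] unfolding im by simp_all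
qed

section \<open>The two integrals\<close>

lemma C4_h: "0 < s \<Longrightarrow> s < 1 \<Longrightarrow> C4 (h s) = sqrt s * (1 + s) * (F s) ^ 4 / 4"
  using sums_unique[OF weight4_odd_sums[of s]] unfolding C4_def od_def by simp

lemma Gk_h: "0 < s \<Longrightarrow> s < 1 \<Longrightarrow> Gk (h s) = - ln s / 16"
proof -
  assume s: "0 < s" "s < 1"
  have "- pi / h s = - pi * h (1 - s)" using h_reflect[OF s] by simp
  then have "kap (exp (- pi / h s)) = sqrt s" using modular_param(5)[of "1 - s"] s by simp
  then show ?thesis using s by (simp add: Gk_def ln_sqrt)
qed

lemma C4_Gk_integral:
  "has_bochner_integral lborel (\<lambda>x. indicator {0<..} x * (x * C4 x * Gk x)) (6 / pi ^ 4 * Re (\<Sum>n. etac (Suc n) / of_nat (Suc n) ^ 4))"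
proof -
  define V where "V = 96 / pi ^ 4 * Re (\<Sum>n. etac (Suc n) / of_nat (Suc n) ^ 4)"
  define e where "e = (\<lambda>x::real. indicator {0<..} x * (x ^ 3 * etaq (exp (- (pi * x / 2)))))"
  have hb: "has_bochner_integral lborel e V" unfolding e_def V_def by (rule eta_mellin)
  have enn: "e x \<ge> 0" for x
  proof -
    have "etaq q \<ge> 0" if "q \<ge> 0" for q :: real
      unfolding etaq_def using that by (intro mult_nonneg_nonneg zero_le_even_power) auto
    then show ?thesis by (simp add: e_def indicator_def)
  qed
  have V: "V \<ge> 0" using hb enn by (auto simp: has_bochner_integral_iff intro: Bochner_Integration.integral_nonneg)
  have nn: "0 \<le> indicator {0<..} x * (x * C4 x * Gk x)" for x
  proof (cases "x > 0")
    case True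
    then have "x \<in> h ` {0<..<1}" unfolding h_image by simp
    then obtain s where s: "0 < s" "s < 1" "x = h s" by auto
    have "C4 x \<ge> 0" unfolding s(3) C4_h[OF s(1,2)] using s by simp
    moreover have "Gk x \<ge> 0" unfolding s(3) Gk_h[OF s(1,2)] using s by simp
    ultimately show ?thesis using True by simp
  qed simp
  \<comment> \<open>Measurability of the integrand is inherited from the four-fold sum of explicit
    terms.\<close>
  have "(\<lambda>x. ennreal (indicator {0<..} x * (x * C4 x * Gk x))) = (\<lambda>x. \<Sum>b. \<Sum>a. \<Sum>i. \<Sum>j. RZT b a i j x)"
  proof
    fix x :: real
    show "ennreal (indicator {0<..} x * (x * C4 x * Gk x)) = (\<Sum>b. \<Sum>a. \<Sum>i. \<Sum>j. RZT b a i j x)"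
    proof (cases "x > 0")
      case True
      then show ?thesis unfolding RZT_sum[OF True] by simp
    next
      case False
      then have "RZT b a i j x = 0" for b a i j by (simp add: RZT_def)
      then show ?thesis using False by simp
    qed
  qed
  moreover have "(\<lambda>x. \<Sum>b. \<Sum>a. \<Sum>i. \<Sum>j. RZT b a i j x) \<in> borel_measurable borel" by measurable
  ultimately have "(\<lambda>x. ennreal (indicator {0<..} x * (x * C4 x * Gk x))) \<in> borel_measurable borel" by simp
  then have "(\<lambda>x. enn2real (ennreal (indicator {0<..} x * (x * C4 x * Gk x)))) \<in> borel_measurable borel" by measurable
  then have m: "(\<lambda>x. indicator {0<..} x * (x * C4 x * Gk x)) \<in> borel_measurable borel" using nn by simp
  have "(\<integral>\<^sup>+x. ennreal (indicator {0<..} x * (x * C4 x * Gk x)) \<partial>lborel) = (\<integral>\<^sup>+x. ennreal (x * C4 x * Gk x) * indicator {0<..} x \<partial>lborel)"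
    by (intro nn_integral_cong) (simp add: indicator_def)
  also have "\<dots> = (\<integral>\<^sup>+x. ennreal (e x / 16) \<partial>lborel)"
    unfolding rogers_zudilin by (intro nn_integral_cong) (simp add: e_def indicator_def)
  also have "\<dots> = ennreal (V / 16)"
  proof -
    have "has_bochner_integral lborel (\<lambda>x. e x / 16) (V / 16)" using hb by (rule has_bochner_integral_divide_zero)
    then show ?thesis using enn by (auto simp: has_bochner_integral_iff nn_integral_eq_integral)
  qed
  finally have I: "(\<integral>\<^sup>+x. ennreal (indicator {0<..} x * (x * C4 x * Gk x)) \<partial>lborel) = ennreal (V / 16)" .
  have "has_bochner_integral lborel (\<lambda>x. indicator {0<..} x * (x * C4 x * Gk x)) (V / 16)"
    by (rule has_bochner_integral_nn_integral[OF _ _ _ I]) (use m nn V in auto)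
  then show ?thesis unfolding V_def by simp
qed

lemma eta_integral:
  defines "L \<equiv> Re (\<Sum>n. etac (Suc n) / of_nat (Suc n) ^ 4)"
  shows "(\<lambda>k. (1 + k\<^sup>2) / (1 - k\<^sup>2) * ellK k * ellK' k * ln k) absolutely_integrable_on {0<..<1}"
    and "integral {0<..<1} (\<lambda>k. (1 + k\<^sup>2) / (1 - k\<^sup>2) * ellK k * ellK' k * ln k) = - (24 / pi * L)"
proof -
  \<comment> \<open>The factor is chosen so that the change of variables x = h(k^2) produces the
    stated integrand exactly, with \<open>C4_h\<close> and \<open>Gk_h\<close> for the two factors;
    times 6 / pi^4 it gives - 24 / pi.\<close>
  define f where "f = (\<lambda>x. - 4 * pi ^ 3 * (x * C4 x * Gk x))"
  define g where "g = (\<lambda>k. h (k\<^sup>2))"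
  define g' where "g' = (\<lambda>k. - 1 / (pi * k\<^sup>2 * (1 - k\<^sup>2) * (F (k\<^sup>2))\<^sup>2) * (2 * k))"
  have sq: "0 < x\<^sup>2 \<and> x\<^sup>2 < 1" if "x \<in> {0<..<1}" for x :: real
    using that power_less_one_iff[of x 2] by simp
  have "x \<in> (\<lambda>k. k\<^sup>2) ` {0<..<1}" if "0 < x" "x < 1" for x :: real
    using that by (intro image_eqI[of _ _ "sqrt x"]) auto
  then have "(\<lambda>k. k\<^sup>2) ` {0<..<1::real} = {0<..<1}" using sq by auto
  then have im: "g ` {0<..<1} = {0<..}" unfolding g_def h_image[symmetric] by (metis image_image)
  have d: "(g has_field_derivative g' x) (at x)" if "x \<in> {0<..<1}" for x
  proof -
    have "((\<lambda>k. k\<^sup>2) has_field_derivative 2 * x) (at x)" by (auto intro!: derivative_eq_intros)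
    then show ?thesis unfolding g_def g'_def using sq[OF that] by (intro DERIV_chain2[OF h_deriv]) auto
  qed
  have i: "inj_on g {0<..<1}"
  proof (rule inj_onI)
    fix x y :: real assume xy: "x \<in> {0<..<1}" "y \<in> {0<..<1}" "g x = g y"
    then have "x\<^sup>2 = y\<^sup>2" using inj_onD[OF h_inj, of "x\<^sup>2" "y\<^sup>2"] sq by (simp add: g_def)
    then show "x = y" using xy by (simp add: power2_eq_iff_nonneg)
  qed
  have eq: "\<bar>g' k\<bar> * f (g k) = (1 + k\<^sup>2) / (1 - k\<^sup>2) * ellK k * ellK' k * ln k" if k: "k \<in> {0<..<1}" for k
  proof -
    define s where "s = k\<^sup>2"
    have s: "0 < s" "s < 1" using sq[OF k] by (auto simp: s_def)
    have sk: "sqrt s = k" "ln s = 2 * ln k" using k by (simp_all add: s_def ln_realpow)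
    define a b u where "a = F s" and "b = F (1 - s)" and "u = 1 - s"
    have pos: "a > 0" "u > 0" "k > 0" using s k by (auto simp: a_def u_def intro: F_pos)
    have 1: "\<bar>g' k\<bar> = 2 * k / (pi * s * u * a\<^sup>2)"
      using s pos unfolding g'_def s_def[symmetric] a_def[symmetric] u_def[symmetric] by (simp add: abs_mult)
    have 2: "f (g k) = - 4 * pi ^ 3 * ((b / a) * (k * (1 + s) * a ^ 4 / 4) * (- (2 * ln k) / 16))"
      unfolding f_def g_def s_def[symmetric] C4_h[OF s] Gk_h[OF s] sk by (simp add: h_def a_def b_def)
    have 3: "ellK k = pi / 2 * a" "ellK' k = pi / 2 * b"
      by (simp_all add: ellK_def ellK'_def hyp2F1_eq_F s_def[symmetric] a_def b_def)
    have sk2: "s = k * k" by (simp add: s_def power2_eq_square)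
    show ?thesis unfolding 1 2 3 s_def[symmetric] u_def[symmetric]
      using pos by (simp add: divide_simps sk2) (simp add: eval_nat_numeral)
  qed
  have hb: "has_bochner_integral lborel (\<lambda>x. indicator {0<..} x * (x * C4 x * Gk x)) (6 / pi ^ 4 * L)"
    unfolding L_def by (rule C4_Gk_integral)
  then have li: "integrable lborel (\<lambda>x. indicator {0<..} x * (x * C4 x * Gk x))"
    "(\<integral>x. indicator {0<..} x * (x * C4 x * Gk x) \<partial>lborel) = 6 / pi ^ 4 * L" by (auto simp: has_bochner_integral_iff)
  note m = lborel_integrable_imp_absolutely_integrable[OF li(1)]
  have f1: "f absolutely_integrable_on g ` {0<..<1}" unfolding im f_def using m(1) by (intro set_integrable_mult_right) auto
  have "integral {0<..} f = - 4 * pi ^ 3 * (6 / pi ^ 4 * L)" unfolding f_def integral_mult_right using m(2) li(2) by simp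
  then have f2: "integral (g ` {0<..<1}) f = - (24 / pi * L)" unfolding im by (simp add: eval_nat_numeral)
  show "(\<lambda>k. (1 + k\<^sup>2) / (1 - k\<^sup>2) * ellK k * ellK' k * ln k) absolutely_integrable_on {0<..<1}"
    "integral {0<..<1} (\<lambda>k. (1 + k\<^sup>2) / (1 - k\<^sup>2) * ellK k * ellK' k * ln k) = - (24 / pi * L)"
    using change_of_variables_Ioo[OF d i eq f1 f2] by blast+
qed

lemma zeta_series_3: "zeta_series 3 = of_real zeta3"
proof -
  have "(\<lambda>n. of_real (1 / real (Suc n) ^ 3) :: complex) sums of_real zeta3" using zeta3_sums by (rule sums_of_real)
  moreover have "(of_real (1 / real (Suc n) ^ 3) :: complex) = 1 / of_nat (Suc n) powr 3" for n
    unfolding powr_complexnumeral by (simp del: of_nat_Suc)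
  ultimately show ?thesis unfolding zeta_series_def by (simp add: sums_iff)
qed

text \<open>The definite description, the infinite sum and the integral are total operations, so the
  expansion, the convergence of the Dirichlet series and both integrabilities are asserted beside
  the two identities to secure their intended meaning.\<close>

theorem theorem2p1:
  shows "(\<forall>\<tau>. Im \<tau> > 0 \<longrightarrow>
            (\<lambda>n. q_coeff eta_form (Suc n) * exp (2 * of_real pi * \<i> * \<tau>) ^ Suc n)
              sums eta_form \<tau>) \<and>
         summable (\<lambda>n. q_coeff eta_form (Suc n) / of_nat (Suc n) powr 4) \<and>
         (\<lambda>k::real. (1 + k\<^sup>2) / (1 - k\<^sup>2) * ellK k * ellK' k * ln k) integrable_on {0<..<1} \<and>
         (\<lambda>k::real. 2 * k / (1 - k\<^sup>2) * ellK k * ellK' k * ln k) integrable_on {0<..<1} \<and>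
         192 / of_real pi * L_series eta_form 4 =
           of_real (- 8 * integral {0<..<1}
             (\<lambda>k::real. (1 + k\<^sup>2) / (1 - k\<^sup>2) * ellK k * ellK' k * ln k)) \<and>
         7 * of_real pi * zeta_series 3 =
           of_real (- 8 * integral {0<..<1}
             (\<lambda>k::real. 2 * k / (1 - k\<^sup>2) * ellK k * ellK' k * ln k))"
proof (intro conjI allI impI)
  fix \<tau> :: complex assume t: "Im \<tau> > 0"
  define z where "z = exp (2 * of_real pi * \<i> * \<tau>)"
  have z: "norm z < 1" "eta_form \<tau> = etaq z" using eta_form_etaq[OF t] by (simp_all add: z_def)
  have "(\<lambda>n. etac (Suc n) * z ^ Suc n) sums etaq z"
    using etac_sums[OF z(1)] etac_0 sums_Suc_iff[of "\<lambda>n. etac n * z ^ n" "etaq z"] by simp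
  then show "(\<lambda>n. q_coeff eta_form (Suc n) * exp (2 * of_real pi * \<i> * \<tau>) ^ Suc n) sums eta_form \<tau>"
    unfolding q_coeff_eta_form z_def[symmetric] z(2) .
next
  have "summable (\<lambda>n. norm (etac (Suc n) / of_nat (Suc n) ^ 4))"
    using etac_summable by (simp add: norm_divide norm_power del: of_nat_Suc)
  then show "summable (\<lambda>n. q_coeff eta_form (Suc n) / of_nat (Suc n) powr 4)"
    unfolding q_coeff_eta_form powr_complexnumeral by (rule summable_norm_cancel)
next
  show "(\<lambda>k::real. (1 + k\<^sup>2) / (1 - k\<^sup>2) * ellK k * ellK' k * ln k) integrable_on {0<..<1}"
    by (rule set_lebesgue_integral_eq_integral(1)[OF eta_integral(1)])
  show "(\<lambda>k::real. 2 * k / (1 - k\<^sup>2) * ellK k * ellK' k * ln k) integrable_on {0<..<1}"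
    by (rule set_lebesgue_integral_eq_integral(1)[OF zeta_integral(1)])
next
  define S where "S = (\<Sum>n. etac (Suc n) / of_nat (Suc n) ^ 4)"
  \<comment> \<open>\<open>eta_integral\<close> speaks of the real part only; the vanishing
    imaginary part makes this the full L-value.\<close>
  have "S = of_real (Re S)" using eta_mellin(2) by (simp add: S_def complex_eq_iff)
  moreover have "L_series eta_form 4 = S" unfolding L_series_def q_coeff_eta_form powr_complexnumeral S_def ..
  ultimately have L: "L_series eta_form 4 = of_real (Re S)" by simp
  show "192 / of_real pi * L_series eta_form 4 =
           of_real (- 8 * integral {0<..<1} (\<lambda>k::real. (1 + k\<^sup>2) / (1 - k\<^sup>2) * ellK k * ellK' k * ln k))"
    unfolding L eta_integral(2) S_def[symmetric] by simp
next
  show "7 * of_real pi * zeta_series 3 =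
           of_real (- 8 * integral {0<..<1} (\<lambda>k::real. 2 * k / (1 - k\<^sup>2) * ellK k * ellK' k * ln k))"
    unfolding zeta_series_3 zeta_integral(2) by simp
qed

end
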